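(* Let $A$ be a finite set, $n\ge3$, and let $\rho\subseteq A^n$ be an essential key relation preserved by a WNU, whose pattern is the full equivalence relation on $\{1,\dots,n\}$. Then: (1) every block of $\rho$ equals $B_1\times\dots\times B_n$ for some $B_1,\dots,B_n\subseteq A$; (2) for every nontrivial block $\boldsymbol B=B_1\times\dots\times B_n$ there exist an abelian group $(G;+)$ whose order is a power of a prime and surjective maps $\phi_i:B_i\to G$ ($i=1,\dots,n$) such that $$\rho\cap\boldsymbol B=\{(x_1,\dots,x_n)\in\boldsymbol B:\ \phi_1(x_1)+\dots+\phi_n(x_n)=0\}.$$
   Context: A tuple $\alpha\in A^n\setminus\rho$ is essential for $\rho$ if for every $i$ some tuple obtained from $\alpha$ by changing only its $i$-th coordinate lies in $\rho$. $\widetilde\rho$ denotes $\rho$ together with all essential tuples for $\rho$. Consider the graph whose vertices are the tuples of $\widetilde\rho$, two tuples being adjacent if they differ in exactly one coordinate; a block of $\rho$ is a connected component of this graph, and a block is trivial if it contains only tuples of $\rho$ (nontrivial otherwise). A unary vector-function is a tuple $\Psi=(\psi_1,\dots,\psi_n)$ of maps $\psi_i:A\to A$ acting coordinatewise; it preserves $\rho$ if $\Psi(\rho)\subseteq\rho$. $\rho$ is a key relation if there is $\beta\in A^n\setminus\rho$ (a key tuple) such that every $\alpha\in A^n\setminus\rho$ is mapped to $\beta$ by some unary vector-function preserving $\rho$. $\rho$ is essential if it cannot be written as a conjunction of relations of smaller arities. A WNU is an $m$-ary ($m\ge2$) operation $f$ on $A$ with $f(x,\dots,x)=x$ and $f(y,x,\dots,x)=f(x,y,x,\dots,x)=\dots=f(x,\dots,x,y)$;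 it preserves $\rho$ if applying it coordinatewise to any $m$ tuples of $\rho$ gives a tuple of $\rho$. The pattern of $\rho$: for $i\ne j$, $i\overset{\rho}{\sim}j$ iff there do NOT exist $a_1,\dots,a_n,b_i,b_j\in A$ with $(a_1,\dots,a_n)\notin\rho$ while the tuples obtained by replacing $a_i$ by $b_i$, replacing $a_j$ by $b_j$, and replacing both, all lie in $\rho$; the pattern is full if $i\overset{\rho}{\sim}j$ for all $i,j$. *)

theory Defs
  imports "HOL-Algebra.Algebra" "HOL-Computational_Algebra.Primes"
begin

text \<open>Tuples of A^n are lists of length n over A; coordinates are indexed 0..n-1.\<close>

definition tuples :: "'a set \<Rightarrow> nat \<Rightarrow> 'a list set" where
  "tuples A n = {xs. length xs = n \<and> set xs \<subseteq> A}"

definition essential_tuple :: "'a set \<Rightarrow> nat \<Rightarrow> 'a list set \<Rightarrow> 'a list \<Rightarrow> bool" where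
  "essential_tuple A n \<rho> \<alpha> \<longleftrightarrow>
     \<alpha> \<in> tuples A n - \<rho> \<and> (\<forall>i<n. \<exists>b\<in>A. \<alpha>[i := b] \<in> \<rho>)"

definition rho_tilde :: "'a set \<Rightarrow> nat \<Rightarrow> 'a list set \<Rightarrow> 'a list set" where
  "rho_tilde A n \<rho> = \<rho> \<union> {\<alpha>. essential_tuple A n \<rho> \<alpha>}"

definition differ_in_one :: "nat \<Rightarrow> 'a list \<Rightarrow> 'a list \<Rightarrow> bool" where
  "differ_in_one n x y \<longleftrightarrow> card {i. i < n \<and> x ! i \<noteq> y ! i} = 1"

definition block_graph :: "'a set \<Rightarrow> nat \<Rightarrow> 'a list set \<Rightarrow> ('a list \<times> 'a list) set" where
  "block_graph A n \<rho> =
     {(x, y). x \<in> rho_tilde A n \<rho> \<and> y \<in> rho_tilde A n \<rho> \<and> differ_in_one n x y}"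

definition is_block :: "'a set \<Rightarrow> nat \<Rightarrow> 'a list set \<Rightarrow> 'a list set \<Rightarrow> bool" where
  "is_block A n \<rho> B \<longleftrightarrow>
     (\<exists>x\<in>rho_tilde A n \<rho>. B = {y. (x, y) \<in> (block_graph A n \<rho>)\<^sup>*})"

definition nontrivial_block :: "'a set \<Rightarrow> nat \<Rightarrow> 'a list set \<Rightarrow> 'a list set \<Rightarrow> bool" where
  "nontrivial_block A n \<rho> B \<longleftrightarrow> is_block A n \<rho> B \<and> \<not> B \<subseteq> \<rho>"

definition apply_vf :: "nat \<Rightarrow> (nat \<Rightarrow> 'a \<Rightarrow> 'a) \<Rightarrow> 'a list \<Rightarrow> 'a list" where
  "apply_vf n \<Psi> x = map (\<lambda>i. \<Psi> i (x ! i)) [0..<n]"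

definition vf_preserves :: "'a set \<Rightarrow> nat \<Rightarrow> 'a list set \<Rightarrow> (nat \<Rightarrow> 'a \<Rightarrow> 'a) \<Rightarrow> bool" where
  "vf_preserves A n \<rho> \<Psi> \<longleftrightarrow>
     (\<forall>i<n. \<Psi> i ` A \<subseteq> A) \<and> (\<forall>x\<in>\<rho>. apply_vf n \<Psi> x \<in> \<rho>)"

definition key_relation :: "'a set \<Rightarrow> nat \<Rightarrow> 'a list set \<Rightarrow> bool" where
  "key_relation A n \<rho> \<longleftrightarrow>
     (\<exists>\<beta>\<in>tuples A n - \<rho>. \<forall>\<alpha>\<in>tuples A n - \<rho>.
        \<exists>\<Psi>. vf_preserves A n \<rho> \<Psi> \<and> apply_vf n \<Psi> \<alpha> = \<beta>)"

definition determined_by :: "'a set \<Rightarrow> nat \<Rightarrow> nat set \<Rightarrow> 'a list set \<Rightarrow> bool" where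
  "determined_by A n S \<sigma> \<longleftrightarrow>
     (\<forall>x\<in>tuples A n. \<forall>y\<in>tuples A n. (\<forall>i\<in>S. x ! i = y ! i) \<longrightarrow> (x \<in> \<sigma> \<longleftrightarrow> y \<in> \<sigma>))"

text \<open>Essential: not a conjunction of relations of smaller arities, i.e. not an
  intersection of relations each depending only on a proper subset of coordinates.\<close>
definition essential_rel :: "'a set \<Rightarrow> nat \<Rightarrow> 'a list set \<Rightarrow> bool" where
  "essential_rel A n \<rho> \<longleftrightarrow>
     \<not> (\<exists>F. (\<forall>\<sigma>\<in>F. \<exists>S. S \<subset> {0..<n} \<and> determined_by A n S \<sigma>)
            \<and> \<rho> = tuples A n \<inter> \<Inter>F)"

definition is_wnu :: "'a set \<Rightarrow> nat \<Rightarrow> ('a list \<Rightarrow> 'a) \<Rightarrow> bool" where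
  "is_wnu A m f \<longleftrightarrow> 2 \<le> m \<and>
     (\<forall>xs\<in>tuples A m. f xs \<in> A) \<and>
     (\<forall>x\<in>A. f (replicate m x) = x) \<and>
     (\<forall>x\<in>A. \<forall>y\<in>A. \<forall>i<m. f ((replicate m x)[i := y]) = f ((replicate m x)[0 := y]))"

definition op_preserves :: "nat \<Rightarrow> 'a list set \<Rightarrow> nat \<Rightarrow> ('a list \<Rightarrow> 'a) \<Rightarrow> bool" where
  "op_preserves n \<rho> m f \<longleftrightarrow>
     (\<forall>r :: nat \<Rightarrow> 'a list. (\<forall>j<m. r j \<in> \<rho>) \<longrightarrow>
        map (\<lambda>i. f (map (\<lambda>j. r j ! i) [0..<m])) [0..<n] \<in> \<rho>)"

definition pattern_rel :: "'a set \<Rightarrow> nat \<Rightarrow> 'a list set \<Rightarrow> nat \<Rightarrow> nat \<Rightarrow> bool" where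
  "pattern_rel A n \<rho> i j \<longleftrightarrow>
     \<not> (\<exists>a\<in>tuples A n. \<exists>bi\<in>A. \<exists>bj\<in>A. a \<notin> \<rho> \<and> a[i := bi] \<in> \<rho> \<and> a[j := bj] \<in> \<rho>
          \<and> a[i := bi, j := bj] \<in> \<rho>)"

definition full_pattern :: "'a set \<Rightarrow> nat \<Rightarrow> 'a list set \<Rightarrow> bool" where
  "full_pattern A n \<rho> \<longleftrightarrow> (\<forall>i<n. \<forall>j<n. i \<noteq> j \<longrightarrow> pattern_rel A n \<rho> i j)"

end

theory Submission
  imports Defs
begin

text \<open>
  Nesting the WNU \<open>f\<close> makes it special: \<open>x \<circ> (x \<circ> y) = x \<circ> y\<close> for \<open>x \<circ> y = f(x,\<dots>,x,y)\<close>. For a tuple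
  \<open>c\<close> of the relation, \<open>y \<mapsto> c \<circ> y\<close> and \<open>y \<mapsto> y \<circ> c\<close> are vector-functions preserving the relation. Retract
  the relation to a core of minimal size around the key tuple \<open>\<beta>\<close>: there a preserving vector-function that
  keeps \<open>\<beta>\<close> outside the relation is injective, so \<open>y \<mapsto> c \<circ> y\<close> is the identity as soon as \<open>c \<circ> \<beta>\<close>
  is outside the relation. Together with the rectangularity expressed by the full pattern and \<open>n \<ge> 3\<close> this
  forces \<open>x \<circ> y = y\<close> on the block of \<open>\<beta>\<close> in the core, which is therefore a product. On a product block
  where \<open>x \<circ> y\<close> is a twin of \<open>y\<close>, the operation \<open>u + v = f(u,v,0,\<dots>,0)\<close> makes the twin classes an
  abelian group, and the relation becomes a linear equation.

  Every tuple outside the original relation is sent to \<open>\<beta>\<close> by a preserving map \<open>\<Psi>\<close> into the core. Composing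
  \<open>\<Psi>\<close> with the linear structure of the core shows that \<open>x \<circ> a\<close> and \<open>a\<close> are indistinguishable
  within a block of the original relation; hence its blocks are products of the same kind. Finally
  \<open>\<Psi>\<close> carries multiples to multiples, so the value of \<open>\<beta>\<close> has prime order \<open>p\<close> and every nonzero group element
  of every block has order divisible by \<open>p\<close>; Cauchy's theorem gives prime power order.
\<close>

section \<open>Idempotent powers\<close>

text \<open>Specialness serves twice. In the core it makes left translations idempotent, so that
  injectivity, which is all that minimality gives, already turns them into the identity. Outside the
  core translations need not be injective; there it replaces a division by the arity
  \<open>m\<close>, which need not be invertible in the group.

  The obstacle on the way back from the core is that a key map controls only the bad tuple, which it
  sends to \<beta>, whereas the linear equation is known only on the block \<open>V\<close> of
  \<beta>. \<open>V_corner\<close> is proved inside the core for this purpose: it puts the opposite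
  corner of a square into \<open>V\<close>, so that the equation can be used on the whole square.

  Three coordinates are the recurring resource: two repairs of one tuple can be stored in different
  coordinates, where they do not interfere when tuples are combined. This is how rectangles close up
  and how the sum of two elements becomes well defined up to twins.\<close>

lemma funpow_closed:
  assumes "h ` A \<subseteq> A" "x \<in> A"
  shows "(h ^^ k) x \<in> A"
  using assms by (induction k) auto

lemma funpow_eventually_periodic:
  assumes "finite A" "h ` A \<subseteq> A" "x \<in> A"
  obtains s d where "d > 0" "(h ^^ (s + d)) x = (h ^^ s) x"
proof -
  have "range (\<lambda>k. (h ^^ k) x) \<subseteq> A" using funpow_closed[OF assms(2,3)] by auto
  then have "finite (range (\<lambda>k. (h ^^ k) x))" using assms(1) finite_subset by blast
  then have "\<not> inj (\<lambda>k. (h ^^ k) x)" using finite_imageD by fastforce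
  then obtain a b where ab: "a < b" "(h ^^ a) x = (h ^^ b) x"
    unfolding inj_def by (metis linorder_neqE_nat)
  then show thesis using that[of "b - a" a] by simp
qed

lemma funpow_periodic_mult:
  fixes h :: "'a \<Rightarrow> 'a"
  assumes "(h ^^ (s + d)) x = (h ^^ s) x" "s \<le> t"
  shows "(h ^^ (t + k * d)) x = (h ^^ t) x"
proof -
  have 1: "(h ^^ (s + k * d)) x = (h ^^ s) x" for k
  proof (induction k)
    case (Suc k)
    have "(h ^^ (s + Suc k * d)) x = (h ^^ (k * d)) ((h ^^ (s + d)) x)"
      by (simp add: funpow_add[symmetric, THEN fun_cong, unfolded o_def] algebra_simps)
    also have "\<dots> = (h ^^ (s + k * d)) x"
      unfolding assms(1) by (simp add: funpow_add[symmetric, THEN fun_cong, unfolded o_def] algebra_simps)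
    finally show ?case using Suc by simp
  qed simp
  have "(h ^^ (t + k * d)) x = (h ^^ (t - s)) ((h ^^ (s + k * d)) x)"
    using assms(2) by (simp add: funpow_add[symmetric, THEN fun_cong, unfolded o_def])
  also have "\<dots> = (h ^^ t) x"
    unfolding 1 using assms(2) by (simp add: funpow_add[symmetric, THEN fun_cong, unfolded o_def])
  finally show ?thesis .
qed

text \<open>An iterate is idempotent once its exponent is a multiple of the period and not below the
  preperiod, and finitely many points admit a common such exponent. It is applied to all
  translations of a WNU at once, and to all coordinates of a retraction.\<close>

lemma common_idempotent_power:
  assumes "finite I" "\<And>i. i \<in> I \<Longrightarrow> finite (A i) \<and> h i ` A i \<subseteq> A i"
  obtains N where "N > 0" "\<And>i x. i \<in> I \<Longrightarrow> x \<in> A i \<Longrightarrow> (h i ^^ N) ((h i ^^ N) x) = (h i ^^ N) x"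
proof -
  have "\<exists>s d. d > 0 \<and> (h i ^^ (s + d)) x = (h i ^^ s) x" if "i \<in> I" "x \<in> A i" for i x
    using funpow_eventually_periodic[of "A i" "h i" x] assms(2) that by metis
  then obtain s d where sd: "\<And>i x. i \<in> I \<Longrightarrow> x \<in> A i \<Longrightarrow> d i x > (0::nat) \<and> (h i ^^ (s i x + d i x)) x = (h i ^^ s i x) x"
    by metis
  define P where "P = Sigma I A"
  have fP: "finite P" unfolding P_def using assms by auto
  \<comment> \<open>The product is a multiple of every period; the second factor lifts it to at
    least every preperiod and keeps it positive.\<close>
  define N where "N = (\<Prod>(i,x)\<in>P. d i x) * Suc (\<Sum>(i,x)\<in>P. s i x)"
  have pos: "(\<Prod>(i,x)\<in>P. d i x) > 0" using sd by (auto simp: P_def intro!: prod_pos)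
  show thesis
  proof (rule that[of N])
    show "N > 0" using pos by (simp add: N_def)
    fix i x assume ix: "i \<in> I" "x \<in> A i"
    then have inP: "(i,x) \<in> P" by (simp add: P_def)
    have "s i x \<le> (\<Sum>(i,x)\<in>P. s i x)"
      using member_le_sum[OF inP, of "\<lambda>(i,x). s i x"] fP by auto
    also have "\<dots> \<le> N" unfolding N_def using pos by (cases "\<Prod>(i,x)\<in>P. d i x") auto
    finally have le: "s i x \<le> N" .
    have "d i x dvd (\<Prod>(i,x)\<in>P. d i x)" using dvd_prodI[OF fP inP, of "\<lambda>(i,x). d i x"] by simp
    then have "d i x dvd N" unfolding N_def by simp
    then obtain k where "N = k * d i x" by (metis dvd_div_mult_self)
    then show "(h i ^^ N) ((h i ^^ N) x) = (h i ^^ N) x"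
      using funpow_periodic_mult[of "s i x" "d i x" "h i" x N k] sd[OF ix] le
      by (simp add: funpow_add)
  qed
qed

section \<open>Weak near-unanimity polymorphisms of multi-sorted relations\<close>

text \<open>From here on a tuple is a function on the natural numbers of which only the values below \<open>n\<close> matter, the
  \<open>i\<close>-th coordinate ranges over its own set \<open>C i\<close>, and an operation of arity \<open>m\<close> is a family
  \<open>f i\<close> of operations whose argument list is given by a function on the positions below \<open>m\<close>.\<close>

definition circ :: "(nat \<Rightarrow> (nat \<Rightarrow> 'a) \<Rightarrow> 'a) \<Rightarrow> nat \<Rightarrow> 'a \<Rightarrow> 'a \<Rightarrow> 'a" where
  "circ f i x y = f i ((\<lambda>_. x)(0 := y))"

text \<open>Sorts and operations vary with the coordinate because a retraction follows
  \<open>f\<close> by a different map in each coordinate. The clauses for constant and nearly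
  constant arguments quantify over every \<open>u\<close> with the right values below
  \<open>m\<close>, since argument lists are total functions.\<close>

definition wnu_pol :: "nat \<Rightarrow> (nat \<Rightarrow> 'a set) \<Rightarrow> ((nat \<Rightarrow> 'a) \<Rightarrow> bool) \<Rightarrow> nat \<Rightarrow> (nat \<Rightarrow> (nat \<Rightarrow> 'a) \<Rightarrow> 'a) \<Rightarrow> bool" where
  "wnu_pol n C R m f \<longleftrightarrow> 2 \<le> m \<and>
     (\<forall>i<n. \<forall>u. (\<forall>p<m. u p \<in> C i) \<longrightarrow> f i u \<in> C i) \<and>
     (\<forall>i<n. \<forall>x\<in>C i. \<forall>u. (\<forall>p<m. u p = x) \<longrightarrow> f i u = x) \<and>
     (\<forall>i<n. \<forall>x\<in>C i. \<forall>y\<in>C i. \<forall>q<m. \<forall>u. u q = y \<and> (\<forall>p<m. p \<noteq> q \<longrightarrow> u p = x) \<longrightarrow> f i u = circ f i x y) \<and>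
     (\<forall>r. (\<forall>p<m. R (r p)) \<longrightarrow> R (\<lambda>i. f i (\<lambda>p. r p i)))"

definition special :: "nat \<Rightarrow> (nat \<Rightarrow> 'a set) \<Rightarrow> (nat \<Rightarrow> (nat \<Rightarrow> 'a) \<Rightarrow> 'a) \<Rightarrow> bool" where
  "special n C f \<longleftrightarrow> (\<forall>i<n. \<forall>x\<in>C i. \<forall>y\<in>C i. circ f i x (circ f i x y) = circ f i x y)"

lemma wnu_pol_arity: "wnu_pol n C R m f \<Longrightarrow> 2 \<le> m"
  and wnu_pol_closed: "wnu_pol n C R m f \<Longrightarrow> i < n \<Longrightarrow> (\<And>p. p < m \<Longrightarrow> u p \<in> C i) \<Longrightarrow> f i u \<in> C i"
  and wnu_pol_const: "wnu_pol n C R m f \<Longrightarrow> i < n \<Longrightarrow> x \<in> C i \<Longrightarrow> (\<And>p. p < m \<Longrightarrow> u p = x) \<Longrightarrow> f i u = x"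
  and wnu_pol_one: "wnu_pol n C R m f \<Longrightarrow> i < n \<Longrightarrow> x \<in> C i \<Longrightarrow> y \<in> C i \<Longrightarrow> q < m \<Longrightarrow> u q = y \<Longrightarrow>
     (\<And>p. p < m \<Longrightarrow> p \<noteq> q \<Longrightarrow> u p = x) \<Longrightarrow> f i u = circ f i x y"
  and wnu_pol_preserves: "wnu_pol n C R m f \<Longrightarrow> (\<And>p. p < m \<Longrightarrow> R (r p)) \<Longrightarrow> R (\<lambda>i. f i (\<lambda>p. r p i))"
  unfolding wnu_pol_def by simp_all

lemma wnu_pol_circ_closed: "wnu_pol n C R m f \<Longrightarrow> i < n \<Longrightarrow> x \<in> C i \<Longrightarrow> y \<in> C i \<Longrightarrow> circ f i x y \<in> C i"
  unfolding circ_def by (rule wnu_pol_closed) auto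

definition nest :: "nat \<Rightarrow> (nat \<Rightarrow> (nat \<Rightarrow> 'a) \<Rightarrow> 'a) \<Rightarrow> (nat \<Rightarrow> (nat \<Rightarrow> 'a) \<Rightarrow> 'a) \<Rightarrow> nat \<Rightarrow> (nat \<Rightarrow> 'a) \<Rightarrow> 'a" where
  "nest k f g i u = f i (\<lambda>p. g i (\<lambda>q. u (p * k + q)))"

text \<open>The odd argument falls into exactly one inner group of positions; the other groups are
  constant and return \<open>x\<close> by idempotence. Hence nesting composes the left translations
  by \<open>x\<close>.\<close>

lemma nest_wnu_pol:
  assumes f: "wnu_pol n C R m f" and g: "wnu_pol n C R k g"
  shows "wnu_pol n C R (m * k) (nest k f g)"
    and "i < n \<Longrightarrow> x \<in> C i \<Longrightarrow> y \<in> C i \<Longrightarrow> circ (nest k f g) i x y = circ f i x (circ g i x y)"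
proof -
  have m2: "2 \<le> m" and k2: "2 \<le> k" using f g by (auto dest: wnu_pol_arity)
  have idx: "p * k + q < m * k" if "p < m" "q < k" for p q
  proof -
    have "p * k + q < p * k + k" using that by simp
    also have "\<dots> = Suc p * k" by simp
    also have "\<dots> \<le> m * k" using that by (intro mult_right_mono) auto
    finally show ?thesis .
  qed
  have one: "nest k f g i u = circ f i x (circ g i x y)"
    if i: "i < n" and xy: "x \<in> C i" "y \<in> C i" and q: "q < m * k" and u: "u q = y"
      "\<And>p. p < m * k \<Longrightarrow> p \<noteq> q \<Longrightarrow> u p = x" for i x y q u
  proof -
    define p0 q0 where "p0 = q div k" and "q0 = q mod k"
    have q_eq: "q = p0 * k + q0" by (simp add: p0_def q0_def)
    have q0: "q0 < k" using k2 by (simp add: q0_def)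
    have p0: "p0 < m" using q by (simp add: p0_def less_mult_imp_div_less)
    \<comment> \<open>Uniqueness of division with remainder by \<open>k\<close>: only the inner
      group \<open>p0\<close>, at its place \<open>q0\<close>, sees the odd argument.\<close>
    have dec: "p * k + r = q \<longleftrightarrow> p = p0 \<and> r = q0" if "r < k" for p r
      using that q0 unfolding q_eq by (metis add.commute div_mult_self3 div_less mod_less mod_mult_self3 add_0_right not_less_zero)
    have "g i (\<lambda>r. u (p0 * k + r)) = circ g i x y"
      by (rule wnu_pol_one[OF g i xy q0]) (use u dec idx p0 in \<open>auto simp: q_eq\<close>)
    moreover have "g i (\<lambda>r. u (p * k + r)) = x" if "p < m" "p \<noteq> p0" for p
      by (rule wnu_pol_const[OF g i xy(1)]) (use u dec idx that in auto)
    ultimately show ?thesis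
      unfolding nest_def
      by (intro wnu_pol_one[OF f i xy(1) wnu_pol_circ_closed[OF g i xy] p0]) auto
  qed
  have mk: "0 < m * k" using m2 k2 by simp
  show 2: "circ (nest k f g) i x y = circ f i x (circ g i x y)" if "i < n" "x \<in> C i" "y \<in> C i" for i x y
    unfolding circ_def[of "nest k f g"] by (rule one[OF that mk]) auto
  show "wnu_pol n C R (m * k) (nest k f g)"
    unfolding wnu_pol_def
  proof (intro conjI allI impI ballI)
    have "2 * 1 \<le> m * k" using m2 k2 by (intro mult_mono) auto
    then show "2 \<le> m * k" by simp
  next
    fix i u assume "i < n" "\<forall>p<m * k. u p \<in> C i"
    then show "nest k f g i u \<in> C i"
      unfolding nest_def by (intro wnu_pol_closed[OF f] wnu_pol_closed[OF g]) (auto simp: idx)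
  next
    fix i x u assume "i < n" "x \<in> C i" "\<forall>p<m * k. u p = x"
    then show "nest k f g i u = x"
      unfolding nest_def by (intro wnu_pol_const[OF f] wnu_pol_const[OF g]) (auto simp: idx)
  next
    fix i x y q u assume a: "i < n" "x \<in> C i" "y \<in> C i" "q < m * k"
      "u q = y \<and> (\<forall>p<m * k. p \<noteq> q \<longrightarrow> u p = x)"
    then show "nest k f g i u = circ (nest k f g) i x y"
      using one[OF a(1-4), of u] 2[OF a(1-3)] by simp
  next
    fix r assume "\<forall>p<m * k. R (r p)"
    then have "R (\<lambda>i. g i (\<lambda>q. r (p * k + q) i))" if "p < m" for p
      using that by (intro wnu_pol_preserves[OF g]) (auto simp: idx)
    from wnu_pol_preserves[OF f, where r = "\<lambda>p i. g i (\<lambda>q. r (p * k + q) i)", OF this]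
    show "R (\<lambda>i. nest k f g i (\<lambda>p. r p i))" unfolding nest_def by simp
  qed
qed

text \<open>Repeated nesting replaces the map \<open>circ f i x\<close> by its iterates; an exponent
  making these maps idempotent for all \<open>i\<close> and \<open>x\<close> simultaneously gives a
  special operation.\<close>

lemma special_wnu_exists:
  assumes f: "wnu_pol n C R m f" and fin: "\<And>i. i < n \<Longrightarrow> finite (C i)"
  obtains m' f' where "wnu_pol n C R m' f'" "special n C f'"
proof -
  have pow: "\<exists>m' f'. wnu_pol n C R m' f' \<and>
     (\<forall>i<n. \<forall>x\<in>C i. \<forall>y\<in>C i. circ f' i x y = (circ f i x ^^ Suc N) y)" for N
  proof (induction N)
    case 0
    show ?case using f by auto
  next
    case (Suc N)
    then obtain m' f' where IH: "wnu_pol n C R m' f'"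
      "\<forall>i<n. \<forall>x\<in>C i. \<forall>y\<in>C i. circ f' i x y = (circ f i x ^^ Suc N) y" by blast
    have "wnu_pol n C R (m * m') (nest m' f f') \<and>
     (\<forall>i<n. \<forall>x\<in>C i. \<forall>y\<in>C i. circ (nest m' f f') i x y = (circ f i x ^^ Suc (Suc N)) y)"
      using nest_wnu_pol[OF f IH(1)] IH(2) by auto
    then show ?case by blast
  qed
  have "finite (Sigma {..<n} C)" using fin by auto
  moreover have "finite (C (fst t)) \<and> circ f (fst t) (snd t) ` C (fst t) \<subseteq> C (fst t)"
    if "t \<in> Sigma {..<n} C" for t
    using that fin wnu_pol_circ_closed[OF f] by auto
  ultimately obtain N where N: "N > 0" "\<And>t y. t \<in> Sigma {..<n} C \<Longrightarrow> y \<in> C (fst t) \<Longrightarrow>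
     (circ f (fst t) (snd t) ^^ N) ((circ f (fst t) (snd t) ^^ N) y) = (circ f (fst t) (snd t) ^^ N) y"
    using common_idempotent_power[of "Sigma {..<n} C" "\<lambda>t. C (fst t)" "\<lambda>t. circ f (fst t) (snd t)"] by blast
  obtain N' where N': "N = Suc N'" using N(1) gr0_implies_Suc by blast
  obtain m' f' where f': "wnu_pol n C R m' f'"
     "\<forall>i<n. \<forall>x\<in>C i. \<forall>y\<in>C i. circ f' i x y = (circ f i x ^^ N) y" using pow[of N'] N' by blast
  have "special n C f'"
    unfolding special_def
  proof (intro allI impI ballI)
    fix i x y assume a: "i < n" "x \<in> C i" "y \<in> C i"
    have "circ f' i x y \<in> C i" using wnu_pol_circ_closed[OF f'(1)] a by blast
    then show "circ f' i x (circ f' i x y) = circ f' i x y"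
      using f'(2) a N(2)[of "(i,x)" y] by simp
  qed
  with f'(1) show thesis by (rule that)
qed

text \<open>The relation together with its essential tuples: a tuple of \<open>R\<close> is repaired
  by its own entry. The witness carries no sort condition because membership in \<open>R\<close>
  will force one.\<close>

definition tilde :: "nat \<Rightarrow> ((nat \<Rightarrow> 'a) \<Rightarrow> bool) \<Rightarrow> (nat \<Rightarrow> 'a) \<Rightarrow> bool" where
  "tilde n R x \<longleftrightarrow> (\<forall>i<n. \<exists>b. R (x(i := b)))"

text \<open>\<open>rect\<close> is the full pattern read positively: three corners of a rectangle in
  two coordinates force the fourth. \<open>local\<close> is stated because tuples are total
  functions.\<close>

locale difunctional =
  fixes n :: nat and C :: "nat \<Rightarrow> 'a set" and R :: "(nat \<Rightarrow> 'a) \<Rightarrow> bool"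
  assumes n3: "3 \<le> n" and finC: "i < n \<Longrightarrow> finite (C i)"
    and local: "R x \<Longrightarrow> (\<And>i. i < n \<Longrightarrow> x i = y i) \<Longrightarrow> R y"
    and R_C: "R x \<Longrightarrow> i < n \<Longrightarrow> x i \<in> C i"
    and rect: "i < n \<Longrightarrow> j < n \<Longrightarrow> i \<noteq> j \<Longrightarrow> R (x(i := b)) \<Longrightarrow> R (x(j := c)) \<Longrightarrow> R (x(i := b, j := c)) \<Longrightarrow> R x"
begin

abbreviation T where "T \<equiv> tilde n R"

lemma R_T: "R x \<Longrightarrow> T x"
  unfolding tilde_def by (metis fun_upd_triv)

lemma T_local:
  assumes "T x" "\<And>i. i < n \<Longrightarrow> x i = y i"
  shows "T y"
  unfolding tilde_def
proof (intro allI impI)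
  fix i assume "i < n"
  then obtain b where "R (x(i := b))" using assms(1) unfolding tilde_def by blast
  then have "R (y(i := b))" by (rule local) (use assms(2) in auto)
  then show "\<exists>b. R (y(i := b))" by blast
qed

text \<open>Repairing a coordinate other than \<open>i\<close> leaves the entry at \<open>i\<close>
  in place.\<close>

lemma T_C: assumes "T x" "i < n" shows "x i \<in> C i"
proof -
  obtain j where j: "j < n" "j \<noteq> i" using n3 that[of 0] that[of 1] by (cases "i = 0") auto
  then obtain b where "R (x(j := b))" using assms unfolding tilde_def by blast
  from R_C[OF this assms(2)] show ?thesis using j by simp
qed

lemma T_ex: "T x \<Longrightarrow> i < n \<Longrightarrow> \<exists>b. R (x(i := b))"
  unfolding tilde_def by blast

lemma third_index: assumes "i < n" "j < n" obtains k where "k < n" "k \<noteq> i" "k \<noteq> j"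
proof -
  have "\<exists>k\<in>{0,1,2}. k \<noteq> i \<and> k \<noteq> j" by auto
  then obtain k where "k \<in> {0,1,2}" "k \<noteq> i" "k \<noteq> j" by blast
  then show thesis using n3 by (intro that[of k]) auto
qed

end

locale difunctional_wnu = difunctional n C R for n C and R :: "(nat \<Rightarrow> 'a) \<Rightarrow> bool" +
  fixes m :: nat and f :: "nat \<Rightarrow> (nat \<Rightarrow> 'a) \<Rightarrow> 'a"
  assumes wnu: "wnu_pol n C R m f" and spec: "special n C f"
begin

abbreviation op where "op \<equiv> circ f"

lemmas m2 = wnu_pol_arity[OF wnu]
lemmas op_closed = wnu_pol_circ_closed[OF wnu]
lemmas f_const = wnu_pol_const[OF wnu]
lemmas f_one = wnu_pol_one[OF wnu]

lemma op_idem: "i < n \<Longrightarrow> x \<in> C i \<Longrightarrow> op i x x = x"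
  unfolding circ_def by (rule f_const) auto

lemma op_op: "i < n \<Longrightarrow> x \<in> C i \<Longrightarrow> y \<in> C i \<Longrightarrow> op i x (op i x y) = op i x y"
  using spec unfolding special_def by blast

lemma f_R:
  assumes "\<And>p. p < m \<Longrightarrow> R (r p)" "\<And>i. i < n \<Longrightarrow> f i (\<lambda>p. r p i) = y i"
  shows "R y"
  using local[OF wnu_pol_preserves[OF wnu, of r]] assms by blast

text \<open>The projection of \<open>R\<close> that forgets coordinate \<open>k\<close> is preserved
  as well, so nothing has to be known about the value of \<open>f\<close> at
  \<open>k\<close>.\<close>

lemma f_proj:
  assumes k: "k < n" and r: "\<And>p. p < m \<Longrightarrow> \<exists>b. R ((r p)(k := b))"
    and y: "\<And>i. i < n \<Longrightarrow> i \<noteq> k \<Longrightarrow> f i (\<lambda>p. r p i) = y i"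
  shows "\<exists>b. R (y(k := b))"
proof -
  obtain b where b: "\<And>p. p < m \<Longrightarrow> R ((r p)(k := b p))" using r by metis
  have "R (y(k := f k b))"
    by (rule f_R[of "\<lambda>p. (r p)(k := b p)"]) (use b y in auto)
  then show ?thesis by blast
qed

lemma f_T:
  assumes "\<And>p. p < m \<Longrightarrow> T (r p)" "\<And>i. i < n \<Longrightarrow> f i (\<lambda>p. r p i) = y i"
  shows "T y"
  unfolding tilde_def
proof (intro allI impI)
  fix k assume k: "k < n"
  show "\<exists>b. R (y(k := b))"
    by (rule f_proj[of k r, OF k T_ex[OF assms(1) k] assms(2)])
qed

lemma op_R: "R x \<Longrightarrow> R y \<Longrightarrow> (\<And>i. i < n \<Longrightarrow> op i (x i) (y i) = z i) \<Longrightarrow> R z"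
  by (rule f_R[of "\<lambda>p. if p = 0 then y else x"]) (auto simp: circ_def fun_upd_def if_distrib[of "\<lambda>t. t _"] cong: if_cong)

text \<open>Where \<open>z\<close> is a left identity, this behaves like \<open>x + y - z\<close> as
  soon as \<open>x\<close> or \<open>y\<close> equals \<open>z\<close>. Positions 0 and 1 exist
  because the arity is at least 2.\<close>

definition op3 where "op3 i x y z = f i ((\<lambda>_. z)(0 := x, 1 := y))"

lemma op3_simps:
  assumes "i < n" "x \<in> C i" "z \<in> C i"
  shows "op3 i x z z = op i z x" "op3 i z x z = op i z x"
  unfolding op3_def by (rule f_one[of i z x 0] f_one[of i z x 1]; use m2 assms in auto)+

lemma op3_eval: "f i (\<lambda>p. (if p = 0 then x else if p = 1 then y else z) i) = op3 i (x i) (y i) (z i)"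
  unfolding op3_def by (rule arg_cong[where f = "f i"]) (auto simp: fun_eq_iff)

lemma op3_R:
  assumes "R x" "R y" "R z" "\<And>i. i < n \<Longrightarrow> op3 i (x i) (y i) (z i) = w i"
  shows "R w"
  by (rule f_R[of "\<lambda>p. if p = 0 then x else if p = 1 then y else z"]) (use assms in \<open>auto simp only: op3_eval split: if_split\<close>)

lemma op3_proj:
  assumes "k < n" "\<exists>b. R (x(k := b))" "\<exists>b. R (y(k := b))" "\<exists>b. R (z(k := b))"
    "\<And>i. i < n \<Longrightarrow> i \<noteq> k \<Longrightarrow> op3 i (x i) (y i) (z i) = w i"
  shows "\<exists>b. R (w(k := b))"
  by (rule f_proj[of k "\<lambda>p. if p = 0 then x else if p = 1 then y else z"]) (use assms in \<open>auto simp only: op3_eval split: if_split\<close>)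

lemma op3_T:
  assumes "T x" "T y" "T z" "\<And>i. i < n \<Longrightarrow> op3 i (x i) (y i) (z i) = w i"
  shows "T w"
  by (rule f_T[of "\<lambda>p. if p = 0 then x else if p = 1 then y else z"]) (use assms in \<open>auto simp only: op3_eval split: if_split\<close>)

lemma op_T: "T x \<Longrightarrow> T y \<Longrightarrow> (\<And>i. i < n \<Longrightarrow> op i (x i) (y i) = z i) \<Longrightarrow> T z"
  by (rule f_T[of "\<lambda>p. if p = 0 then y else x"]) (auto simp: circ_def fun_upd_def if_distrib[of "\<lambda>t. t _"] cong: if_cong)

end

section \<open>Rigid cores\<close>

locale rigid_core = difunctional_wnu n C R m f for n C and R :: "(nat \<Rightarrow> 'a) \<Rightarrow> bool" and m f +
  fixes \<beta> :: "nat \<Rightarrow> 'a"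
  assumes \<beta>_notR: "\<not> R \<beta>" and \<beta>_T: "T \<beta>"
    and rigid: "\<And>\<Phi> i. (\<And>j. j < n \<Longrightarrow> \<Phi> j ` C j \<subseteq> C j) \<Longrightarrow> (\<And>x. R x \<Longrightarrow> R (\<lambda>j. \<Phi> j (x j))) \<Longrightarrow>
       \<not> R (\<lambda>j. \<Phi> j (\<beta> j)) \<Longrightarrow> i < n \<Longrightarrow> inj_on (\<Phi> i) (C i)"
begin

section \<open>Left identities on the lines through \<beta>\<close>

definition U where "U i c \<longleftrightarrow> c \<in> C i \<and> (\<forall>x\<in>C i. op i c x = x)"

lemma U_C: "U i c \<Longrightarrow> c \<in> C i" and U_op: "U i c \<Longrightarrow> x \<in> C i \<Longrightarrow> op i c x = x"
  unfolding U_def by auto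

lemma \<beta>_C: "i < n \<Longrightarrow> \<beta> i \<in> C i"
  using T_C \<beta>_T by blast

lemma upd_C: "R (x(i := b)) \<Longrightarrow> i < n \<Longrightarrow> b \<in> C i"
  using R_C[of "x(i := b)" i] by simp

text \<open>Were both values in the relation, the product of the two given tuples would complete a rectangle with
  corner \<open>\<beta>\<close>.\<close>

lemma P_Q_exclusive:
  assumes ij: "i < n" "j < n" "i \<noteq> j" and b: "R (\<beta>(i := b))" and d: "R (\<beta>(j := d))"
    and P: "R (\<beta>(i := op i (\<beta> i) b))" and Q: "R (\<beta>(j := op j d (\<beta> j)))"
  shows False
proof -
  have "R (\<beta>(i := op i (\<beta> i) b, j := op j d (\<beta> j)))"
    by (rule op_R[OF d b]) (use ij in \<open>auto simp: op_idem \<beta>_C\<close>)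
  then show False using rect[OF ij P Q] \<beta>_notR by blast
qed

text \<open>Left multiplication by a tuple of \<open>R\<close> preserves \<open>R\<close>, so
  rigidity makes it injective when it keeps \<beta> outside; a map that is injective and idempotent
  is the identity.\<close>

lemma left_mult_rigid:
  assumes c: "R c" and nR: "\<not> R (\<lambda>i. op i (c i) (\<beta> i))" and i: "i < n"
  shows "U i (c i)"
proof -
  have "inj_on (op i (c i)) (C i)"
    by (rule rigid[of "\<lambda>i. op i (c i)"]) (use op_R[OF c] nR i op_closed R_C[OF c] in auto)
  then show ?thesis unfolding U_def using op_op[OF i R_C[OF c i]] op_closed[OF i R_C[OF c i]] R_C[OF c i] i
    by (metis inj_onD)
qed

text \<open>Left multiplication by \<open>\<beta>(j := b)\<close> moves \<beta> at most in
  coordinate \<open>j\<close>. If the result stays outside \<open>R\<close>, rigidity applies to all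
  coordinates of the multiplier at once.\<close>

lemma not_Q_U:
  assumes j: "j < n" and b: "R (\<beta>(j := b))" and nQ: "\<not> R (\<beta>(j := op j b (\<beta> j)))"
  shows "U j b" "\<And>k. k < n \<Longrightarrow> k \<noteq> j \<Longrightarrow> U k (\<beta> k)"
proof -
  have nR: "\<not> R (\<lambda>i. op i ((\<beta>(j := b)) i) (\<beta> i))"
  proof
    assume "R (\<lambda>i. op i ((\<beta>(j := b)) i) (\<beta> i))"
    then have "R (\<beta>(j := op j b (\<beta> j)))"
      by (rule local) (auto simp: op_idem \<beta>_C)
    then show False using nQ by blast
  qed
  show "U j b" using left_mult_rigid[OF b nR j] by simp
  show "U k (\<beta> k)" if "k < n" "k \<noteq> j" for k using left_mult_rigid[OF b nR that(1)] that by simp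
qed

text \<open>In this case rigidity yields \<open>\<beta>\<^sub>i \<circ> b = \<beta>\<^sub>i\<close>, as for a near-unanimity operation; replacing \<open>b\<^sub>2\<close> by \<open>\<beta>\<^sub>2\<close>
  position by position then leads to \<open>\<beta>\<close> itself.\<close>

lemma majority_like_impossible:
  assumes Q: "\<And>i b. i < n \<Longrightarrow> R (\<beta>(i := b)) \<Longrightarrow> R (\<beta>(i := op i b (\<beta> i)))"
    and nP: "\<And>i b. i < n \<Longrightarrow> R (\<beta>(i := b)) \<Longrightarrow> \<not> R (\<beta>(i := op i (\<beta> i) b))"
  shows False
proof -
  have stuck: "op i (\<beta> i) b = \<beta> i" if i: "i < n" and b: "R (\<beta>(i := b))" for i b
  proof -
    obtain j where j: "j < n" "j \<noteq> i" using third_index[of i i] i by blast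
    obtain d where d: "R (\<beta>(j := d))" using T_ex \<beta>_T j by blast
    define c where "c = op i (\<beta> i) b"
    define d' where "d' = op j d (\<beta> j)"
    have bC: "b \<in> C i" using upd_C b i by blast
    have cC: "c \<in> C i" unfolding c_def using op_closed i \<beta>_C bC by blast
    have d': "R (\<beta>(j := d'))" unfolding d'_def using Q j d by blast
    have cd: "R (\<beta>(i := c, j := d'))" unfolding c_def d'_def
      by (rule op_R[OF d b]) (use i j in \<open>auto simp: op_idem \<beta>_C\<close>)
    \<comment> \<open>If this product lay in \<open>R\<close>, a rectangle in coordinates
      \<open>i\<close> and \<open>j\<close> would yield
      \<open>\<beta>(j := op j (\<beta> j) d')\<close>, against \<open>nP\<close> for the repair
      \<open>d'\<close>.\<close>
    have nR: "\<not> R (\<lambda>k. op k (\<beta> k) ((\<beta>(i := c, j := d')) k))"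
    proof
      assume "R (\<lambda>k. op k (\<beta> k) ((\<beta>(i := c, j := d')) k))"
      then have 1: "R (\<beta>(i := c, j := op j (\<beta> j) d'))"
        by (rule local) (use i j in \<open>auto simp: op_idem \<beta>_C op_op bC c_def\<close>)
      have "R (\<beta>(j := op j (\<beta> j) d'))"
        by (rule rect[of i j "\<beta>(j := op j (\<beta> j) d')" c d'])
           (use i j 1 d' cd in \<open>auto simp: fun_upd_twist\<close>)
      then show False using nP d' j by blast
    qed
    \<comment> \<open>Right multiplication by a tuple of \<open>R\<close> preserves \<open>R\<close>
      too. It is injective here and sends both \<open>c\<close> and \<open>\<beta> i\<close> to
      \<open>c\<close>, so the two coincide.\<close>
    have "inj_on (\<lambda>x. op i x ((\<beta>(i := c, j := d')) i)) (C i)"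
      by (rule rigid[of "\<lambda>k x. op k x ((\<beta>(i := c, j := d')) k)"])
         (use op_closed R_C[OF cd] in \<open>auto simp del: fun_upd_apply\<close>, rule op_R[OF _ cd], simp_all only: nR i not_False_eq_True)
    then have "inj_on (\<lambda>x. op i x c) (C i)" using j by simp
    moreover have "op i c c = c" "op i (\<beta> i) c = c" using i cC \<beta>_C bC by (auto simp: op_idem c_def op_op)
    ultimately show ?thesis using cC \<beta>_C i unfolding c_def inj_on_def by metis
  qed
  have lt: "0 < n" "1 < n" "2 < n" using n3 by auto
  obtain b0 b1 b2 where b: "R (\<beta>(0 := b0))" "R (\<beta>(1 := b1))" "R (\<beta>(2 := b2))"
    using T_ex[OF \<beta>_T] lt by metis
  have bC: "b0 \<in> C 0" "b1 \<in> C 1" "b2 \<in> C 2" using b lt upd_C by blast+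
  \<comment> \<open>\<open>K W\<close> interpolates between \<open>b2\<close>, for the empty set,
    and \<open>\<beta> 2\<close>, for the set of all positions below \<open>m\<close>.\<close>
  define K where "K W = f 2 (\<lambda>p. if p \<in> W then \<beta> 2 else b2)" for W :: "nat set"
  have win: "R (\<beta>(2 := K W))" if "finite W" "W \<subseteq> {..<m}" for W
    using that
  proof (induction W rule: finite_induct)
    case empty
    have "K {} = b2" unfolding K_def by (rule f_const) (use lt bC in auto)
    then show ?case using b by (simp only:)
  next
    case (insert s W)
    have s: "s < m" "s \<notin> W" and IH: "R (\<beta>(2 := K W))"
      using insert by (auto simp only: insert_subset lessThan_iff)
    \<comment> \<open>Both tuples below carry this entry at 1. Between them, position
      \<open>s\<close> switches from the tuple repaired at 2 to the one repaired at 0, whose trace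
      at 0 is erased by \<open>stuck\<close>. A rectangle in coordinates 1 and 2 then removes
      \<open>x\<close>.\<close>
    define x where "x = f 1 (\<lambda>p. if p \<in> W then b1 else \<beta> 1)"
    have R1: "R (\<beta>(1 := x, 2 := K W))"
    proof (rule f_R[of "\<lambda>p. if p \<in> W then \<beta>(1 := b1) else \<beta>(2 := b2)"])
      fix i assume i: "i < n"
      consider "i = 1" | "i = 2" | "i \<noteq> 1" "i \<noteq> 2" by blast
      then show "f i (\<lambda>p. (if p \<in> W then \<beta>(1 := b1) else \<beta>(2 := b2)) i) = (\<beta>(1 := x, 2 := K W)) i"
        by cases (use i in \<open>auto simp: K_def x_def if_distrib[of "\<lambda>t. t _"] intro!: f_const \<beta>_C cong: if_cong\<close>)
    qed (use b in auto)
    have R2: "R (\<beta>(1 := x, 2 := K (insert s W)))"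
    proof (rule f_R[of "\<lambda>p. if p = s then \<beta>(0 := b0) else if p \<in> W then \<beta>(1 := b1) else \<beta>(2 := b2)"])
      fix i assume i: "i < n"
      have e1: "(\<lambda>p. if p = s then \<beta> 1 else if p \<in> W then b1 else \<beta> 1) = (\<lambda>p. if p \<in> W then b1 else \<beta> 1)"
        using s by auto
      have e2: "(\<lambda>p. if p = s then \<beta> 2 else if p \<in> W then \<beta> 2 else b2) = (\<lambda>p. if p \<in> insert s W then \<beta> 2 else b2)"
        by auto
      have e0: "f 0 (\<lambda>p. if p = s then b0 else \<beta> 0) = \<beta> 0"
        using f_one[of 0 "\<beta> 0" b0 s "\<lambda>p. if p = s then b0 else \<beta> 0"] stuck[of 0 b0] s lt bC \<beta>_C b by simp
      consider "i = 0" | "i = 1" | "i = 2" | "i \<noteq> 0" "i \<noteq> 1" "i \<noteq> 2" by blast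
      then show "f i (\<lambda>p. (if p = s then \<beta>(0 := b0) else if p \<in> W then \<beta>(1 := b1) else \<beta>(2 := b2)) i)
         = (\<beta>(1 := x, 2 := K (insert s W))) i"
        by cases (use i e0 e1 e2 in \<open>auto simp: K_def x_def if_distrib[of "\<lambda>t. t _"] intro!: f_const \<beta>_C cong: if_cong\<close>)
    qed (use b in auto)
    show ?case
    proof (rule rect[of 1 2 _ x "K W"])
      have "(\<beta>(2 := K (insert s W)))(1 := x) = \<beta>(1 := x, 2 := K (insert s W))" by (rule ext) simp
      with R2 show "R ((\<beta>(2 := K (insert s W)))(1 := x))" by (simp only:)
      have "(\<beta>(2 := K (insert s W)))(1 := x, 2 := K W) = \<beta>(1 := x, 2 := K W)" by (rule ext) simp
      with R1 show "R ((\<beta>(2 := K (insert s W)))(1 := x, 2 := K W))" by (simp only:)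
    qed (use lt IH in \<open>auto simp only: fun_upd_upd\<close>)
  qed
  have "K {..<m} = \<beta> 2" unfolding K_def by (rule f_const) (use lt \<beta>_C in auto)
  then show False using win[of "{..<m}"] \<beta>_notR by simp
qed

text \<open>All or nothing: if the product failed to lie in \<open>R\<close> at some other repair,
  the remaining entries of \<beta> would be left identities, so the reversed product would lie in
  \<open>R\<close>, which \<open>P_Q_exclusive\<close> forbids next to \<open>Qj\<close>. Hence
  \<open>Qj\<close> leads to the situation excluded by
  \<open>majority_like_impossible\<close>.\<close>

lemma not_Q:
  assumes j: "j < n" and d: "R (\<beta>(j := d))"
  shows "\<not> R (\<beta>(j := op j d (\<beta> j)))"
proof
  assume Qj: "R (\<beta>(j := op j d (\<beta> j)))"
  have Q: "R (\<beta>(k := op k b (\<beta> k)))" if k: "k < n" and b: "R (\<beta>(k := b))" for k b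
  proof (rule ccontr)
    assume nQ: "\<not> R (\<beta>(k := op k b (\<beta> k)))"
    obtain l where l: "l < n" "l \<noteq> j" "l \<noteq> k" using third_index j k by blast
    obtain bl where bl: "R (\<beta>(l := bl))" using T_ex \<beta>_T l by blast
    have "op l (\<beta> l) bl = bl" using not_Q_U(2)[OF k b nQ] l U_op upd_C[OF bl] by blast
    then show False using P_Q_exclusive[OF l(1) j l(2) bl d _ Qj] bl by simp
  qed
  have nP: "\<not> R (\<beta>(i := op i (\<beta> i) b))" if i: "i < n" and b: "R (\<beta>(i := b))" for i b
  proof
    assume P: "R (\<beta>(i := op i (\<beta> i) b))"
    obtain k where k: "k < n" "k \<noteq> i" using third_index i by blast
    obtain bk where bk: "R (\<beta>(k := bk))" using T_ex \<beta>_T k by blast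
    show False using P_Q_exclusive[OF i k(1) _ b bk P Q[OF k(1) bk]] k by blast
  qed
  show False using majority_like_impossible Q nP by blast
qed

lemma line_U: "j < n \<Longrightarrow> R (\<beta>(j := b)) \<Longrightarrow> U j b"
  using not_Q_U(1) not_Q by blast

lemma \<beta>_U: assumes "k < n" shows "U k (\<beta> k)"
proof -
  obtain j where j: "j < n" "j \<noteq> k" using third_index assms by blast
  obtain b where b: "R (\<beta>(j := b))" using T_ex \<beta>_T j by blast
  show ?thesis using not_Q_U(2)[OF j(1) b not_Q[OF j(1) b] assms] j by blast
qed

text \<open>If the entry at \<open>k\<close> failed, left multiplication by \<open>c\<close> would
  send \<beta> into \<open>R\<close>. It changes \<beta> and a repair of \<beta> only at
  \<open>k\<close> and to the same entry, so a rectangle closes at \<beta>.\<close>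

lemma U_propagates:
  assumes c: "R c" and k: "k < n" and U: "\<And>l. l < n \<Longrightarrow> l \<noteq> k \<Longrightarrow> U l (c l)"
  shows "U k (c k)"
proof (rule ccontr)
  assume nU: "\<not> U k (c k)"
  then have "R (\<lambda>i. op i (c i) (\<beta> i))" using left_mult_rigid[OF c _ k] by blast
  then have p: "R (\<beta>(k := op k (c k) (\<beta> k)))"
    by (rule local) (auto simp: U_op[OF U] \<beta>_C)
  obtain i where i: "i < n" "i \<noteq> k" using third_index k by blast
  obtain b where b: "R (\<beta>(i := b))" using T_ex \<beta>_T i by blast
  have "R (\<beta>(i := b, k := op k (c k) (\<beta> k)))"
    by (rule op_R[OF c b]) (use i in \<open>auto simp: U_op[OF U] \<beta>_C upd_C[OF b]\<close>)
  then show False using rect[OF i(1) k i(2) b p] \<beta>_notR by blast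
qed

text \<open>If \<open>a\<close> did not act as the identity, neither would any iterate of \<open>\<lambda>x. x \<circ> \<beta>\<^sub>i\<close> on \<open>a\<close>; on a cycle of
  the simultaneous iteration in coordinate \<open>j\<close> a rectangle closes up.\<close>

lemma adjacent_U:
  assumes ijk: "i < n" "j < n" "k < n" "i \<noteq> j" "i \<noteq> k" "j \<noteq> k"
    and y: "R (\<beta>(i := a, j := y))" and z: "R (\<beta>(i := a, k := z))"
  shows "U i a"
proof (rule ccontr)
  assume nU: "\<not> U i a"
  define S where "S a y z \<longleftrightarrow> R (\<beta>(i := a, j := y)) \<and> R (\<beta>(i := a, k := z)) \<and> \<not> U i a" for a y z
  have SC: "a \<in> C i" "y \<in> C j" "z \<in> C k" if "S a y z" for a y z
    using that R_C[of "\<beta>(i := a, j := y)"] R_C[of "\<beta>(i := a, k := z)"] ijk unfolding S_def by force+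
  have step1: "R (\<beta>(i := op i a (\<beta> i), j := op j y (\<beta> j))) \<and> \<not> U i (op i a (\<beta> i))"
    if R: "R (\<beta>(i := a, j := y))" and nU: "\<not> U i a" and j: "j < n" "j \<noteq> i" for a y j
  proof -
    have aC: "a \<in> C i" and yC: "y \<in> C j" using R_C[OF R] ijk j by force+
    let ?p = "op i a (\<beta> i)" and ?q = "op j y (\<beta> j)"
    have "R (\<lambda>l. op l ((\<beta>(i := a, j := y)) l) (\<beta> l))" using left_mult_rigid[OF R _ ijk(1)] nU j by force
    then have pq: "R (\<beta>(i := ?p, j := ?q))" by (rule local) (use j in \<open>auto simp: op_idem \<beta>_C\<close>)
    have "\<not> U i ?p"
    proof
      assume Up: "U i ?p"
      have "U j ((\<beta>(i := ?p, j := ?q)) j)"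
        by (rule U_propagates[OF pq]) (use Up \<beta>_U j in auto)
      then have Uq: "U j ?q" by simp
      obtain l where l: "l < n" "l \<noteq> i" "l \<noteq> j" using third_index ijk j by blast
      obtain b where b: "R (\<beta>(l := b))" using T_ex \<beta>_T l by blast
      have bU: "U l b" using line_U b l by blast
      have pqb: "R (\<beta>(i := ?p, j := ?q, l := b))"
        by (rule op_R[OF R b]) (use l j U_op[OF \<beta>_U] U_C[OF bU] in \<open>auto simp: op_idem \<beta>_C\<close>)
      \<comment> \<open>The combination \<open>b + pq - pqb\<close>: at \<open>i\<close>,
        \<open>j\<close> and \<open>l\<close> the entry of the third tuple is a left identity, so
        the entry of \<beta> reappears there.\<close>
      have "R \<beta>"
      proof (rule op3_R[OF b pq pqb])
        fix h assume h: "h < n"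
        consider "h = l" | "h = i" | "h = j" | "h \<noteq> l" "h \<noteq> i" "h \<noteq> j" by blast
        then show "op3 h ((\<beta>(l := b)) h) ((\<beta>(i := ?p, j := ?q)) h) ((\<beta>(i := ?p, j := ?q, l := b)) h) = \<beta> h"
          by cases (use h l j \<beta>_C op_closed aC yC U_C[OF bU] U_op[OF bU] U_op[OF Up] U_op[OF Uq]
            in \<open>auto simp: op3_simps op_idem\<close>)
      qed
      then show False using \<beta>_notR by blast
    qed
    with pq show ?thesis by blast
  qed
  have step: "S (op i a (\<beta> i)) (op j y (\<beta> j)) (op k z (\<beta> k))" if "S a y z" for a y z
    using that step1[of a j y] step1[of a k z] ijk unfolding S_def by blast
  define g where "g i x = op i x (\<beta> i)" for i x
  have iter: "S ((g i ^^ t) a) ((g j ^^ t) y) ((g k ^^ t) z)" for t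
  proof (induction t)
    case 0 show ?case using y z nU by (simp add: S_def)
  next
    case (Suc t) then show ?case using step by (simp add: g_def)
  qed
  have yC: "y \<in> C j" using SC iter[of 0] by simp
  have "g j ` C j \<subseteq> C j" using op_closed \<beta>_C ijk unfolding g_def by auto
  then obtain s d where sd: "d > 0" "(g j ^^ (s + d)) y = (g j ^^ s) y"
    using funpow_eventually_periodic[OF finC[OF ijk(2)] _ yC] by metis
  define a' y' z' where "a' = (g i ^^ s) a" and "y' = (g j ^^ s) y" and "z' = (g k ^^ s) z"
  have S': "S a' y' z'" using iter by (simp add: a'_def y'_def z'_def)
  have cyc: "(g j ^^ d) y' = y'" using sd(2) by (simp add: y'_def funpow_add[symmetric, THEN fun_cong, unfolded o_def] add.commute)
  note C' = SC[OF S']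
  have Ry: "R (\<beta>(i := a', j := y'))" and Rz: "R (\<beta>(i := a', k := z'))" using S' by (auto simp: S_def)
  \<comment> \<open>Repeated multiplication by \<open>\<beta>(i := a', k := z')\<close> keeps the
    entries at \<open>i\<close> and \<open>k\<close> and runs the entry at \<open>j\<close> around
    its cycle. When it is \<open>y'\<close> again, the corner opposite to
    \<open>\<beta>(i := a')\<close> has been reached.\<close>
  have "R (\<beta>(i := a', j := (g j ^^ Suc t) y', k := z'))" for t
  proof (induction t)
    case 0
    show ?case
      by (rule op_R[OF Ry Rz]) (use ijk C' U_op[OF \<beta>_U] in \<open>auto simp: g_def op_idem \<beta>_C\<close>)
  next
    case (Suc t)
    show ?case
      by (rule op_R[OF Suc Rz]) (use ijk C' in \<open>auto simp: g_def op_idem \<beta>_C\<close>)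
  qed
  from this[of "d - 1"] have "R (\<beta>(i := a', j := y', k := z'))" using sd(1) cyc by simp
  then have "R (\<beta>(i := a'))"
    by (rule rect[OF ijk(2,3,6) Ry Rz])
  then have "U i a'" using line_U ijk by blast
  then show False using S' by (simp add: S_def)
qed

section \<open>The block of \<beta> in the core\<close>

definition V where "V i = {a. T (\<beta>(i := a))}"

lemma \<beta>_V: "\<beta> i \<in> V i" unfolding V_def using \<beta>_T by simp

lemma V_U: assumes i: "i < n" and a: "a \<in> V i" shows "U i a"
proof -
  obtain j where j: "j < n" "j \<noteq> i" using third_index i by blast
  obtain k where k: "k < n" "k \<noteq> i" "k \<noteq> j" using third_index i j by blast
  obtain y z where "R (\<beta>(i := a, j := y))" "R (\<beta>(i := a, k := z))"
    using a i j k unfolding V_def tilde_def by blast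
  then show ?thesis using adjacent_U[of i j k a y z] i j k by blast
qed

lemma V_C: "i < n \<Longrightarrow> a \<in> V i \<Longrightarrow> a \<in> C i"
  using V_U U_C by blast

text \<open>Entries are inserted one at a time by adding \<open>\<beta>(l := x l)\<close> and
  subtracting \<beta> with \<open>op3\<close>; the base entries are those of \<beta>, which are left
  identities.\<close>

lemma V_T:
  assumes x: "\<And>i. i < n \<Longrightarrow> x i \<in> V i"
  shows "T x"
proof -
  have "T (\<lambda>i. if i < l then x i else \<beta> i)" if "l \<le> n" for l
    using that
  proof (induction l)
    case 0 show ?case using \<beta>_T by simp
  next
    case (Suc l)
    have l: "l < n" and IH: "T (\<lambda>i. if i < l then x i else \<beta> i)" using Suc by auto
    have xl: "T (\<beta>(l := x l))" using x[OF l] by (simp add: V_def)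
    show ?case
      by (rule op3_T[OF IH xl \<beta>_T])
         (use l in \<open>auto simp: op3_simps \<beta>_C less_Suc_eq V_C[OF _ x] U_op[OF \<beta>_U] op_idem\<close>)
  qed
  from this[of n] show ?thesis by (rule T_local) auto
qed

text \<open>The entries away from \<open>i\<close> are moved back to those of \<beta> one at a time.
  The base tuple \<open>w\<close> has entries in \<open>V\<close>, hence left identities, so the
  entry \<open>a\<close> survives each combination.\<close>

lemma V_step:
  assumes x: "\<And>l. l < n \<Longrightarrow> x l \<in> V l" and i: "i < n" and Ta: "T (x(i := a))"
  shows "a \<in> V i"
proof -
  have aC: "a \<in> C i" using T_C[OF Ta i] by simp
  have "T (\<lambda>l. if l = i then a else if l < j then \<beta> l else x l)" if "j \<le> n" for j
    using that
  proof (induction j)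
    case 0 show ?case by (rule T_local[OF Ta]) auto
  next
    case (Suc j)
    have j: "j < n" and IH: "T (\<lambda>l. if l = i then a else if l < j then \<beta> l else x l)" using Suc by auto
    let ?w = "\<lambda>l. if l < j then \<beta> l else x l"
    have w: "T ?w" by (rule V_T) (use x \<beta>_V in auto)
    have w': "T (?w(j := \<beta> j))" by (rule V_T) (use x \<beta>_V in auto)
    show ?case
    proof (cases "j = i")
      case True then show ?thesis by (intro T_local[OF IH]) (auto simp: less_Suc_eq)
    next
      case False
      show ?thesis
        by (rule op3_T[OF IH w' w])
           (use j False in \<open>auto simp: op3_simps \<beta>_C op_idem less_Suc_eq V_C[OF _ x] U_op[OF V_U[OF _ x]] U_op[OF \<beta>_U] aC\<close>)
    qed
  qed
  from this[of n] have "T (\<beta>(i := a))" by (rule T_local) auto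
  then show ?thesis by (simp add: V_def)
qed

text \<open>Meant for \<open>T_square\<close>, where a key map is known to hit \<beta> only at the
  far corner of a square. Repairs show through \<open>adjacent_U\<close> that the three moved
  entries are left identities; then \<open>op3\<close> combines the given tuples to
  \<open>\<beta>(k := w k)\<close>, and with its help to the other two.\<close>

lemma V_corner:
  assumes ijk: "i < n" "j < n" "k < n" "i \<noteq> j" "i \<noteq> k" "j \<noteq> k"
    and w: "T w" "T (w(i := \<beta> i))" "T (w(j := \<beta> j))"
    and off: "\<And>l. l < n \<Longrightarrow> l \<noteq> i \<Longrightarrow> l \<noteq> j \<Longrightarrow> l \<noteq> k \<Longrightarrow> w l = \<beta> l"
    and l: "l < n"
  shows "w l \<in> V l"
proof -
  have wC: "w l \<in> C l" if "l < n" for l using T_C w that by blast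
  have proj: "\<exists>b. R (v(l := b))" if "T x" "l < n" "\<And>h. h < n \<Longrightarrow> h \<noteq> l \<Longrightarrow> x h = v h" for x v l
  proof -
    obtain b where "R (x(l := b))" using T_ex \<open>T x\<close> \<open>l < n\<close> by blast
    then have "R (v(l := b))" by (rule local) (use that in auto)
    then show ?thesis by blast
  qed
  have ki: "\<exists>b. R (\<beta>(k := w k, i := b))" by (rule proj[OF w(3) ijk(1)]) (use ijk off in auto)
  have kj: "\<exists>b. R (\<beta>(k := w k, j := b))" by (rule proj[OF w(2) ijk(2)]) (use ijk off in auto)
  have Uk: "U k (w k)" using adjacent_U[of k i j "w k"] ki kj ijk by blast
  have wk: "op h (w h) (\<beta> h) = \<beta> h" if "h < n" "h \<noteq> i" "h \<noteq> j" for h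
    using that by (cases "h = k") (auto simp: off op_idem \<beta>_C U_op[OF Uk])
  have ik: "\<exists>b. R (\<beta>(i := w i, k := b))" by (rule proj[OF w(3) ijk(3)]) (use ijk off in auto)
  have ij: "\<exists>b. R (\<beta>(i := w i, j := b))"
    by (rule op3_proj[OF ijk(2) T_ex[OF w(1) ijk(2)] T_ex[OF \<beta>_T ijk(2)] T_ex[OF w(2) ijk(2)]])
       (use ijk in \<open>auto simp: op3_simps op_idem off wC \<beta>_C wk U_op[OF \<beta>_U]\<close>)
  have Ui: "U i (w i)" using adjacent_U[of i j k "w i"] ij ik ijk by blast
  have jk: "\<exists>b. R (\<beta>(j := w j, k := b))" by (rule proj[OF w(2) ijk(3)]) (use ijk off in auto)
  have ji: "\<exists>b. R (\<beta>(j := w j, i := b))"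
    by (rule op3_proj[OF ijk(1) T_ex[OF w(1) ijk(1)] T_ex[OF \<beta>_T ijk(1)] T_ex[OF w(3) ijk(1)]])
       (use ijk in \<open>auto simp: op3_simps op_idem off wC \<beta>_C wk U_op[OF \<beta>_U]\<close>)
  have Uj: "U j (w j)" using adjacent_U[of j i k "w j"] ji jk ijk by blast
  have Tk: "T (\<beta>(k := w k))"
    by (rule op3_T[OF w(2,3,1)])
       (use ijk in \<open>auto simp: op3_simps op_idem off wC \<beta>_C U_op[OF Ui] U_op[OF Uj]\<close>)
  have Ti: "T (\<beta>(i := w i))"
  proof -
    have "T (w(j := \<beta> j, k := \<beta> k))"
      by (rule op3_T[OF w(3) \<beta>_T Tk])
         (use ijk in \<open>auto simp: op3_simps op_idem off wC \<beta>_C wk U_op[OF \<beta>_U]\<close>)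
    then show ?thesis by (rule T_local) (use ijk off in auto)
  qed
  have Tj: "T (\<beta>(j := w j))"
  proof -
    have "T (w(i := \<beta> i, k := \<beta> k))"
      by (rule op3_T[OF w(2) \<beta>_T Tk])
         (use ijk in \<open>auto simp: op3_simps op_idem off wC \<beta>_C wk U_op[OF \<beta>_U]\<close>)
    then show ?thesis by (rule T_local) (use ijk off in auto)
  qed
  show ?thesis using Ti Tj Tk off \<beta>_V l unfolding V_def by (cases "l = i"; cases "l = j"; cases "l = k") auto
qed

end

section \<open>The group of a product block\<close>

locale twin_block =
  fixes n :: nat and B :: "nat \<Rightarrow> 'a set" and R :: "(nat \<Rightarrow> 'a) \<Rightarrow> bool"
    and m :: nat and f :: "nat \<Rightarrow> (nat \<Rightarrow> 'a) \<Rightarrow> 'a"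
  assumes n3: "3 \<le> n" and finB: "finite (B 0)" and B_ne: "i < n \<Longrightarrow> B i \<noteq> {}"
    and local: "R x \<Longrightarrow> (\<And>i. i < n \<Longrightarrow> x i = y i) \<Longrightarrow> R y"
    and R_B: "R x \<Longrightarrow> i < n \<Longrightarrow> x i \<in> B i"
    and wnu: "wnu_pol n B R m f"
    and line: "(\<And>l. l < n \<Longrightarrow> x l \<in> B l) \<Longrightarrow> i < n \<Longrightarrow> \<exists>b. R (x(i := b))"
    and twin: "i < n \<Longrightarrow> u \<in> B i \<Longrightarrow> (\<And>l. l < n \<Longrightarrow> x l \<in> B l) \<Longrightarrow> R (x(i := circ f i u (x i))) \<longleftrightarrow> R x"
begin

lemma op_B: "i < n \<Longrightarrow> x \<in> B i \<Longrightarrow> y \<in> B i \<Longrightarrow> circ f i x y \<in> B i"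
  by (rule wnu_pol_circ_closed[OF wnu])

lemma twin_all:
  assumes x: "\<And>l. l < n \<Longrightarrow> x l \<in> B l"
    and v: "\<And>l. l < n \<Longrightarrow> v l = x l \<or> (\<exists>u\<in>B l. v l = circ f l u (x l))"
  shows "R v \<longleftrightarrow> R x"
proof -
  have "R (\<lambda>l. if l < k then v l else x l) \<longleftrightarrow> R x" if "k \<le> n" for k
    using that
  proof (induction k)
    case 0 show ?case by simp
  next
    case (Suc k)
    let ?w = "\<lambda>l. if l < k then v l else x l"
    have k: "k < n" using Suc by simp
    have vB: "v l \<in> B l" if "l < n" for l using v[OF that] x[OF that] op_B[OF that] by auto
    have eq: "(\<lambda>l. if l < Suc k then v l else x l) = ?w(k := v k)" by (auto simp: fun_eq_iff less_Suc_eq)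
    have "R (?w(k := v k)) \<longleftrightarrow> R ?w"
    proof (cases "v k = x k")
      case True
      have "?w(k := v k) = ?w" using True by (auto simp: fun_eq_iff)
      then show ?thesis by simp
    next
      case False
      then obtain u where u: "u \<in> B k" "v k = circ f k u (x k)" using v[OF k] by blast
      show ?thesis using twin[OF k u(1), of ?w] x vB u(2) by simp
    qed
    then show ?case using Suc eq by simp
  qed
  from this[of n] have "R (\<lambda>l. if l < n then v l else x l) \<longleftrightarrow> R x" by simp
  then show ?thesis using local[of v "\<lambda>l. if l < n then v l else x l"] local[of "\<lambda>l. if l < n then v l else x l" v] by auto
qed

definition tw where
  "tw i a b \<longleftrightarrow> a \<in> B i \<and> b \<in> B i \<and> (\<forall>x. (\<forall>l<n. x l \<in> B l) \<longrightarrow> R (x(i := a)) = R (x(i := b)))"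

lemma three_R:
  assumes "R x" "R y" "R z"
  shows "R (\<lambda>l. f l ((\<lambda>_. z l)(0 := x l, 1 := y l)))"
proof -
  have "R (\<lambda>l. f l (\<lambda>p. (if p = 0 then x else if p = 1 then y else z) l))"
    by (rule wnu_pol_preserves[OF wnu]) (use assms in auto)
  moreover have "(\<lambda>p::nat. (if p = 0 then x else if p = 1 then y else z) l) = (\<lambda>_. z l)(0 := x l, 1 := y l)" for l
    by (auto simp: fun_eq_iff)
  ultimately show ?thesis by simp
qed

lemma three_simps:
  assumes "i < n" "x \<in> B i" "z \<in> B i"
  shows "f i ((\<lambda>_. z)(0 := x, 1 := z)) = circ f i z x" "f i ((\<lambda>_. z)(0 := z, 1 := x)) = circ f i z x"
  by (rule wnu_pol_one[OF wnu, of i z x 0] wnu_pol_one[OF wnu, of i z x 1];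
      use wnu_pol_arity[OF wnu] assms in auto)+

text \<open>Apply \<open>f\<close> to \<open>y(i := a)\<close>, \<open>x(i := b)\<close> and copies
  of \<open>x(i := a)\<close>: at \<open>i\<close> the result is a twin of \<open>b\<close>,
  elsewhere a twin of the entry of \<open>y\<close>. So one common line decides interchangeability
  on the whole block.\<close>

lemma common_line_twin:
  assumes i: "i < n" and a: "R (x(i := a))" and b: "R (x(i := b))"
  shows "tw i a b"
proof -
  have half: "R (y(i := b))" if y: "\<And>l. l < n \<Longrightarrow> y l \<in> B l" and a: "R (x(i := a))" and b: "R (x(i := b))" and ya: "R (y(i := a))"
    for a b y
  proof -
    have aB: "a \<in> B i" and bB: "b \<in> B i" using R_B[OF a i] R_B[OF b i] by auto
    have xB: "x l \<in> B l" if "l < n" "l \<noteq> i" for l using R_B[OF a that(1)] that by simp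
    have "R (\<lambda>l. f l ((\<lambda>_. (x(i := a)) l)(0 := (y(i := a)) l, 1 := (x(i := b)) l))) \<longleftrightarrow> R (y(i := b))"
    proof (rule twin_all)
      fix l assume l: "l < n"
      then show "(y(i := b)) l \<in> B l" using y bB by auto
      show "f l ((\<lambda>_. (x(i := a)) l)(0 := (y(i := a)) l, 1 := (x(i := b)) l)) = (y(i := b)) l \<or>
        (\<exists>u\<in>B l. f l ((\<lambda>_. (x(i := a)) l)(0 := (y(i := a)) l, 1 := (x(i := b)) l)) = circ f l u ((y(i := b)) l))"
        using l aB bB xB y three_simps[of l] by (cases "l = i") force+
    qed
    then show ?thesis using three_R[OF ya b a] by blast
  qed
  show ?thesis unfolding tw_def
    using half[OF _ a b] half[OF _ b a] R_B[OF a i] R_B[OF b i] by auto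
qed

lemma tw_refl: "a \<in> B i \<Longrightarrow> tw i a a" and tw_sym: "tw i a b \<Longrightarrow> tw i b a"
  and tw_trans: "tw i a b \<Longrightarrow> tw i b c \<Longrightarrow> tw i a c"
  unfolding tw_def by auto

lemma tw_R:
  assumes "tw i a b" "R (x(i := a))" "i < n" shows "R (x(i := b))"
proof -
  have "(x(i := a)) l \<in> B l" if "l < n" for l using R_B[OF assms(2) that] .
  then have "R ((x(i := a))(i := a)) = R ((x(i := a))(i := b))" using assms(1) unfolding tw_def by blast
  then show ?thesis using assms(2) by simp
qed

lemma origin: obtains z where "R z"
proof -
  define x where "x i = (SOME b. b \<in> B i)" for i
  have x: "x i \<in> B i" if "i < n" for i
    unfolding x_def using B_ne[OF that] by (simp add: some_in_eq)
  have "0 < n" using n3 by simp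
  then obtain b where "R (x(0 := b))" using line x by blast
  then show thesis by (rule that)
qed

end

locale pointed_twin_block = twin_block n B R m f
  for n B and R :: "(nat \<Rightarrow> 'a) \<Rightarrow> bool" and m f +
  fixes z :: "nat \<Rightarrow> 'a" assumes R_z: "R z"
begin

section \<open>Addition relative to a base tuple\<close>

definition pl where "pl i u v = f i ((\<lambda>_. z i)(0 := u, 1 := v))"

lemma z_B: "i < n \<Longrightarrow> z i \<in> B i" using R_B R_z by blast

lemma pl_B: "i < n \<Longrightarrow> u \<in> B i \<Longrightarrow> v \<in> B i \<Longrightarrow> pl i u v \<in> B i"
  unfolding pl_def by (rule wnu_pol_closed[OF wnu]) (auto simp: z_B)

text \<open>Where one summand is the base entry, the sum is only a twin of the other summand;
  \<open>twin_all\<close> allows writing that summand itself, which keeps the entries of later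
  tuples explicit.\<close>

lemma pl_R:
  assumes x: "R x" and y: "R y"
    and w: "\<And>l. l < n \<Longrightarrow> w l = pl l (x l) (y l) \<or> x l = z l \<and> w l = y l \<or> y l = z l \<and> w l = x l"
  shows "R w"
proof -
  have "R (\<lambda>l. pl l (x l) (y l)) \<longleftrightarrow> R w"
  proof (rule twin_all)
    fix l assume l: "l < n"
    have B: "x l \<in> B l" "y l \<in> B l" "z l \<in> B l" using R_B x y R_z l by auto
    show "w l \<in> B l" using w[OF l] pl_B[OF l B(1,2)] B by auto
    show "pl l (x l) (y l) = w l \<or> (\<exists>u\<in>B l. pl l (x l) (y l) = circ f l u (w l))"
      using w[OF l] three_simps[OF l] B unfolding pl_def by metis
  qed
  then show ?thesis using three_R[OF x y R_z] unfolding pl_def by blast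
qed

lemma lt: "0 < n" "1 < n" "2 < n" using n3 by auto

lemma partner:
  assumes "i < n" "j < n" "i \<noteq> j" "u \<in> B i"
  shows "\<exists>a. R (z(i := u, j := a))"
  by (rule line) (use assms z_B in auto)

text \<open>The entries cancelling the two summands sit in different coordinates, so
  \<open>a\<close> and \<open>d\<close> determine the sum up to twins, in either order.
  Commutativity, associativity and independence of representatives then follow by comparing two
  tuples on one line.\<close>

lemma pl_char:
  assumes "R (z(0 := u, 1 := a))" "R (z(0 := v, 2 := d))"
  shows "R (z(0 := pl 0 u v, 1 := a, 2 := d))" "R (z(0 := pl 0 v u, 1 := a, 2 := d))"
  by (rule pl_R[OF assms] pl_R[OF assms(2,1)]; auto)+

lemma line0: "R (z(0 := u, 1 := a, 2 := d)) \<Longrightarrow> R (z(0 := v, 1 := a, 2 := d)) \<Longrightarrow> tw 0 u v"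
proof -
  assume a: "R (z(0 := u, 1 := a, 2 := d))" "R (z(0 := v, 1 := a, 2 := d))"
  have "z(0 := u, 1 := a, 2 := d) = z(1 := a, 2 := d, 0 := u)" for u by (auto simp: fun_eq_iff)
  then show ?thesis using a common_line_twin[OF lt(1), of "z(1 := a, 2 := d)" u v] by simp
qed

lemma tw_R0: "tw 0 u v \<Longrightarrow> i \<noteq> 0 \<Longrightarrow> R (z(0 := u, i := a)) \<Longrightarrow> R (z(0 := v, i := a))"
  using tw_R[of 0 u v "z(i := a)"] lt by (simp add: fun_upd_twist)

lemma pl_cong:
  assumes "tw 0 u u'" "tw 0 v v'"
  shows "tw 0 (pl 0 u v) (pl 0 u' v')"
proof -
  have B: "u \<in> B 0" "v \<in> B 0" using assms by (auto simp: tw_def)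
  obtain a where a: "R (z(0 := u, 1 := a))" using partner[of 0 1 u] B lt by auto
  obtain d where d: "R (z(0 := v, 2 := d))" using partner[of 0 2 v] B lt by auto
  show ?thesis
    by (rule line0[OF pl_char(1)[OF a d] pl_char(1)[OF tw_R0[OF assms(1) _ a] tw_R0[OF assms(2) _ d]]]) auto
qed

lemma pl_comm:
  assumes B: "u \<in> B 0" "v \<in> B 0"
  shows "tw 0 (pl 0 u v) (pl 0 v u)"
proof -
  obtain a where a: "R (z(0 := u, 1 := a))" using partner[of 0 1 u] B lt by auto
  obtain d where d: "R (z(0 := v, 2 := d))" using partner[of 0 2 v] B lt by auto
  show ?thesis by (rule line0[OF pl_char[OF a d]])
qed

lemma pl_assoc:
  assumes B: "u \<in> B 0" "v \<in> B 0" "w \<in> B 0"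
  shows "tw 0 (pl 0 (pl 0 u v) w) (pl 0 u (pl 0 v w))"
proof -
  obtain a where a: "R (z(0 := u, 1 := a))" using partner[of 0 1 u] B lt by auto
  obtain e where e: "R (z(0 := v, 2 := e))" using partner[of 0 2 v] B lt by auto
  obtain d where d: "R (z(0 := w, 2 := d))" using partner[of 0 2 w] B lt by auto
  have 1: "R (z(0 := pl 0 (pl 0 u v) w, 1 := a, 2 := pl 2 e d))"
    by (rule pl_R[OF pl_char(1)[OF a e] d]) auto
  have "R (z(0 := pl 0 v w, 2 := pl 2 e d))"
    by (rule pl_R[OF e d]) auto
  from line0[OF 1 pl_char(1)[OF a this]] show ?thesis .
qed

lemma pl_zero: "u \<in> B 0 \<Longrightarrow> tw 0 (pl 0 (z 0) u) u"
proof -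
  assume u: "u \<in> B 0"
  obtain a where a: "R (z(0 := u, 1 := a))" using partner[of 0 1 u] u lt by auto
  have "R (z(0 := pl 0 (z 0) u, 1 := a))" by (rule pl_R[OF R_z a]) auto
  moreover have "z(0 := u, 1 := a) = z(1 := a, 0 := u)" for u by (auto simp: fun_eq_iff)
  ultimately show ?thesis using a common_line_twin[OF lt(1), of "z(1 := a)"] by simp
qed

text \<open>Cancelling \<open>u\<close> by \<open>a\<close>, \<open>a\<close> by \<open>d\<close>
  and \<open>d\<close> by \<open>v\<close> negates three times. The tuple with \<open>a\<close> and
  \<open>d\<close> alone puts the sum of \<open>v\<close> and \<open>u\<close> on a common line with
  the base entry.\<close>

lemma pl_inverse: assumes u: "u \<in> B 0" shows "\<exists>v\<in>B 0. tw 0 (pl 0 v u) (z 0)"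
proof -
  obtain a where a: "R (z(0 := u, 1 := a))" using partner[of 0 1 u] u lt by auto
  have aB: "a \<in> B 1" using R_B[OF a lt(2)] by simp
  obtain d where d: "R (z(1 := a, 2 := d))" using partner[of 1 2 a] aB lt by auto
  have dB: "d \<in> B 2" using R_B[OF d lt(3)] by simp
  obtain v where v: "R (z(2 := d, 0 := v))" using partner[of 2 0 d] dB lt by auto
  have "z(2 := d, 0 := v) = z(0 := v, 2 := d)" by (auto simp: fun_eq_iff)
  then have v': "R (z(0 := v, 2 := d))" using v by simp
  have "z(0 := z 0) = z" by simp
  then have d': "R (z(0 := z 0, 1 := a, 2 := d))" using d by simp
  from line0[OF pl_char(2)[OF a v'] d'] show ?thesis using R_B[OF v' lt(1)] by auto
qed

text \<open>The group has to live on the natural numbers, so a twin class will be coded by the least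
  number of a member under some injection of \<open>B 0\<close>.\<close>

definition num :: "'a \<Rightarrow> nat" where
  "num = (SOME g. inj_on g (B 0))"

definition kl :: "'a \<Rightarrow> nat" where "kl u = (LEAST k. \<exists>v\<in>B 0. tw 0 u v \<and> num v = k)"

lemma num_inj: "inj_on num (B 0)"
  unfolding num_def using finite_imp_inj_to_nat_seg[OF finB] by (metis someI_ex)

lemma kl_eq: assumes "u \<in> B 0" "v \<in> B 0" shows "kl u = kl v \<longleftrightarrow> tw 0 u v"
proof
  have ex: "\<exists>v\<in>B 0. tw 0 u v \<and> num v = kl u" if "u \<in> B 0" for u
    unfolding kl_def by (rule LeastI_ex) (use that tw_refl in blast)
  assume "kl u = kl v"
  then obtain a b where "a \<in> B 0" "tw 0 u a" "b \<in> B 0" "tw 0 v b" "num a = num b"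
    using ex[OF assms(1)] ex[OF assms(2)] by metis
  then show "tw 0 u v" using num_inj tw_sym tw_trans unfolding inj_on_def by metis
next
  assume "tw 0 u v"
  then have "tw 0 u w \<longleftrightarrow> tw 0 v w" for w using tw_sym tw_trans by blast
  then show "kl u = kl v" unfolding kl_def by simp
qed

definition pick :: "nat \<Rightarrow> 'a" where "pick k = (SOME u. u \<in> B 0 \<and> kl u = k)"

lemma pick: assumes "u \<in> B 0" shows "pick (kl u) \<in> B 0" "tw 0 (pick (kl u)) u"
proof -
  have 1: "pick (kl u) \<in> B 0 \<and> kl (pick (kl u)) = kl u"
    unfolding pick_def by (rule someI[of _ u]) (use assms in simp)
  then show "pick (kl u) \<in> B 0" by simp
  show "tw 0 (pick (kl u)) u" using 1 kl_eq assms by blast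
qed

definition G :: "nat monoid" where
  "G = \<lparr>carrier = kl ` B 0, monoid.mult = (\<lambda>p q. kl (pl 0 (pick p) (pick q))), one = kl (z 0)\<rparr>"

lemma G_simps: "carrier G = kl ` B 0" "\<one>\<^bsub>G\<^esub> = kl (z 0)"
  by (simp_all add: G_def)

lemma G_mult: "u \<in> B 0 \<Longrightarrow> v \<in> B 0 \<Longrightarrow> kl u \<otimes>\<^bsub>G\<^esub> kl v = kl (pl 0 u v)"
  unfolding G_def using pl_cong[OF pick(2) pick(2), of u v] kl_eq pl_B pick(1) lt by simp

lemma G_comm_group: "comm_group G"
proof (rule comm_groupI)
  fix x y assume "x \<in> carrier G" "y \<in> carrier G"
  then show "x \<otimes>\<^bsub>G\<^esub> y \<in> carrier G" by (auto simp: G_simps G_mult pl_B lt)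
next
  show "\<one>\<^bsub>G\<^esub> \<in> carrier G" by (auto simp: G_simps z_B lt)
next
  fix x y w assume "x \<in> carrier G" "y \<in> carrier G" "w \<in> carrier G"
  then show "x \<otimes>\<^bsub>G\<^esub> y \<otimes>\<^bsub>G\<^esub> w = x \<otimes>\<^bsub>G\<^esub> (y \<otimes>\<^bsub>G\<^esub> w)"
    by (auto simp: G_simps G_mult pl_B lt kl_eq pl_assoc)
next
  fix x y assume "x \<in> carrier G" "y \<in> carrier G"
  then show "x \<otimes>\<^bsub>G\<^esub> y = y \<otimes>\<^bsub>G\<^esub> x" by (auto simp: G_simps G_mult pl_B lt kl_eq pl_comm)
next
  fix x assume "x \<in> carrier G"
  then show "\<one>\<^bsub>G\<^esub> \<otimes>\<^bsub>G\<^esub> x = x" by (auto simp: G_simps G_mult pl_B lt kl_eq pl_zero z_B)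
next
  fix x assume "x \<in> carrier G"
  then obtain u where u: "u \<in> B 0" "x = kl u" by (auto simp: G_simps)
  obtain v where v: "v \<in> B 0" "tw 0 (pl 0 v u) (z 0)" using pl_inverse u by blast
  have "kl v \<otimes>\<^bsub>G\<^esub> x = \<one>\<^bsub>G\<^esub>" using u v by (simp add: G_mult G_simps kl_eq pl_B lt z_B)
  then show "\<exists>y\<in>carrier G. y \<otimes>\<^bsub>G\<^esub> x = \<one>\<^bsub>G\<^esub>" using v by (auto simp: G_simps)
qed

text \<open>The entry at 0 that cancels \<open>v\<close> at \<open>i\<close>. A tuple lies in the
  relation when its entry at 0 is, up to twins, the sum of the \<open>sol\<close> of the others;
  moving that entry to the same side accounts for the inverse in \<open>ph 0\<close>.\<close>

definition sol where "sol i v = (SOME u. R (z(0 := u, i := v)))"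

definition ph where "ph i v = (if i = 0 then inv\<^bsub>G\<^esub> (kl v) else kl (sol i v))"

lemma sol: assumes "i < n" "i \<noteq> 0" "v \<in> B i" shows "R (z(0 := sol i v, i := v))"
proof -
  obtain u where "R (z(i := v, 0 := u))" using partner[of i 0 v] assms lt by auto
  moreover have "z(i := v, 0 := u) = z(0 := u, i := v)" using assms by (auto simp: fun_eq_iff)
  ultimately have "R (z(0 := u, i := v))" by simp
  then show ?thesis unfolding sol_def by (rule someI)
qed

lemma sol_B: assumes "i < n" "i \<noteq> 0" "v \<in> B i" shows "sol i v \<in> B 0"
  using R_B[OF sol[OF assms] lt(1)] assms by simp

lemma ph_surj: assumes i: "i < n" shows "ph i ` B i = carrier G"
proof (cases "i = 0")
  case True
  interpret comm_group G by (rule G_comm_group)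
  show ?thesis
  proof
    have "inv\<^bsub>G\<^esub> (kl u) \<in> carrier G" if "u \<in> B 0" for u
      using that by (intro inv_closed) (simp add: G_simps)
    then show "ph i ` B i \<subseteq> carrier G" using True by (auto simp: ph_def)
    show "carrier G \<subseteq> ph i ` B i"
    proof
      fix g assume g: "g \<in> carrier G"
      then have "inv\<^bsub>G\<^esub> g \<in> kl ` B 0" using inv_closed G_simps by blast
      then obtain u where "u \<in> B 0" "inv\<^bsub>G\<^esub> g = kl u" by blast
      then have "u \<in> B 0" "g = inv\<^bsub>G\<^esub> (kl u)" using g inv_inv by metis+
      then show "g \<in> ph i ` B i" using True by (auto simp: ph_def)
    qed
  qed
next
  case False
  show ?thesis
  proof
    show "ph i ` B i \<subseteq> carrier G" using False i by (auto simp: ph_def G_simps sol_B)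
    show "carrier G \<subseteq> ph i ` B i"
    proof
      fix g assume "g \<in> carrier G"
      then obtain u where u: "u \<in> B 0" "g = kl u" by (auto simp: G_simps)
      obtain v where v: "R (z(0 := u, i := v))" using partner[of 0 i u] u i False lt by auto
      have vB: "v \<in> B i" using R_B[OF v i] by simp
      have sw: "z(0 := u, i := v) = z(i := v, 0 := u)" for u using False by (auto simp: fun_eq_iff)
      have "tw 0 (sol i v) u" using common_line_twin[OF lt(1)] sol[OF i False vB] v unfolding sw by blast
      then have "kl (sol i v) = g" using u kl_eq sol_B[OF i False vB] by blast
      then show "g \<in> ph i ` B i" using vB False by (auto simp: ph_def)
    qed
  qed
qed

lemma R_iff_finprod:
  assumes x: "\<And>i. i < n \<Longrightarrow> x i \<in> B i"
  shows "R x \<longleftrightarrow> finprod G (\<lambda>i. ph i (x i)) {..<n} = \<one>\<^bsub>G\<^esub>"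
proof -
  interpret comm_group G by (rule G_comm_group)
  have car: "ph i (x i) \<in> carrier G" if "i < n" for i using ph_surj[OF that] x[OF that] by blast
  \<comment> \<open>Partial sums: \<open>u\<close> is the entry at 0 required by the coordinates of
    \<open>x\<close> from 1 to \<open>l\<close>, while all later coordinates are still those of the
    base tuple.\<close>
  have "\<exists>u\<in>B 0. kl u = finprod G (\<lambda>i. ph i (x i)) {1..<Suc l} \<and>
      R (\<lambda>i. if i = 0 then u else if i < Suc l then x i else z i)" if "l < n" for l
    using that
  proof (induction l)
    case 0
    have "R (\<lambda>i. if i = 0 then z 0 else if i < Suc 0 then x i else z i)"
      by (rule local[OF R_z]) auto
    then show ?case using z_B lt G_simps by auto
  next
    case (Suc l)
    then obtain u where u: "u \<in> B 0" "kl u = finprod G (\<lambda>i. ph i (x i)) {1..<Suc l}"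
      "R (\<lambda>i. if i = 0 then u else if i < Suc l then x i else z i)" by auto
    let ?k = "Suc l"
    have k: "?k < n" "?k \<noteq> 0" using Suc by auto
    let ?v = "sol ?k (x ?k)"
    have v: "R (z(0 := ?v, ?k := x ?k))" "?v \<in> B 0" using sol sol_B k x by auto
    have "finprod G (\<lambda>i. ph i (x i)) {1..<Suc ?k} = ph ?k (x ?k) \<otimes>\<^bsub>G\<^esub> finprod G (\<lambda>i. ph i (x i)) {1..<?k}"
    proof -
      have "{1..<Suc ?k} = insert ?k {1..<?k}" by auto
      then show ?thesis using car k by (simp add: finprod_insert Pi_def)
    qed
    also have "\<dots> = kl (pl 0 ?v u)" unfolding u(2)[symmetric] ph_def[of ?k] using u(1) v(2) by (simp add: G_mult)
    finally have "kl (pl 0 ?v u) = finprod G (\<lambda>i. ph i (x i)) {1..<Suc ?k}" by simp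
    moreover have "R (\<lambda>i. if i = 0 then pl 0 ?v u else if i < Suc ?k then x i else z i)"
      by (rule pl_R[OF v(1) u(3)]) (auto simp: less_Suc_eq)
    ultimately show ?case using pl_B u v lt by blast
  qed
  moreover have "Suc (n - 1) = n" "n - 1 < n" using n3 by auto
  ultimately obtain u where u: "u \<in> B 0" "kl u = finprod G (\<lambda>i. ph i (x i)) {1..<n}"
      "R (\<lambda>i. if i = 0 then u else if i < n then x i else z i)" by metis
  have xu: "R (x(0 := u))" by (rule local[OF u(3)]) auto
  have "R x \<longleftrightarrow> tw 0 u (x 0)"
    using common_line_twin[OF lt(1) xu, of "x 0"] tw_R[OF _ xu lt(1), of "x 0"] by auto
  also have "\<dots> \<longleftrightarrow> kl u = kl (x 0)" using kl_eq u x lt by blast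
  also have "\<dots> \<longleftrightarrow> inv\<^bsub>G\<^esub> (kl (x 0)) \<otimes>\<^bsub>G\<^esub> kl u = \<one>\<^bsub>G\<^esub>"
  proof -
    have c: "kl u \<in> carrier G" "kl (x 0) \<in> carrier G" using u(1) x lt(1) by (auto simp: G_simps)
    then show ?thesis by (metis inv_closed inv_inv inv_equality l_inv)
  qed
  also have "inv\<^bsub>G\<^esub> (kl (x 0)) \<otimes>\<^bsub>G\<^esub> kl u = finprod G (\<lambda>i. ph i (x i)) {..<n}"
  proof -
    have "{..<n} = insert 0 {1..<n}" using lt by auto
    moreover have "finprod G (\<lambda>i. ph i (x i)) (insert 0 {1..<n}) = ph 0 (x 0) \<otimes>\<^bsub>G\<^esub> finprod G (\<lambda>i. ph i (x i)) {1..<n}"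
      by (rule finprod_insert) (use car lt in \<open>auto simp: Pi_def\<close>)
    ultimately show ?thesis unfolding u(2) ph_def[of 0] by (simp del: One_nat_def)
  qed
  finally show ?thesis .
qed

end

lemma (in twin_block) block_group:
  obtains G :: "nat monoid" and \<phi> where "comm_group G" "finite (carrier G)"
    "\<And>i. i < n \<Longrightarrow> \<phi> i ` B i = carrier G"
    "\<And>x. (\<And>i. i < n \<Longrightarrow> x i \<in> B i) \<Longrightarrow> R x \<longleftrightarrow> finprod G (\<lambda>i. \<phi> i (x i)) {..<n} = \<one>\<^bsub>G\<^esub>"
proof -
  obtain z where "R z" by (rule origin)
  then interpret pointed_twin_block n B R m f z by unfold_locales
  show thesis
    by (rule that[OF G_comm_group _ ph_surj R_iff_finprod]) (auto simp: G_simps finB)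
qed

section \<open>Linear systems over abelian groups\<close>

definition linsys :: "nat \<Rightarrow> (nat \<Rightarrow> 'a set) \<Rightarrow> ((nat \<Rightarrow> 'a) \<Rightarrow> bool) \<Rightarrow> nat monoid \<Rightarrow> (nat \<Rightarrow> 'a \<Rightarrow> nat) \<Rightarrow> bool" where
  "linsys n B R G \<phi> \<longleftrightarrow> comm_group G \<and> finite (carrier G) \<and> (\<forall>i<n. \<phi> i ` B i = carrier G) \<and>
     (\<forall>x. (\<forall>i<n. x i \<in> B i) \<longrightarrow> (R x \<longleftrightarrow> finprod G (\<lambda>i. \<phi> i (x i)) {..<n} = \<one>\<^bsub>G\<^esub>))"

lemma (in comm_group) four_term:
  assumes car: "a1 \<in> carrier G" "a2 \<in> carrier G" "a3 \<in> carrier G" "a4 \<in> carrier G" "b \<in> carrier G" "b' \<in> carrier G"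
    "c \<in> carrier G" "c' \<in> carrier G" "d \<in> carrier G"
    and eq: "a1 \<otimes> (b \<otimes> (c \<otimes> d)) = \<one>" "a2 \<otimes> (b' \<otimes> (c \<otimes> d)) = \<one>" "a3 \<otimes> (b \<otimes> (c' \<otimes> d)) = \<one>"
  shows "a4 \<otimes> (b' \<otimes> (c' \<otimes> d)) = \<one> \<longleftrightarrow> a1 \<otimes> a4 = a2 \<otimes> a3"
proof -
  let ?w = "(b \<otimes> (c \<otimes> d)) \<otimes> (b' \<otimes> (c' \<otimes> d))"
  have 1: "(a1 \<otimes> a4) \<otimes> ?w = (a1 \<otimes> (b \<otimes> (c \<otimes> d))) \<otimes> (a4 \<otimes> (b' \<otimes> (c' \<otimes> d)))"
    using car by (simp add: m_ac)
  have 2: "(a2 \<otimes> a3) \<otimes> ?w = (a2 \<otimes> (b' \<otimes> (c \<otimes> d))) \<otimes> (a3 \<otimes> (b \<otimes> (c' \<otimes> d)))"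
    using car by (simp add: m_ac)
  have "a4 \<otimes> (b' \<otimes> (c' \<otimes> d)) = (a1 \<otimes> a4) \<otimes> ?w" using 1 eq car by simp
  moreover have "(a2 \<otimes> a3) \<otimes> ?w = \<one>" using 2 eq by simp
  moreover have "(a1 \<otimes> a4) \<otimes> ?w = (a2 \<otimes> a3) \<otimes> ?w \<longleftrightarrow> a1 \<otimes> a4 = a2 \<otimes> a3" using car by simp
  ultimately show ?thesis by simp
qed

lemma linsys_split:
  assumes L: "linsys n B R G \<phi>" and x: "\<And>i. i < n \<Longrightarrow> x i \<in> B i"
    and ijk: "i < n" "j < n" "k < n" "i \<noteq> j" "i \<noteq> k" "j \<noteq> k"
  shows "finprod G (\<lambda>l. \<phi> l (x l)) {..<n} =
      \<phi> i (x i) \<otimes>\<^bsub>G\<^esub> (\<phi> j (x j) \<otimes>\<^bsub>G\<^esub> (\<phi> k (x k) \<otimes>\<^bsub>G\<^esub> finprod G (\<lambda>l. \<phi> l (x l)) ({..<n} - {i, j, k})))"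
    and "finprod G (\<lambda>l. \<phi> l (x l)) ({..<n} - {i, j, k}) \<in> carrier G"
proof -
  interpret comm_group G using L by (simp add: linsys_def)
  have car: "\<phi> l (x l) \<in> carrier G" if "l < n" for l using L x that unfolding linsys_def by blast
  have "{..<n} = insert i (insert j (insert k ({..<n} - {i, j, k})))" using ijk by auto
  then have "finprod G (\<lambda>l. \<phi> l (x l)) {..<n} = finprod G (\<lambda>l. \<phi> l (x l)) (insert i (insert j (insert k ({..<n} - {i, j, k}))))"
    by simp
  also have "\<dots> = \<phi> i (x i) \<otimes>\<^bsub>G\<^esub> (\<phi> j (x j) \<otimes>\<^bsub>G\<^esub> (\<phi> k (x k) \<otimes>\<^bsub>G\<^esub> finprod G (\<lambda>l. \<phi> l (x l)) ({..<n} - {i, j, k})))"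
    using ijk car by (subst finprod_insert; auto simp: Pi_def)+
  finally show "finprod G (\<lambda>l. \<phi> l (x l)) {..<n} =
      \<phi> i (x i) \<otimes>\<^bsub>G\<^esub> (\<phi> j (x j) \<otimes>\<^bsub>G\<^esub> (\<phi> k (x k) \<otimes>\<^bsub>G\<^esub> finprod G (\<lambda>l. \<phi> l (x l)) ({..<n} - {i, j, k})))" .
  show "finprod G (\<lambda>l. \<phi> l (x l)) ({..<n} - {i, j, k}) \<in> carrier G"
    by (rule finprod_closed) (use car in auto)
qed

text \<open>An equation \<open>a1 + a4 = a2 + a3\<close> in the group becomes membership of four
  tuples, in which \<open>b\<close>, \<open>b'\<close>, \<open>c\<close> and \<open>c'\<close> occur
  twice each and cancel. In this form it is transported by preserving vector-functions.\<close>

lemma linsys_four: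
  assumes L: "linsys n B R G \<phi>" and x: "\<And>i. i < n \<Longrightarrow> x i \<in> B i"
    and ijk: "i < n" "j < n" "k < n" "i \<noteq> j" "i \<noteq> k" "j \<noteq> k"
    and mem: "a1 \<in> B i" "a2 \<in> B i" "a3 \<in> B i" "a4 \<in> B i" "b \<in> B j" "b' \<in> B j" "c \<in> B k" "c' \<in> B k"
    and R: "R (x(i := a1, j := b, k := c))" "R (x(i := a2, j := b', k := c))" "R (x(i := a3, j := b, k := c'))"
  shows "R (x(i := a4, j := b', k := c')) \<longleftrightarrow> \<phi> i a1 \<otimes>\<^bsub>G\<^esub> \<phi> i a4 = \<phi> i a2 \<otimes>\<^bsub>G\<^esub> \<phi> i a3"
proof -
  interpret comm_group G using L by (simp add: linsys_def)
  define D where "D = finprod G (\<lambda>l. \<phi> l (x l)) ({..<n} - {i, j, k})"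
  have D: "D \<in> carrier G" unfolding D_def by (rule linsys_split(2)[OF L x ijk])
  have eq: "R (x(i := a, j := b, k := c)) \<longleftrightarrow> \<phi> i a \<otimes>\<^bsub>G\<^esub> (\<phi> j b \<otimes>\<^bsub>G\<^esub> (\<phi> k c \<otimes>\<^bsub>G\<^esub> D)) = \<one>\<^bsub>G\<^esub>"
    if abc: "a \<in> B i" "b \<in> B j" "c \<in> B k" for a b c
  proof -
    let ?y = "x(i := a, j := b, k := c)"
    have y: "?y l \<in> B l" if "l < n" for l using that x abc by auto
    have "finprod G (\<lambda>l. \<phi> l (?y l)) ({..<n} - {i, j, k}) = D"
      unfolding D_def by (rule finprod_cong') (use L x in \<open>auto simp: linsys_def\<close>)
    then have "finprod G (\<lambda>l. \<phi> l (?y l)) {..<n} = \<phi> i a \<otimes>\<^bsub>G\<^esub> (\<phi> j b \<otimes>\<^bsub>G\<^esub> (\<phi> k c \<otimes>\<^bsub>G\<^esub> D))"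
      using linsys_split(1)[OF L y ijk] ijk by simp
    moreover have "R ?y \<longleftrightarrow> finprod G (\<lambda>l. \<phi> l (?y l)) {..<n} = \<one>\<^bsub>G\<^esub>"
      using L y unfolding linsys_def by blast
    ultimately show ?thesis by (simp only:)
  qed
  have car: "\<phi> l u \<in> carrier G" if "l < n" "u \<in> B l" for l u using L that unfolding linsys_def by blast
  show ?thesis
    unfolding eq[OF mem(4,6,8)]
    by (rule four_term[OF _ _ _ _ _ _ _ _ D eq[OF mem(1,5,7), THEN iffD1, OF R(1)] eq[OF mem(2,6,7), THEN iffD1, OF R(2)]
          eq[OF mem(3,5,8), THEN iffD1, OF R(3)]]) (use car mem ijk in auto)
qed

text \<open>The value of the equation is the defect of \<open>x\<close>: one coordinate can give it
  any value, and the entry of \<open>x\<close> at \<open>i\<close> exceeds that of a repair by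
  exactly the defect.\<close>

lemma linsys_line:
  assumes L: "linsys n B R G \<phi>" and x: "\<And>i. i < n \<Longrightarrow> x i \<in> B i" and i: "i < n" and g: "g \<in> carrier G"
  shows "\<exists>b\<in>B i. finprod G (\<lambda>l. \<phi> l ((x(i := b)) l)) {..<n} = g"
    and "\<exists>b\<in>B i. R (x(i := b)) \<and> \<phi> i (x i) = \<phi> i b \<otimes>\<^bsub>G\<^esub> finprod G (\<lambda>l. \<phi> l (x l)) {..<n}"
proof -
  interpret comm_group G using L by (simp add: linsys_def)
  have car: "\<phi> l u \<in> carrier G" if "l < n" "u \<in> B l" for l u using L that unfolding linsys_def by blast
  define D where "D = finprod G (\<lambda>l. \<phi> l (x l)) ({..<n} - {i})"
  have D: "D \<in> carrier G" unfolding D_def by (rule finprod_closed) (use car x in auto)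
  have sp: "finprod G (\<lambda>l. \<phi> l ((x(i := b)) l)) {..<n} = \<phi> i b \<otimes>\<^bsub>G\<^esub> D" if b: "b \<in> B i" for b
  proof -
    have "{..<n} = insert i ({..<n} - {i})" using i by auto
    then have "finprod G (\<lambda>l. \<phi> l ((x(i := b)) l)) {..<n} = finprod G (\<lambda>l. \<phi> l ((x(i := b)) l)) (insert i ({..<n} - {i}))" by simp
    also have "\<dots> = \<phi> i ((x(i := b)) i) \<otimes>\<^bsub>G\<^esub> finprod G (\<lambda>l. \<phi> l ((x(i := b)) l)) ({..<n} - {i})"
      by (rule finprod_insert) (use car x b i in auto)
    also have "finprod G (\<lambda>l. \<phi> l ((x(i := b)) l)) ({..<n} - {i}) = D"
      unfolding D_def by (rule finprod_cong') (use car x in auto)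
    finally show ?thesis by simp
  qed
  have ex: "\<exists>b\<in>B i. finprod G (\<lambda>l. \<phi> l ((x(i := b)) l)) {..<n} = g" if g: "g \<in> carrier G" for g
  proof -
    have "g \<otimes>\<^bsub>G\<^esub> inv\<^bsub>G\<^esub> D \<in> \<phi> i ` B i" using L i g D unfolding linsys_def by auto
    then obtain b where b: "b \<in> B i" "\<phi> i b = g \<otimes>\<^bsub>G\<^esub> inv\<^bsub>G\<^esub> D" by auto
    then have "\<phi> i b \<otimes>\<^bsub>G\<^esub> D = g" using g D by (simp add: m_assoc)
    then show ?thesis using sp b by blast
  qed
  show "\<exists>b\<in>B i. finprod G (\<lambda>l. \<phi> l ((x(i := b)) l)) {..<n} = g" by (rule ex[OF g])
  obtain b where b: "b \<in> B i" "finprod G (\<lambda>l. \<phi> l ((x(i := b)) l)) {..<n} = \<one>\<^bsub>G\<^esub>" using ex one_closed by blast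
  have "(x(i := b)) l \<in> B l" if "l < n" for l using x b that by simp
  then have R: "R (x(i := b))" using L b(2) unfolding linsys_def by blast
  have 1: "\<phi> i b \<otimes>\<^bsub>G\<^esub> D = \<one>\<^bsub>G\<^esub>" using sp b by simp
  have 2: "finprod G (\<lambda>l. \<phi> l (x l)) {..<n} = \<phi> i (x i) \<otimes>\<^bsub>G\<^esub> D" using sp[OF x[OF i]] by simp
  have "\<phi> i b \<otimes>\<^bsub>G\<^esub> (\<phi> i (x i) \<otimes>\<^bsub>G\<^esub> D) = \<phi> i (x i) \<otimes>\<^bsub>G\<^esub> (\<phi> i b \<otimes>\<^bsub>G\<^esub> D)"
    using car[OF i b(1)] car[OF i x[OF i]] D by (simp add: m_lcomm)
  then have "\<phi> i (x i) = \<phi> i b \<otimes>\<^bsub>G\<^esub> finprod G (\<lambda>l. \<phi> l (x l)) {..<n}" unfolding 1 2 using car[OF i x[OF i]] by simp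
  then show "\<exists>b\<in>B i. R (x(i := b)) \<and> \<phi> i (x i) = \<phi> i b \<otimes>\<^bsub>G\<^esub> finprod G (\<lambda>l. \<phi> l (x l)) {..<n}"
    using R b by blast
qed

text \<open>By \<open>linsys_four\<close>, used in both directions, \<open>\<Psi>\<close> acts on
  the values at coordinate 0 as an affine map. It sends a repair of \<open>\<alpha>\<close> to a
  repair of the image, hence the step by one defect to the step by the other, and multiples to
  multiples.\<close>

lemma linsys_order:
  assumes n3: "3 \<le> n" and L: "linsys n B R G \<phi>" and L': "linsys n V R' G' \<phi>'"
    and \<Psi>: "\<And>i b. i < n \<Longrightarrow> b \<in> B i \<Longrightarrow> \<Psi> i b \<in> V i" "\<And>x. R x \<Longrightarrow> R' (\<lambda>i. \<Psi> i (x i))"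
    and \<alpha>: "\<And>i. i < n \<Longrightarrow> \<alpha> i \<in> B i"
    and q: "finprod G (\<lambda>i. \<phi> i (\<alpha> i)) {..<n} [^]\<^bsub>G\<^esub> (q::nat) = \<one>\<^bsub>G\<^esub>"
  shows "finprod G' (\<lambda>i. \<phi>' i (\<Psi> i (\<alpha> i))) {..<n} [^]\<^bsub>G'\<^esub> q = \<one>\<^bsub>G'\<^esub>"
proof -
  interpret G: comm_group G using L by (simp add: linsys_def)
  interpret G': comm_group G' using L' by (simp add: linsys_def)
  have lt0: "0 < n" "1 < n" "2 < n" using n3 by auto
  then obtain j k where lt: "0 < n" "j < n" "k < n" and ne: "0 \<noteq> j" "0 \<noteq> k" "j \<noteq> k"
    by (metis zero_neq_one zero_neq_numeral numeral_eq_one_iff num.distinct(1) one_eq_numeral_iff)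
  have car: "\<phi> l u \<in> carrier G" if "l < n" "u \<in> B l" for l u using L that unfolding linsys_def by blast
  have car': "\<phi>' l (\<Psi> l u) \<in> carrier G'" if "l < n" "u \<in> B l" for l u using L' \<Psi>(1) that unfolding linsys_def by blast
  have line: "\<exists>b\<in>B i. R (x(i := b))" if "\<And>i. i < n \<Longrightarrow> x i \<in> B i" "i < n" for x i
    using linsys_line(2)[OF L that G.one_closed] by blast
  have rel: "\<phi>' 0 (\<Psi> 0 a1) \<otimes>\<^bsub>G'\<^esub> \<phi>' 0 (\<Psi> 0 a4) = \<phi>' 0 (\<Psi> 0 a2) \<otimes>\<^bsub>G'\<^esub> \<phi>' 0 (\<Psi> 0 a3)"
    if a: "a1 \<in> B 0" "a2 \<in> B 0" "a3 \<in> B 0" "a4 \<in> B 0" and eq: "\<phi> 0 a1 \<otimes>\<^bsub>G\<^esub> \<phi> 0 a4 = \<phi> 0 a2 \<otimes>\<^bsub>G\<^esub> \<phi> 0 a3" for a1 a2 a3 a4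
  proof -
    have third: "\<exists>c\<in>B k. R (\<alpha>(0 := u, j := \<alpha> j, k := c))" if "u \<in> B 0" for u
      by (rule line) (use that \<alpha> lt in auto)
    obtain c where c: "c \<in> B k" "R (\<alpha>(0 := a1, j := \<alpha> j, k := c))" using third[OF a(1)] by blast
    have "\<exists>b\<in>B j. R (\<alpha>(0 := a2, k := c, j := b))"
      by (rule line) (use a \<alpha> c lt in auto)
    then obtain b where b: "b \<in> B j" "R (\<alpha>(0 := a2, k := c, j := b))" by blast
    have "\<alpha>(0 := a2, k := c, j := b) = \<alpha>(0 := a2, j := b, k := c)" using ne by (auto simp: fun_eq_iff)
    then have b2: "R (\<alpha>(0 := a2, j := b, k := c))" using b by simp
    obtain c' where c': "c' \<in> B k" "R (\<alpha>(0 := a3, j := \<alpha> j, k := c'))" using third[OF a(3)] by blast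
    have R4: "R (\<alpha>(0 := a4, j := b, k := c'))"
      by (rule linsys_four[OF L \<alpha> lt ne a \<alpha>[OF lt(2)] b(1) c(1) c'(1) c(2) b2 c'(2), THEN iffD2, OF _ eq])
    let ?x = "\<lambda>i. \<Psi> i (\<alpha> i)"
    have tr: "(\<lambda>i. \<Psi> i ((\<alpha>(0 := a, j := b, k := c)) i)) = ?x(0 := \<Psi> 0 a, j := \<Psi> j b, k := \<Psi> k c)" for a b c
      using ne by (auto simp: fun_eq_iff)
    have V: "?x i \<in> V i" if "i < n" for i using \<Psi>(1) \<alpha> that by blast
    show ?thesis
      by (rule linsys_four[OF L' V lt ne \<Psi>(1)[OF lt(1) a(1)] \<Psi>(1)[OF lt(1) a(2)] \<Psi>(1)[OF lt(1) a(3)] \<Psi>(1)[OF lt(1) a(4)]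
         \<Psi>(1)[OF lt(2) \<alpha>[OF lt(2)]] \<Psi>(1)[OF lt(2) b(1)] \<Psi>(1)[OF lt(3) c(1)] \<Psi>(1)[OF lt(3) c'(1)]
         \<Psi>(2)[OF c(2), unfolded tr] \<Psi>(2)[OF b2, unfolded tr] \<Psi>(2)[OF c'(2), unfolded tr],
         THEN iffD1, OF _ \<Psi>(2)[OF R4, unfolded tr]])
  qed
  define g where "g = finprod G (\<lambda>i. \<phi> i (\<alpha> i)) {..<n}"
  define c where "c = finprod G' (\<lambda>i. \<phi>' i (\<Psi> i (\<alpha> i))) {..<n}"
  have gc: "g \<in> carrier G" unfolding g_def by (rule G.finprod_closed) (use car \<alpha> in auto)
  have cc: "c \<in> carrier G'" unfolding c_def by (rule G'.finprod_closed) (use car' \<alpha> in auto)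
  obtain u where u: "u \<in> B 0" "R (\<alpha>(0 := u))" "\<phi> 0 (\<alpha> 0) = \<phi> 0 u \<otimes>\<^bsub>G\<^esub> g"
    using linsys_line(2)[OF L \<alpha> lt(1) G.one_closed] unfolding g_def by blast
  have u': "\<phi>' 0 (\<Psi> 0 (\<alpha> 0)) = \<phi>' 0 (\<Psi> 0 u) \<otimes>\<^bsub>G'\<^esub> c"
  proof -
    have V: "\<Psi> i (\<alpha> i) \<in> V i" if "i < n" for i using \<Psi>(1) \<alpha> that by blast
    obtain b where b: "b \<in> V 0" "R' ((\<lambda>i. \<Psi> i (\<alpha> i))(0 := b))" "\<phi>' 0 (\<Psi> 0 (\<alpha> 0)) = \<phi>' 0 b \<otimes>\<^bsub>G'\<^esub> c"
      using linsys_line(2)[OF L' V lt(1) G'.one_closed] unfolding c_def by blast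
    have "(\<lambda>i. \<Psi> i ((\<alpha>(0 := u)) i)) = (\<lambda>i. \<Psi> i (\<alpha> i))(0 := \<Psi> 0 u)" using ne by (auto simp: fun_eq_iff)
    then have 2: "R' ((\<lambda>i. \<Psi> i (\<alpha> i))(0 := \<Psi> 0 u))" using \<Psi>(2)[OF u(2)] by simp
    have t: "((\<lambda>i. \<Psi> i (\<alpha> i))(0 := w, j := \<Psi> j (\<alpha> j), k := \<Psi> k (\<alpha> k))) = ((\<lambda>i. \<Psi> i (\<alpha> i))(0 := w))" for w
      using ne by (auto simp: fun_eq_iff)
    \<comment> \<open>A degenerate instance of \<open>linsys_four\<close>, with equal entries at
      \<open>j\<close> and at \<open>k\<close>: two repairs on one line have the same value.\<close>
    have "\<phi>' 0 b \<otimes>\<^bsub>G'\<^esub> \<phi>' 0 b = \<phi>' 0 (\<Psi> 0 u) \<otimes>\<^bsub>G'\<^esub> \<phi>' 0 b"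
      by (rule linsys_four[OF L' V lt ne b(1) \<Psi>(1)[OF lt(1) u(1)] b(1) b(1)
         \<Psi>(1)[OF lt(2) \<alpha>[OF lt(2)]] \<Psi>(1)[OF lt(2) \<alpha>[OF lt(2)]] \<Psi>(1)[OF lt(3) \<alpha>[OF lt(3)]] \<Psi>(1)[OF lt(3) \<alpha>[OF lt(3)]], unfolded t, THEN iffD1, OF _ b(2) 2 b(2) b(2)])
    moreover have "\<phi>' 0 b \<in> carrier G'" using L' b lt unfolding linsys_def by blast
    ultimately have "\<phi>' 0 b = \<phi>' 0 (\<Psi> 0 u)" using car'[OF lt(1) u(1)] by simp
    then show ?thesis using b by simp
  qed
  note cu = car[OF lt(1) u(1)] car'[OF lt(1) u(1)]
  have "\<phi>' 0 (\<Psi> 0 w) = \<phi>' 0 (\<Psi> 0 u) \<otimes>\<^bsub>G'\<^esub> c [^]\<^bsub>G'\<^esub> t"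
    if "w \<in> B 0" "\<phi> 0 w = \<phi> 0 u \<otimes>\<^bsub>G\<^esub> g [^]\<^bsub>G\<^esub> t" for w and t :: nat
    using that
  proof (induction t arbitrary: w)
    case 0
    then have "\<phi> 0 w = \<phi> 0 u" using cu by simp
    from rel[OF 0(1) u(1) u(1) u(1)] this show ?case using car'[OF lt(1) 0(1)] cu by simp
  next
    case (Suc t)
    have "\<phi> 0 u \<otimes>\<^bsub>G\<^esub> g [^]\<^bsub>G\<^esub> t \<in> \<phi> 0 ` B 0" using L lt cu gc unfolding linsys_def by auto
    then obtain v where v: "v \<in> B 0" "\<phi> 0 v = \<phi> 0 u \<otimes>\<^bsub>G\<^esub> g [^]\<^bsub>G\<^esub> t" by auto
    have "\<phi> 0 w \<otimes>\<^bsub>G\<^esub> \<phi> 0 u = \<phi> 0 (\<alpha> 0) \<otimes>\<^bsub>G\<^esub> \<phi> 0 v"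
      unfolding Suc.prems(2) v(2) u(3) using cu gc by (simp add: G.m_ac)
    from rel[OF Suc.prems(1) \<alpha>[OF lt(1)] v(1) u(1) this]
    have "\<phi>' 0 (\<Psi> 0 w) \<otimes>\<^bsub>G'\<^esub> \<phi>' 0 (\<Psi> 0 u) = (\<phi>' 0 (\<Psi> 0 u) \<otimes>\<^bsub>G'\<^esub> c [^]\<^bsub>G'\<^esub> Suc t) \<otimes>\<^bsub>G'\<^esub> \<phi>' 0 (\<Psi> 0 u)"
      unfolding u' Suc.IH[OF v] using cu cc by (simp add: G'.m_ac)
    then show ?case using car'[OF lt(1) Suc.prems(1)] cu cc by simp
  qed
  from this[OF u(1), of q] have "\<phi>' 0 (\<Psi> 0 u) = \<phi>' 0 (\<Psi> 0 u) \<otimes>\<^bsub>G'\<^esub> c [^]\<^bsub>G'\<^esub> q"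
    using q cu unfolding g_def[symmetric] by simp
  then show ?thesis unfolding c_def[symmetric] using cu cc G'.l_cancel_one' by simp
qed

text \<open>Entries of \<open>V\<close> are left identities, so the twin condition is literally an
  equality of tuples; \<open>V_T\<close> and \<open>V_step\<close> supply repairs that stay in the
  block.\<close>

lemma (in rigid_core) core_linsys:
  obtains G :: "nat monoid" and \<phi> where "linsys n V R G \<phi>"
proof -
  define RV where "RV x \<longleftrightarrow> R x \<and> (\<forall>i<n. x i \<in> V i)" for x
  have fV: "f i u \<in> V i" if i: "i < n" and u: "\<And>p. p < m \<Longrightarrow> u p \<in> V i" for i u
  proof -
    have "T (\<beta>(i := f i u))"
      by (rule f_T[of "\<lambda>p. \<beta>(i := u p)"]) (use u in \<open>auto simp: V_def intro: f_const \<beta>_C\<close>)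
    then show ?thesis by (simp add: V_def)
  qed
  have wV: "wnu_pol n V RV m f"
    unfolding wnu_pol_def
  proof (intro conjI allI impI ballI)
    show "2 \<le> m" by (rule m2)
    fix i u assume "i < n" "\<forall>p<m. u p \<in> V i" then show "f i u \<in> V i" using fV by blast
  next
    fix i x u assume "i < n" "x \<in> V i" "\<forall>p<m. u p = x" then show "f i u = x" using f_const V_C by blast
  next
    fix i x y q u assume "i < n" "x \<in> V i" "y \<in> V i" "q < m" "u q = y \<and> (\<forall>p<m. p \<noteq> q \<longrightarrow> u p = x)"
    then show "f i u = op i x y" using f_one V_C by blast
  next
    fix r assume r: "\<forall>p<m. RV (r p)"
    have "R (\<lambda>i. f i (\<lambda>p. r p i))" by (rule f_R[of r]) (use r in \<open>auto simp: RV_def\<close>)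
    moreover have "f i (\<lambda>p. r p i) \<in> V i" if "i < n" for i
      by (rule fV[OF that]) (use r that in \<open>auto simp: RV_def\<close>)
    ultimately show "RV (\<lambda>i. f i (\<lambda>p. r p i))" by (simp add: RV_def)
  qed
  interpret B: twin_block n V RV m f
  proof
    show "3 \<le> n" by (rule n3)
    have "V 0 \<subseteq> C 0" using V_C n3 by auto
    then show "finite (V 0)" using finC[of 0] n3 finite_subset by auto
    show "V i \<noteq> {}" for i using \<beta>_V by blast
    show "RV y" if "RV x" "\<And>i. i < n \<Longrightarrow> x i = y i" for x y
      using that local[of x y] unfolding RV_def by auto
    show "x i \<in> V i" if "RV x" "i < n" for x i using that by (simp add: RV_def)
    show "wnu_pol n V RV m f" by (rule wV)
    show "\<exists>b. RV (x(i := b))" if x: "\<And>l. l < n \<Longrightarrow> x l \<in> V l" and i: "i < n" for x i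
    proof -
      obtain b where b: "R (x(i := b))" using T_ex[OF V_T[OF x] i] by blast
      have "b \<in> V i" by (rule V_step[OF x i R_T[OF b]])
      then show ?thesis using b x by (auto simp: RV_def)
    qed
    show "RV (x(i := op i u (x i))) \<longleftrightarrow> RV x" if "i < n" "u \<in> V i" "\<And>l. l < n \<Longrightarrow> x l \<in> V l" for i u x
      using U_op[OF V_U[OF that(1,2)], of "x i"] V_C that by simp
  qed
  obtain G :: "nat monoid" and \<phi> where G: "comm_group G" "finite (carrier G)"
    "\<And>i. i < n \<Longrightarrow> \<phi> i ` V i = carrier G"
    "\<And>x. (\<And>i. i < n \<Longrightarrow> x i \<in> V i) \<Longrightarrow> RV x \<longleftrightarrow> finprod G (\<lambda>i. \<phi> i (x i)) {..<n} = \<one>\<^bsub>G\<^esub>"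
    using B.block_group by blast
  have "linsys n V R G \<phi>"
    unfolding linsys_def
  proof (intro conjI allI impI)
    fix x assume "\<forall>i<n. x i \<in> V i"
    then show "R x \<longleftrightarrow> finprod G (\<lambda>i. \<phi> i (x i)) {..<n} = \<one>\<^bsub>G\<^esub>" using G(4)[of x] by (simp add: RV_def)
  qed (use G in auto)
  then show thesis by (rule that)
qed

section \<open>Pulling the linear structure back along key maps\<close>

text \<open>The core carries an operation of its own, which need not be the one used on the original
  relation. This interface forgets it and keeps what key maps into the core can exploit.\<close>

locale linear_target =
  fixes n :: nat and R' :: "(nat \<Rightarrow> 'a) \<Rightarrow> bool" and V :: "nat \<Rightarrow> 'a set"
    and G :: "nat monoid" and \<phi> :: "nat \<Rightarrow> 'a \<Rightarrow> nat" and \<beta> :: "nat \<Rightarrow> 'a"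
  assumes target_n3: "3 \<le> n" and target: "linsys n V R' G \<phi>" and target_notR: "\<not> R' \<beta>" and target_V: "i < n \<Longrightarrow> \<beta> i \<in> V i"
    and target_T: "(\<And>i. i < n \<Longrightarrow> x i \<in> V i) \<Longrightarrow> tilde n R' x"
    and target_step: "(\<And>l. l < n \<Longrightarrow> x l \<in> V l) \<Longrightarrow> i < n \<Longrightarrow> tilde n R' (x(i := a)) \<Longrightarrow> a \<in> V i"
    and target_corner: "i < n \<Longrightarrow> j < n \<Longrightarrow> k < n \<Longrightarrow> i \<noteq> j \<Longrightarrow> i \<noteq> k \<Longrightarrow> j \<noteq> k \<Longrightarrow>
      tilde n R' w \<Longrightarrow> tilde n R' (w(i := \<beta> i)) \<Longrightarrow> tilde n R' (w(j := \<beta> j)) \<Longrightarrow>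
      (\<And>l. l < n \<Longrightarrow> l \<noteq> i \<Longrightarrow> l \<noteq> j \<Longrightarrow> l \<noteq> k \<Longrightarrow> w l = \<beta> l) \<Longrightarrow> l < n \<Longrightarrow> w l \<in> V l"
    and target_key: "(\<And>i. i < n \<Longrightarrow> z i \<in> V i) \<Longrightarrow> \<not> R' z \<Longrightarrow>
      \<exists>\<Psi>. (\<forall>x. R' x \<longrightarrow> R' (\<lambda>i. \<Psi> i (x i))) \<and> (\<forall>i<n. \<Psi> i (z i) = \<beta> i)"
begin

sublocale G: comm_group G using target by (simp add: linsys_def)

lemma \<phi>_carrier: "i < n \<Longrightarrow> v \<in> V i \<Longrightarrow> \<phi> i v \<in> carrier G"
  using target unfolding linsys_def by blast

lemma map_tilde:
  assumes \<Psi>: "\<And>x. Q x \<Longrightarrow> R' (\<lambda>i. \<Psi> i (x i))" and x: "tilde n Q x"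
  shows "tilde n R' (\<lambda>i. \<Psi> i (x i))"
  unfolding tilde_def
proof (intro allI impI)
  fix i assume "i < n"
  then obtain b where b: "Q (x(i := b))" using x unfolding tilde_def by blast
  have "(\<lambda>l. \<Psi> l ((x(i := b)) l)) = (\<lambda>l. \<Psi> l (x l))(i := \<Psi> i b)" by (auto simp: fun_eq_iff)
  then show "\<exists>b. R' ((\<lambda>i. \<Psi> i (x i))(i := b))" using \<Psi>[OF b] by auto
qed

text \<open>One tuple known to be mapped into \<open>V\<close> pulls along every entry that can be
  reached from it inside the tilde closure.\<close>

lemma map_step:
  assumes \<Psi>: "\<And>x. Q x \<Longrightarrow> R' (\<lambda>i. \<Psi> i (x i))" and y: "\<And>l. l < n \<Longrightarrow> \<Psi> l (y l) \<in> V l"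
    and i: "i < n" and T: "tilde n Q (y(i := b))"
  shows "\<Psi> i b \<in> V i"
proof (rule target_step[OF y i])
  have "(\<lambda>l. \<Psi> l ((y(i := b)) l)) = (\<lambda>l. \<Psi> l (y l))(i := \<Psi> i b)" by (auto simp: fun_eq_iff)
  then show "tilde n R' ((\<lambda>l. \<Psi> l (y l))(i := \<Psi> i b))" using map_tilde[where \<Psi> = \<Psi>, OF \<Psi> T] by simp
qed

text \<open>The equation on \<open>V\<close> supplies the independence of \<open>R'\<close> from
  values at \<open>n\<close> and beyond.\<close>

lemma R'_cong: assumes "R' x" "\<And>i. i < n \<Longrightarrow> x i = \<beta> i" shows False
proof -
  have "(\<forall>i<n. x i \<in> V i)" using assms target_V by auto
  then have "R' x \<longleftrightarrow> finprod G (\<lambda>i. \<phi> i (x i)) {..<n} = \<one>\<^bsub>G\<^esub>" using target unfolding linsys_def by blast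
  moreover have "R' \<beta> \<longleftrightarrow> finprod G (\<lambda>i. \<phi> i (\<beta> i)) {..<n} = \<one>\<^bsub>G\<^esub>" using target target_V unfolding linsys_def by blast
  moreover have "finprod G (\<lambda>i. \<phi> i (x i)) {..<n} = finprod G (\<lambda>i. \<phi> i (\<beta> i)) {..<n}"
    by (rule G.finprod_cong') (use assms target_V \<phi>_carrier in auto)
  ultimately show False using assms target_notR by simp
qed

definition c where "c = finprod G (\<lambda>i. \<phi> i (\<beta> i)) {..<n}"

lemma c_carrier: "c \<in> carrier G"
  unfolding c_def by (rule G.finprod_closed) (use target_V \<phi>_carrier in auto)

lemma c_not_one: "c \<noteq> \<one>\<^bsub>G\<^esub>"
  using target target_notR target_V unfolding linsys_def c_def by blast

text \<open>Some tuple of the block has defect \<open>h\<close>. The key map sending it to \<beta>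
  maps the whole block into \<open>V\<close>, so \<open>linsys_order\<close> transfers the relation
  satisfied by \<open>h\<close> to the defect \<open>c\<close> of \<beta>.\<close>

lemma source_order:
  assumes L: "linsys n B Q H \<theta>" and BT: "\<And>x. (\<And>i. i < n \<Longrightarrow> x i \<in> B i) \<Longrightarrow> tilde n Q x"
    and key: "\<And>z. (\<And>i. i < n \<Longrightarrow> z i \<in> B i) \<Longrightarrow> \<not> Q z \<Longrightarrow>
      \<exists>\<Psi>. (\<forall>x. Q x \<longrightarrow> R' (\<lambda>i. \<Psi> i (x i))) \<and> (\<forall>i<n. \<Psi> i (z i) = \<beta> i)"
    and x: "\<And>i. i < n \<Longrightarrow> x i \<in> B i"
    and h: "h \<in> carrier H" "h \<noteq> \<one>\<^bsub>H\<^esub>" "h [^]\<^bsub>H\<^esub> (q::nat) = \<one>\<^bsub>H\<^esub>"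
  shows "c [^]\<^bsub>G\<^esub> q = \<one>\<^bsub>G\<^esub>"
proof -
  have n0: "0 < n" using target_n3 by simp
  obtain b where b: "b \<in> B 0" "finprod H (\<lambda>l. \<theta> l ((x(0 := b)) l)) {..<n} = h"
    using linsys_line(1)[OF L x n0 h(1)] by blast
  let ?a = "x(0 := b)"
  have a: "?a i \<in> B i" if "i < n" for i using that x b by simp
  have "\<not> Q ?a" using L a b(2) h(2) unfolding linsys_def by blast
  from key[OF a this] obtain \<Psi> where \<Psi>: "\<And>x. Q x \<Longrightarrow> R' (\<lambda>i. \<Psi> i (x i))" "\<And>i. i < n \<Longrightarrow> \<Psi> i (?a i) = \<beta> i" by blast
  have V: "\<Psi> i u \<in> V i" if i: "i < n" and u: "u \<in> B i" for i u
    by (rule map_step[of Q \<Psi> ?a i u, OF \<Psi>(1) _ i BT]) (use \<Psi>(2) target_V a u in auto)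
  have "finprod G (\<lambda>i. \<phi> i (\<Psi> i (?a i))) {..<n} [^]\<^bsub>G\<^esub> q = \<one>\<^bsub>G\<^esub>"
    by (rule linsys_order[OF target_n3 L target V \<Psi>(1) a]) (use b h in simp_all)
  moreover have "finprod G (\<lambda>i. \<phi> i (\<Psi> i (?a i))) {..<n} = c"
    unfolding c_def by (rule G.finprod_cong') (use \<Psi>(2) target_V \<phi>_carrier in \<open>auto simp del: fun_upd_apply\<close>)
  ultimately show ?thesis by simp
qed

text \<open>\<open>source_order\<close> is applied to the core itself, with a power \<open>h\<close>
  of \<open>c\<close> of prime order \<open>p\<close>: a tuple with defect \<open>h\<close> can be
  moved to \<beta>, so \<open>c\<close> is annihilated by \<open>p\<close> as well.\<close>

lemma c_prime_order: obtains p :: nat where "Factorial_Ring.prime p" "c [^]\<^bsub>G\<^esub> p = \<one>\<^bsub>G\<^esub>"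
proof -
  have fin: "finite (carrier G)" using target by (simp add: linsys_def)
  have ord: "G.ord c \<noteq> 1" using c_not_one c_carrier G.ord_eq_1 by simp
  then obtain p where p: "Factorial_Ring.prime p" "p dvd G.ord c" using prime_factor_nat by blast
  define h where "h = c [^]\<^bsub>G\<^esub> (G.ord c div p)"
  have pos: "G.ord c > 0" using G.ord_ge_1[OF fin c_carrier] by simp
  have lt: "G.ord c div p < G.ord c" using p(1) pos prime_gt_1_nat by (intro div_less_dividend) auto
  have nd: "\<not> G.ord c dvd G.ord c div p"
    using lt p pos by (metis dvd_div_eq_0_iff dvd_imp_le gr0I leD not_less0 less_numeral_extra(3))
  have "h \<noteq> \<one>\<^bsub>G\<^esub>" unfolding h_def using nd G.pow_eq_id[OF c_carrier] by simp
  moreover have "h [^]\<^bsub>G\<^esub> p = \<one>\<^bsub>G\<^esub>"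
    unfolding h_def using p(2) c_carrier by (simp add: G.nat_pow_pow G.pow_eq_id)
  moreover have "h \<in> carrier G" unfolding h_def using c_carrier by simp
  ultimately have "c [^]\<^bsub>G\<^esub> p = \<one>\<^bsub>G\<^esub>"
    by (intro source_order[OF target target_T target_key target_V]) auto
  with p(1) show thesis by (rule that)
qed

lemma source_prime_power:
  assumes p: "Factorial_Ring.prime p" "c [^]\<^bsub>G\<^esub> p = \<one>\<^bsub>G\<^esub>"
    and L: "linsys n B Q H \<theta>" and BT: "\<And>x. (\<And>i. i < n \<Longrightarrow> x i \<in> B i) \<Longrightarrow> tilde n Q x"
    and key: "\<And>z. (\<And>i. i < n \<Longrightarrow> z i \<in> B i) \<Longrightarrow> \<not> Q z \<Longrightarrow>
      \<exists>\<Psi>. (\<forall>x. Q x \<longrightarrow> R' (\<lambda>i. \<Psi> i (x i))) \<and> (\<forall>i<n. \<Psi> i (z i) = \<beta> i)"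
    and x: "\<And>i. i < n \<Longrightarrow> x i \<in> B i"
  shows "\<exists>k. order H = p ^ k"
proof -
  interpret H: comm_group H using L by (simp add: linsys_def)
  have fin: "finite (carrier H)" using L by (simp add: linsys_def)
  have uniq: "r = p" if r: "Factorial_Ring.prime r" "r dvd order H" for r
  proof -
    \<comment> \<open>Exponent 1 makes Sylow's theorem yield a subgroup of order \<open>r\<close>,
      whatever the full power of \<open>r\<close> in \<open>order H\<close>.\<close>
    obtain t where t: "order H = r ^ 1 * t" using r(2) by auto
    obtain K where K: "subgroup K H" "card K = r ^ 1"
      using sylow_thm[OF r(1) H.is_group t fin] by blast
    have "K \<noteq> {\<one>\<^bsub>H\<^esub>}" using K(2) prime_gt_1_nat[OF r(1)] by auto
    then obtain h where h: "h \<in> K" "h \<noteq> \<one>\<^bsub>H\<^esub>" using subgroup.one_closed[OF K(1)] by blast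
    have hc: "h \<in> carrier H" using subgroup.mem_carrier[OF K(1) h(1)] .
    have hr: "h [^]\<^bsub>H\<^esub> r = \<one>\<^bsub>H\<^esub>"
    proof -
      interpret K: group "H\<lparr>carrier := K\<rparr>" using H.subgroup_imp_group[OF K(1)] .
      have fK: "finite K" using K(2) r(1) by (metis card.infinite power_one_right not_prime_0)
      have "h [^]\<^bsub>H\<lparr>carrier := K\<rparr>\<^esub> order (H\<lparr>carrier := K\<rparr>) = \<one>\<^bsub>H\<lparr>carrier := K\<rparr>\<^esub>"
        using K.pow_order_eq_1 h(1) by simp
      then show ?thesis using K(2) by (simp add: order_def H.nat_pow_consistent[symmetric])
    qed
    have c1: "c [^]\<^bsub>G\<^esub> r = \<one>\<^bsub>G\<^esub>" by (rule source_order[OF L BT key x hc h(2) hr])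
    have "G.ord c dvd r" "G.ord c dvd p" using c1 p(2) G.pow_eq_id[OF c_carrier] by auto
    moreover have "G.ord c \<noteq> 1" using c_not_one c_carrier G.ord_eq_1 by simp
    ultimately show "r = p" using r(1) p(1) by (metis prime_nat_iff)
  qed
  have "order H > 0" using fin H.order_gt_0_iff_finite by simp
  then obtain k t where kt: "order H = p ^ k * t" "\<not> p dvd t"
    using multiplicity_decompose'[of "order H" p] p(1) by (metis less_irrefl not_prime_unit)
  have "t = 1"
  proof (rule ccontr)
    assume "t \<noteq> 1"
    then obtain r where "Factorial_Ring.prime r" "r dvd t" using prime_factor_nat by blast
    then show False using uniq[of r] kt by auto
  qed
  then show ?thesis using kt by auto
qed

end

section \<open>Twins in the original relation, seen through key maps\<close>

locale key_setting = difunctional_wnu n C R m f + linear_target n R' V G \<phi> \<beta>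
  for n C and R :: "(nat \<Rightarrow> 'a) \<Rightarrow> bool" and m f R' V G \<phi> \<beta> +
  assumes key: "(\<And>i. i < n \<Longrightarrow> z i \<in> C i) \<Longrightarrow> \<not> R z \<Longrightarrow>
      \<exists>\<Psi>. (\<forall>x. R x \<longrightarrow> R' (\<lambda>i. \<Psi> i (x i))) \<and> (\<forall>i<n. \<Psi> i (z i) = \<beta> i)"
begin

text \<open>Write \<open>\<psi> = \<phi>\<^sub>i \<circ> \<Psi>\<^sub>i\<close> and \<open>A\<^sub>S\<close> for the value of \<open>f\<close> with \<open>a\<close> on the positions in \<open>S\<close> and \<open>x\<^sub>i\<close>
  elsewhere. The four tuples below differ only in the coordinates \<open>i, j, k\<close> and show that
  \<open>\<psi>(A\<^sub>S) - \<psi>(x\<^sub>i)\<close> is additive in \<open>S\<close>.\<close>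

lemma mixture_additive:
  fixes S Q :: "nat set"
  assumes \<Psi>: "\<And>x. R x \<Longrightarrow> R' (\<lambda>i. \<Psi> i (x i))" and i: "i < n" and Tx: "T x" and Ta: "T (x(i := a))"
    and V: "\<And>l. l < n \<Longrightarrow> \<Psi> l (x l) \<in> V l" and SQ: "S \<inter> Q = {}"
  shows "\<phi> i (\<Psi> i (f i (\<lambda>p. if p \<in> S \<union> Q then a else x i))) \<otimes>\<^bsub>G\<^esub> \<phi> i (\<Psi> i (x i)) =
    \<phi> i (\<Psi> i (f i (\<lambda>p. if p \<in> S then a else x i))) \<otimes>\<^bsub>G\<^esub> \<phi> i (\<Psi> i (f i (\<lambda>p. if p \<in> Q then a else x i)))"
proof -
  obtain j where j: "j < n" "j \<noteq> i" using third_index i by blast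
  obtain k where k: "k < n" "k \<noteq> i" "k \<noteq> j" using third_index i j by blast
  have xC: "x l \<in> C l" if "l < n" for l using T_C Tx that by blast
  have aC: "a \<in> C i" using T_C[OF Ta i] by simp
  obtain c0 where c0: "R (x(k := c0))" using T_ex Tx k by blast
  obtain c1 where c1: "R (x(i := a, k := c1))" using T_ex Ta k by blast
  obtain d0 where d0: "R (x(j := d0))" using T_ex Tx j by blast
  obtain d1 where d1: "R (x(i := a, j := d1))" using T_ex Ta j by blast
  define A where "A S = f i (\<lambda>p. if p \<in> S then a else x i)" for S :: "nat set"
  define J where "J d = f j (\<lambda>p. if p \<in> Q then d else x j)" for d
  define K where "K = f k (\<lambda>p. if p \<in> S then c1 else if p \<in> Q then x k else c0)"
  define K' where "K' = f k (\<lambda>p. if p \<in> Q then x k else c0)"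
  note upd = fun_upd_apply if_distrib[of "\<lambda>t. t _"]
  have A0: "A {} = x i" unfolding A_def by (rule f_const) (use i xC in auto)
  have eqA: "(\<lambda>p. if p \<in> S then a else if p \<in> Q then a else x i) = (\<lambda>p. if p \<in> S \<union> Q then a else x i)" by auto
  have eqJ: "(\<lambda>p. if p \<in> S then x j else if p \<in> Q then d else x j) = (\<lambda>p. if p \<in> Q then d else x j)" for d
    using SQ by (intro ext) auto
  have eqQ: "(\<lambda>p. if p \<in> S then x i else if p \<in> Q then a else x i) = (\<lambda>p. if p \<in> Q then a else x i)"
    using SQ by (intro ext) auto
  have eqK: "(\<lambda>p. if p \<in> S then c0 else if p \<in> Q then x k else c0) = (\<lambda>p. if p \<in> Q then x k else c0)"
    using SQ by (intro ext) auto
  \<comment> \<open>Each of the four tuples mixes repaired tuples. Using \<open>a\<close> on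
    \<open>S\<close> is paid for at \<open>k\<close> by \<open>c1\<close> instead of
    \<open>c0\<close>, using \<open>a\<close> on \<open>Q\<close> at \<open>j\<close> by
    \<open>d1\<close> instead of \<open>d0\<close>. The two choices are independent, which produces
    the pattern of \<open>linsys_four\<close>.\<close>
  have R1: "R (x(i := A (S \<union> Q), j := J d1, k := K))"
  proof (rule f_R[of "\<lambda>p. if p \<in> S then x(i := a, k := c1) else if p \<in> Q then x(i := a, j := d1) else x(k := c0)"])
    fix l assume l: "l < n"
    consider "l = i" | "l = j" | "l = k" | "l \<noteq> i" "l \<noteq> j" "l \<noteq> k" by blast
    then show "f l (\<lambda>p. (if p \<in> S then x(i := a, k := c1) else if p \<in> Q then x(i := a, j := d1) else x(k := c0)) l)
       = (x(i := A (S \<union> Q), j := J d1, k := K)) l"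
      by cases (use i j k l in \<open>simp_all add: upd eqA eqJ A_def J_def K_def f_const xC cong: if_cong\<close>)
  qed (use c0 c1 d1 in auto)
  have R2: "R (x(i := A S, j := J d0, k := K))"
  proof (rule f_R[of "\<lambda>p. if p \<in> S then x(i := a, k := c1) else if p \<in> Q then x(j := d0) else x(k := c0)"])
    fix l assume l: "l < n"
    consider "l = i" | "l = j" | "l = k" | "l \<noteq> i" "l \<noteq> j" "l \<noteq> k" by blast
    then show "f l (\<lambda>p. (if p \<in> S then x(i := a, k := c1) else if p \<in> Q then x(j := d0) else x(k := c0)) l)
       = (x(i := A S, j := J d0, k := K)) l"
      by cases (use i j k l in \<open>simp_all add: upd eqJ A_def J_def K_def f_const xC cong: if_cong\<close>)
  qed (use c0 c1 d0 in auto)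
  have R3: "R (x(i := A Q, j := J d1, k := K'))"
  proof (rule f_R[of "\<lambda>p. if p \<in> S then x(k := c0) else if p \<in> Q then x(i := a, j := d1) else x(k := c0)"])
    fix l assume l: "l < n"
    consider "l = i" | "l = j" | "l = k" | "l \<noteq> i" "l \<noteq> j" "l \<noteq> k" by blast
    then show "f l (\<lambda>p. (if p \<in> S then x(k := c0) else if p \<in> Q then x(i := a, j := d1) else x(k := c0)) l)
       = (x(i := A Q, j := J d1, k := K')) l"
      by cases (use i j k l in \<open>simp_all add: upd eqQ eqJ eqK A_def J_def K'_def f_const xC cong: if_cong\<close>)
  qed (use c0 d1 in auto)
  have R4: "R (x(i := A {}, j := J d0, k := K'))"
  proof (rule f_R[of "\<lambda>p. if p \<in> S then x(k := c0) else if p \<in> Q then x(j := d0) else x(k := c0)"])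
    fix l assume l: "l < n"
    consider "l = i" | "l = j" | "l = k" | "l \<noteq> i" "l \<noteq> j" "l \<noteq> k" by blast
    then show "f l (\<lambda>p. (if p \<in> S then x(k := c0) else if p \<in> Q then x(j := d0) else x(k := c0)) l)
       = (x(i := A {}, j := J d0, k := K')) l"
      by cases (use i j k l in \<open>simp_all add: upd eqJ eqK A0 J_def K'_def f_const xC cong: if_cong\<close>)
  qed (use c0 d0 in auto)
  \<comment> \<open>The equation may be used only for entries in \<open>V\<close>; each new entry is
    one step in the tilde closure away from a tuple already mapped into \<open>V\<close>.\<close>
  have TA: "T (x(i := A W))" for W
  proof (rule f_T[of "\<lambda>p. if p \<in> W then x(i := a) else x"])
    fix l assume l: "l < n"
    then show "f l (\<lambda>p. (if p \<in> W then x(i := a) else x) l) = (x(i := A W)) l"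
      by (cases "l = i") (simp_all add: upd A_def f_const xC cong: if_cong)
  qed (use Tx Ta in auto)
  have VA: "\<Psi> i (A W) \<in> V i" for W by (rule map_step[of R \<Psi> x i, OF \<Psi> V i TA])
  have Va: "\<Psi> i a \<in> V i" by (rule map_step[of R \<Psi> x i, OF \<Psi> V i Ta])
  have VJ0: "\<Psi> j (J d0) \<in> V j"
  proof (rule map_step[of R \<Psi> x j, OF \<Psi> V j(1)])
    show "T (x(j := J d0))"
    proof (rule f_T[of "\<lambda>p. if p \<in> Q then x(j := d0) else x"])
      fix l assume l: "l < n"
      then show "f l (\<lambda>p. (if p \<in> Q then x(j := d0) else x) l) = (x(j := J d0)) l"
        by (cases "l = j") (simp_all add: upd J_def f_const xC cong: if_cong)
    qed (use Tx R_T[OF d0] in auto)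
  qed
  have VJ1: "\<Psi> j (J d1) \<in> V j"
  proof (rule map_step[of R \<Psi> "x(i := a)" j, OF \<Psi> _ j(1)])
    show "\<Psi> l ((x(i := a)) l) \<in> V l" if "l < n" for l using V Va that by simp
    show "T (x(i := a, j := J d1))"
    proof (rule f_T[of "\<lambda>p. if p \<in> Q then x(i := a, j := d1) else x(i := a)"])
      fix l assume l: "l < n"
      then show "f l (\<lambda>p. (if p \<in> Q then x(i := a, j := d1) else x(i := a)) l) = (x(i := a, j := J d1)) l"
        using j by (cases "l = j"; cases "l = i") (simp_all add: upd J_def f_const xC aC cong: if_cong)
    qed (use Ta R_T[OF d1] in auto)
  qed
  have VK: "\<Psi> k K \<in> V k"
  proof (rule map_step[of R \<Psi> "x(i := A S)" k, OF \<Psi> _ k(1)])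
    show "\<Psi> l ((x(i := A S)) l) \<in> V l" if "l < n" for l using V VA that by simp
    show "T (x(i := A S, k := K))"
    proof (rule f_T[of "\<lambda>p. if p \<in> S then x(i := a, k := c1) else if p \<in> Q then x else x(k := c0)"])
      fix l assume l: "l < n"
      then show "f l (\<lambda>p. (if p \<in> S then x(i := a, k := c1) else if p \<in> Q then x else x(k := c0)) l) = (x(i := A S, k := K)) l"
        using k by (cases "l = k"; cases "l = i") (simp_all add: upd K_def A_def f_const xC aC cong: if_cong)
    qed (use Tx R_T[OF c1] R_T[OF c0] in auto)
  qed
  have VK': "\<Psi> k K' \<in> V k"
  proof (rule map_step[of R \<Psi> x k, OF \<Psi> V k(1)])
    show "T (x(k := K'))"
    proof (rule f_T[of "\<lambda>p. if p \<in> Q then x else x(k := c0)"])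
      fix l assume l: "l < n"
      then show "f l (\<lambda>p. (if p \<in> Q then x else x(k := c0)) l) = (x(k := K')) l"
        by (cases "l = k") (simp_all add: upd K'_def f_const xC cong: if_cong)
    qed (use Tx R_T[OF c0] in auto)
  qed
  have tr: "(\<lambda>l. \<Psi> l ((x(i := u, j := v, k := w)) l)) = (\<lambda>l. \<Psi> l (x l))(i := \<Psi> i u, j := \<Psi> j v, k := \<Psi> k w)" for u v w
    by (auto simp: fun_eq_iff)
  have "\<phi> i (\<Psi> i (A (S \<union> Q))) \<otimes>\<^bsub>G\<^esub> \<phi> i (\<Psi> i (A {})) = \<phi> i (\<Psi> i (A S)) \<otimes>\<^bsub>G\<^esub> \<phi> i (\<Psi> i (A Q))"
    by (rule linsys_four[OF target V i j(1) k(1) j(2)[symmetric] k(2)[symmetric] k(3)[symmetric]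
       VA VA VA VA VJ1 VJ0 VK VK' \<Psi>[OF R1, unfolded tr] \<Psi>[OF R2, unfolded tr] \<Psi>[OF R3, unfolded tr],
       THEN iffD1, OF _ \<Psi>[OF R4, unfolded tr]])
  then show ?thesis unfolding A0 by (simp add: A_def)
qed

text \<open>Inserting \<open>a\<close> position by position, each of the \<open>m\<close> steps adds
  the difference between the values at \<open>op i (x i) a\<close> and at \<open>x i\<close>, and
  the last one reaches the value at \<open>a\<close>. Starting from \<open>op i (x i) a\<close> in
  place of \<open>a\<close> gives the same multiple, because the operation is special.\<close>

lemma circ_twin:
  assumes \<Psi>: "\<And>x. R x \<Longrightarrow> R' (\<lambda>i. \<Psi> i (x i))" and i: "i < n" and Tx: "T x" and Ta: "T (x(i := a))"
    and V: "\<And>l. l < n \<Longrightarrow> \<Psi> l (x l) \<in> V l"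
  shows "\<phi> i (\<Psi> i (op i (x i) a)) = \<phi> i (\<Psi> i a)"
proof -
  have xC: "x i \<in> C i" using T_C Tx i by blast
  let ?a0 = "\<phi> i (\<Psi> i (x i))"
  have step: "\<Psi> i u \<in> V i" if "T (x(i := u))" for u by (rule map_step[of R \<Psi> x i, OF \<Psi> V i that])
  have T_op: "T (x(i := op i (x i) u))" if "T (x(i := u))" for u
    by (rule op_T[OF Tx that]) (use T_C[OF Tx] in \<open>auto simp: op_idem\<close>)
  have pow: "\<phi> i (\<Psi> i u) \<otimes>\<^bsub>G\<^esub> ?a0 [^]\<^bsub>G\<^esub> m = ?a0 \<otimes>\<^bsub>G\<^esub> \<phi> i (\<Psi> i (op i (x i) u)) [^]\<^bsub>G\<^esub> m" if Tu: "T (x(i := u))" for u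
  proof -
    have uC: "u \<in> C i" using T_C[OF Tu i] by simp
    let ?b = "\<phi> i (\<Psi> i (op i (x i) u))"
    define A where "A k = \<phi> i (\<Psi> i (f i (\<lambda>p. if p \<in> {..<k} then u else x i)))" for k :: nat
    have b: "?b \<in> carrier G" and a0: "?a0 \<in> carrier G"
      using \<phi>_carrier i step[OF T_op[OF Tu]] V by auto
    have Ac: "A k \<in> carrier G" for k
    proof -
      have "T (x(i := f i (\<lambda>p. if p \<in> {..<k} then u else x i)))"
      proof (rule f_T[of "\<lambda>p. if p \<in> {..<k} then x(i := u) else x"])
        fix l assume "l < n"
        then show "f l (\<lambda>p. (if p \<in> {..<k} then x(i := u) else x) l) = (x(i := f i (\<lambda>p. if p \<in> {..<k} then u else x i))) l"
          by (cases "l = i") (simp_all add: fun_upd_apply if_distrib[of "\<lambda>t. t _"] f_const T_C[OF Tx] cong: if_cong)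
      qed (use Tx Tu in auto)
      then show ?thesis unfolding A_def using step \<phi>_carrier i by blast
    qed
    have "A k \<otimes>\<^bsub>G\<^esub> ?a0 [^]\<^bsub>G\<^esub> k = ?a0 \<otimes>\<^bsub>G\<^esub> ?b [^]\<^bsub>G\<^esub> k" if "k \<le> m" for k
      using that
    proof (induction k)
      case 0
      have "f i (\<lambda>p. if p \<in> {..<0::nat} then u else x i) = x i" by (rule f_const) (use i xC in auto)
      then show ?case using a0 by (simp add: A_def)
    next
      case (Suc k)
      have one: "f i (\<lambda>p. if p \<in> {k} then u else x i) = op i (x i) u"
        by (rule f_one[OF i xC uC, of k]) (use Suc in auto)
      have "{..<k} \<union> {k} = {..<Suc k}" by auto
      then have st: "A (Suc k) \<otimes>\<^bsub>G\<^esub> ?a0 = A k \<otimes>\<^bsub>G\<^esub> ?b"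
        using mixture_additive[where \<Psi> = \<Psi> and S = "{..<k}" and Q = "{k}", OF \<Psi> i Tx Tu V] unfolding one A_def by simp
      have "A (Suc k) \<otimes>\<^bsub>G\<^esub> ?a0 [^]\<^bsub>G\<^esub> Suc k = (A (Suc k) \<otimes>\<^bsub>G\<^esub> ?a0) \<otimes>\<^bsub>G\<^esub> ?a0 [^]\<^bsub>G\<^esub> k"
        using Ac a0 by (simp add: G.m_ac)
      also have "\<dots> = (A k \<otimes>\<^bsub>G\<^esub> ?a0 [^]\<^bsub>G\<^esub> k) \<otimes>\<^bsub>G\<^esub> ?b" unfolding st using Ac a0 b by (simp add: G.m_ac)
      also have "\<dots> = ?a0 \<otimes>\<^bsub>G\<^esub> ?b [^]\<^bsub>G\<^esub> Suc k" using Suc a0 b by (simp add: G.m_ac)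
      finally show ?case .
    qed
    from this[of m] have "A m \<otimes>\<^bsub>G\<^esub> ?a0 [^]\<^bsub>G\<^esub> m = ?a0 \<otimes>\<^bsub>G\<^esub> ?b [^]\<^bsub>G\<^esub> m" by simp
    moreover have "A m = \<phi> i (\<Psi> i u)"
    proof -
      have "f i (\<lambda>p. if p \<in> {..<m} then u else x i) = u" by (rule f_const) (use i uC in auto)
      then show ?thesis by (simp add: A_def)
    qed
    ultimately show ?thesis by simp
  qed
  have aC: "a \<in> C i" using T_C[OF Ta i] by simp
  have "\<phi> i (\<Psi> i a) \<otimes>\<^bsub>G\<^esub> ?a0 [^]\<^bsub>G\<^esub> m = \<phi> i (\<Psi> i (op i (x i) a)) \<otimes>\<^bsub>G\<^esub> ?a0 [^]\<^bsub>G\<^esub> m"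
    using pow[OF Ta] pow[OF T_op[OF Ta]] op_op[OF i xC aC] by simp
  moreover have "\<phi> i (\<Psi> i a) \<in> carrier G" "\<phi> i (\<Psi> i (op i (x i) a)) \<in> carrier G" "?a0 \<in> carrier G"
    using \<phi>_carrier i step[OF Ta] step[OF T_op[OF Ta]] V by auto
  ultimately show ?thesis by simp
qed

lemma R'_psi_cong:
  assumes "\<And>i. i < n \<Longrightarrow> x i \<in> V i" "\<And>i. i < n \<Longrightarrow> y i \<in> V i" "\<And>i. i < n \<Longrightarrow> \<phi> i (x i) = \<phi> i (y i)" "R' x"
  shows "R' y"
proof -
  have "finprod G (\<lambda>i. \<phi> i (x i)) {..<n} = finprod G (\<lambda>i. \<phi> i (y i)) {..<n}"
    by (rule G.finprod_cong') (use assms \<phi>_carrier in auto)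
  then show ?thesis using target assms unfolding linsys_def by metis
qed

text \<open>A repair at \<open>i\<close> or \<open>j\<close> comes from one of the given tuples. For
  another \<open>k\<close>, \<open>op3\<close> gives a repair \<open>u\<close> of the corner with
  entries \<open>op i (x i) a\<close> and \<open>op j (x j) b\<close>. It repairs the true corner
  too: otherwise a key map sends the true corner to \<beta>, \<open>target_corner\<close> puts the
  image of \<open>x\<close> into \<open>V\<close>, and \<open>circ_twin\<close> forces \<beta> into
  \<open>R'\<close>.\<close>

lemma T_square:
  assumes ij: "i < n" "j < n" "i \<noteq> j" and Tx: "T x" and Ta: "T (x(i := a))" and Tb: "T (x(j := b))"
  shows "T (x(i := a, j := b))"
  unfolding tilde_def
proof (intro allI impI)
  fix k assume k: "k < n"
  have sw: "x(i := a, j := b) = x(j := b, i := a)" using ij by (simp add: fun_upd_twist)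
  consider "k = i" | "k = j" | "k \<noteq> i" "k \<noteq> j" by blast
  then show "\<exists>u. R (x(i := a, j := b, k := u))"
  proof cases
    case 1
    then show ?thesis using T_ex[OF Tb ij(1)] unfolding sw by simp
  next
    case 2
    then show ?thesis using T_ex[OF Ta ij(2)] by simp
  next
    case 3
    note C = T_C[OF Tx] T_C[OF Ta ij(1), simplified] T_C[OF Tb ij(2), simplified]
    have "\<exists>u. R (x(i := op i (x i) a, j := op j (x j) b, k := u))"
      by (rule op3_proj[OF k T_ex[OF Ta k] T_ex[OF Tb k] T_ex[OF Tx k]])
         (use ij C in \<open>auto simp: op3_simps op_idem\<close>)
    then obtain u where u: "R (x(i := op i (x i) a, j := op j (x j) b, k := u))" by blast
    have uC: "u \<in> C k" using R_C[OF u k] by simp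
    have "R (x(i := a, j := b, k := u))"
    proof (rule ccontr)
      assume nR: "\<not> R (x(i := a, j := b, k := u))"
      have zC: "(x(i := a, j := b, k := u)) l \<in> C l" if "l < n" for l using that C uC by simp
      obtain \<Psi> where \<Psi>: "\<And>x. R x \<Longrightarrow> R' (\<lambda>i. \<Psi> i (x i))" "\<And>l. l < n \<Longrightarrow> \<Psi> l ((x(i := a, j := b, k := u)) l) = \<beta> l"
        using key[OF zC nR] by blast
      have \<beta>: "\<Psi> i a = \<beta> i" "\<Psi> j b = \<beta> j" "\<Psi> k u = \<beta> k" using \<Psi>(2)[OF ij(1)] \<Psi>(2)[OF ij(2)] \<Psi>(2)[OF k] ij 3 by auto
      have off: "\<Psi> l (x l) = \<beta> l" if "l < n" "l \<noteq> i" "l \<noteq> j" "l \<noteq> k" for l using \<Psi>(2)[OF that(1)] that by simp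
      let ?w = "\<lambda>l. \<Psi> l (x l)"
      have t1: "tilde n R' ?w" by (rule map_tilde[where \<Psi> = \<Psi>, OF \<Psi>(1) Tx])
      have "(\<lambda>l. \<Psi> l ((x(i := a)) l)) = ?w(i := \<beta> i)" using \<beta> by (auto simp: fun_eq_iff)
      then have t2: "tilde n R' (?w(i := \<beta> i))" using map_tilde[where \<Psi> = \<Psi>, OF \<Psi>(1) Ta] by simp
      have "(\<lambda>l. \<Psi> l ((x(j := b)) l)) = ?w(j := \<beta> j)" using \<beta> by (auto simp: fun_eq_iff)
      then have t3: "tilde n R' (?w(j := \<beta> j))" using map_tilde[where \<Psi> = \<Psi>, OF \<Psi>(1) Tb] by simp
      have V: "\<Psi> l (x l) \<in> V l" if "l < n" for l
        by (rule target_corner[OF ij(1,2) k ij(3) 3[symmetric] t1 t2 t3 _ that]) (rule off)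
      have psi: "\<phi> i (\<Psi> i (op i (x i) a)) = \<phi> i (\<beta> i)" "\<phi> j (\<Psi> j (op j (x j) b)) = \<phi> j (\<beta> j)"
        using circ_twin[where \<Psi> = \<Psi>, OF \<Psi>(1) ij(1) Tx Ta V] circ_twin[where \<Psi> = \<Psi>, OF \<Psi>(1) ij(2) Tx Tb V] \<beta> by auto
      have To: "T (x(l := op l (x l) v))" if "l < n" "T (x(l := v))" for l v
        by (rule op_T[OF Tx that(2)]) (use T_C[OF Tx] in \<open>auto simp: op_idem\<close>)
      have Vo: "\<Psi> i (op i (x i) a) \<in> V i" "\<Psi> j (op j (x j) b) \<in> V j"
        by (rule map_step[of R \<Psi> x, OF \<Psi>(1) V _ To] ; use ij Ta Tb in simp)+
      have "R' \<beta>"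
        by (rule R'_psi_cong[OF _ _ _ \<Psi>(1)[OF u]])
           (use V Vo \<beta> psi off target_V k in \<open>auto\<close>)
      then show False using target_notR by blast
    qed
    then show ?thesis by blast
  qed
qed

lemma block_linsys:
  assumes B: "\<And>x. (\<And>l. l < n \<Longrightarrow> x l \<in> B l) \<Longrightarrow> T x"
    and ne: "\<And>l. l < n \<Longrightarrow> y l \<in> B l"
    and max: "\<And>x i a. (\<And>l. l < n \<Longrightarrow> x l \<in> B l) \<Longrightarrow> i < n \<Longrightarrow> T (x(i := a)) \<Longrightarrow> a \<in> B i"
  obtains H :: "nat monoid" and \<theta> where "linsys n B R H \<theta>"
proof -
  define RB where "RB x \<longleftrightarrow> R x \<and> (\<forall>i<n. x i \<in> B i)" for x
  have upd: "(x(i := a)) l \<in> B l" if "\<And>l. l < n \<Longrightarrow> x l \<in> B l" "a \<in> B i" "l < n" for x i a l using that by simp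
  have BC: "a \<in> C i" if "i < n" "a \<in> B i" for i a
    using T_C[OF B[OF upd[OF ne that(2)]] that(1)] by simp
  have fB: "f i u \<in> B i" if i: "i < n" and u: "\<And>p. p < m \<Longrightarrow> u p \<in> B i" for i u
  proof (rule max[OF ne i])
    show "T (y(i := f i u))"
    proof (rule f_T[of "\<lambda>p. y(i := u p)"])
      fix p assume "p < m" then show "T (y(i := u p))" using B upd ne u by blast
    next
      fix l assume "l < n" then show "f l (\<lambda>p. (y(i := u p)) l) = (y(i := f i u)) l"
        using ne BC by (cases "l = i") (auto intro: f_const)
    qed
  qed
  have wB: "wnu_pol n B RB m f"
    unfolding wnu_pol_def
  proof (intro conjI allI impI ballI)
    show "2 \<le> m" by (rule m2)
    fix i u assume "i < n" "\<forall>p<m. u p \<in> B i" then show "f i u \<in> B i" using fB by blast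
  next
    fix i x u assume "i < n" "x \<in> B i" "\<forall>p<m. u p = x" then show "f i u = x" using f_const BC by blast
  next
    fix i x y q u assume "i < n" "x \<in> B i" "y \<in> B i" "q < m" "u q = y \<and> (\<forall>p<m. p \<noteq> q \<longrightarrow> u p = x)"
    then show "f i u = op i x y" using f_one BC by blast
  next
    fix r assume r: "\<forall>p<m. RB (r p)"
    have "R (\<lambda>i. f i (\<lambda>p. r p i))" by (rule f_R[of r]) (use r in \<open>auto simp: RB_def\<close>)
    moreover have "f i (\<lambda>p. r p i) \<in> B i" if "i < n" for i
      by (rule fB[OF that]) (use r that in \<open>auto simp: RB_def\<close>)
    ultimately show "RB (\<lambda>i. f i (\<lambda>p. r p i))" by (simp add: RB_def)
  qed
  have opB: "op i u v \<in> B i" if "i < n" "u \<in> B i" "v \<in> B i" for i u v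
    by (rule wnu_pol_circ_closed[OF wB that])
  have tw: "R (x(i := op i u (x i))) \<longleftrightarrow> R x" if i: "i < n" and u: "u \<in> B i" and x: "\<And>l. l < n \<Longrightarrow> x l \<in> B l" for i u x
  proof -
    define v where "v = op i u (x i)"
    have vB: "v \<in> B i" unfolding v_def using opB i u x by blast
    \<comment> \<open>Entries whose values no key map can separate are interchangeable: otherwise a
      key map taking the bad tuple to \<beta> would place a tuple agreeing with \<beta> in
      \<open>R'\<close>.\<close>
    have same: "R (x(i := b))" if ab: "a \<in> B i" "b \<in> B i" and phi: "\<And>\<Psi>. (\<And>x. R x \<Longrightarrow> R' (\<lambda>i. \<Psi> i (x i))) \<Longrightarrow>
         (\<And>l w. l < n \<Longrightarrow> w \<in> B l \<Longrightarrow> \<Psi> l w \<in> V l) \<Longrightarrow> \<phi> i (\<Psi> i a) = \<phi> i (\<Psi> i b)" and Ra: "R (x(i := a))" for a b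
    proof (rule ccontr)
      assume nR: "\<not> R (x(i := b))"
      have xb: "(x(i := b)) l \<in> B l" if "l < n" for l using upd x ab that by blast
      obtain \<Psi> where \<Psi>: "\<And>x. R x \<Longrightarrow> R' (\<lambda>i. \<Psi> i (x i))" "\<And>l. l < n \<Longrightarrow> \<Psi> l ((x(i := b)) l) = \<beta> l"
        using key[OF BC[OF _ xb] nR] by blast
      have V: "\<Psi> l w \<in> V l" if l: "l < n" and w: "w \<in> B l" for l w
        by (rule map_step[of R \<Psi> "x(i := b)" l w, OF \<Psi>(1) _ l B[OF upd[OF xb w]]]) (use \<Psi>(2) target_V in simp_all)
      have "R' (\<lambda>l. \<Psi> l ((x(i := b)) l))"
        by (rule R'_psi_cong[OF _ _ _ \<Psi>(1)[OF Ra]]) (use V x ab phi[of \<Psi>, OF \<Psi>(1) V] in auto)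
      then show False using R'_cong \<Psi>(2) by blast
    qed
    have phi: "\<phi> i (\<Psi> i v) = \<phi> i (\<Psi> i (x i))" if \<Psi>: "\<And>x. R x \<Longrightarrow> R' (\<lambda>i. \<Psi> i (x i))" and V: "\<And>l w. l < n \<Longrightarrow> w \<in> B l \<Longrightarrow> \<Psi> l w \<in> V l" for \<Psi>
    proof -
      \<comment> \<open>The base tuple for \<open>circ_twin\<close> is \<open>x(i := u)\<close>, and
        the entry compared with its translate is \<open>x i\<close>.\<close>
      have 1: "T (x(i := u))" "T ((x(i := u))(i := x i))" using B upd x u i by (blast, simp)
      have 2: "\<Psi> l ((x(i := u)) l) \<in> V l" if "l < n" for l using V upd x u that by blast
      from circ_twin[where \<Psi> = \<Psi>, OF \<Psi> i 1 2] show ?thesis unfolding v_def by simp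
    qed
    have "R (x(i := v)) \<longleftrightarrow> R (x(i := x i))"
    proof
      assume "R (x(i := v))" then show "R (x(i := x i))"
        using same[OF vB x[OF i]] phi by blast
    next
      assume "R (x(i := x i))" then show "R (x(i := v))"
        using same[OF x[OF i] vB] phi by metis
    qed
    then show ?thesis by (simp add: v_def)
  qed
  interpret B: twin_block n B RB m f
  proof
    show "3 \<le> n" by (rule n3)
    have "B 0 \<subseteq> C 0" using BC n3 by auto
    then show "finite (B 0)" using finC[of 0] n3 finite_subset by auto
    show "B i \<noteq> {}" if "i < n" for i using ne that by blast
    show "RB y" if "RB x" "\<And>i. i < n \<Longrightarrow> x i = y i" for x y
      using that local[of x y] unfolding RB_def by auto
    show "x i \<in> B i" if "RB x" "i < n" for x i using that by (simp add: RB_def)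
    show "wnu_pol n B RB m f" by (rule wB)
    show "\<exists>b. RB (x(i := b))" if x: "\<And>l. l < n \<Longrightarrow> x l \<in> B l" and i: "i < n" for x i
    proof -
      obtain b where b: "R (x(i := b))" using T_ex[OF B[OF x] i] by blast
      have "b \<in> B i" by (rule max[OF x i R_T[OF b]])
      then show ?thesis using b x by (auto simp: RB_def)
    qed
    show "RB (x(i := op i u (x i))) \<longleftrightarrow> RB x" if "i < n" "u \<in> B i" "\<And>l. l < n \<Longrightarrow> x l \<in> B l" for i u x
      using tw[OF that] opB that by (auto simp: RB_def)
  qed
  obtain H :: "nat monoid" and \<theta> where H: "comm_group H" "finite (carrier H)"
    "\<And>i. i < n \<Longrightarrow> \<theta> i ` B i = carrier H"
    "\<And>x. (\<And>i. i < n \<Longrightarrow> x i \<in> B i) \<Longrightarrow> RB x \<longleftrightarrow> finprod H (\<lambda>i. \<theta> i (x i)) {..<n} = \<one>\<^bsub>H\<^esub>"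
    using B.block_group by blast
  have "linsys n B R H \<theta>"
    unfolding linsys_def
  proof (intro conjI allI impI)
    fix x assume "\<forall>i<n. x i \<in> B i"
    then show "R x \<longleftrightarrow> finprod H (\<lambda>i. \<theta> i (x i)) {..<n} = \<one>\<^bsub>H\<^esub>" using H(4)[of x] by (simp add: RB_def)
  qed (use H in auto)
  then show thesis by (rule that)
qed

lemma block_prime_group:
  assumes B: "\<And>x. (\<And>l. l < n \<Longrightarrow> x l \<in> B l) \<Longrightarrow> T x"
    and ne: "\<And>l. l < n \<Longrightarrow> y l \<in> B l"
    and max: "\<And>x i a. (\<And>l. l < n \<Longrightarrow> x l \<in> B l) \<Longrightarrow> i < n \<Longrightarrow> T (x(i := a)) \<Longrightarrow> a \<in> B i"
  obtains H :: "nat monoid" and \<theta> and p k :: nat where "linsys n B R H \<theta>" "Factorial_Ring.prime p" "order H = p ^ k"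
proof -
  obtain H :: "nat monoid" and \<theta> where L: "linsys n B R H \<theta>"
  proof (rule block_linsys[of B y])
    show "T x" if "\<And>l. l < n \<Longrightarrow> x l \<in> B l" for x by (rule B[OF that])
    show "y l \<in> B l" if "l < n" for l by (rule ne[OF that])
    show "a \<in> B i" if "\<And>l. l < n \<Longrightarrow> x l \<in> B l" "i < n" "T (x(i := a))" for x i a by (rule max[OF that])
  qed
  obtain p :: nat where p: "Factorial_Ring.prime p" "c [^]\<^bsub>G\<^esub> p = \<one>\<^bsub>G\<^esub>" by (rule c_prime_order)
  have "\<exists>k. order H = p ^ k"
  proof (rule source_prime_power[OF p L B _ ne])
    fix z assume z: "\<And>i. i < n \<Longrightarrow> z i \<in> B i" and "\<not> R z"
    then show "\<exists>\<Psi>. (\<forall>x. R x \<longrightarrow> R' (\<lambda>i. \<Psi> i (x i))) \<and> (\<forall>i<n. \<Psi> i (z i) = \<beta> i)"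
      using key[of z] T_C[OF B[OF z]] by blast
  qed
  then show thesis using L p(1) that by blast
qed

end

section \<open>Blocks of the original relation as products of slices\<close>

context key_setting
begin

definition slice where "slice x i = {a. T (x(i := a))}"

text \<open>\<open>T_square\<close> is used once in each direction along the edge. Slices are
  therefore constant on a connected component.\<close>

lemma slice_step:
  assumes "T x" "T (x(j := b))" "i < n" "j < n"
  shows "slice (x(j := b)) i = slice x i"
proof (cases "i = j")
  case True then show ?thesis by (simp add: slice_def)
next
  case False
  have "T (x(j := b, i := a))" if "T (x(i := a))" for a
    using T_square[OF assms(4,3) _ assms(1,2) that] False by simp
  moreover have "T (x(i := a))" if a: "T (x(j := b, i := a))" for a
  proof -
    have "T (x(j := b, i := a, j := x j))"
      by (rule T_square[OF assms(3,4) False assms(2) a]) (simp add: assms(1))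
    then show ?thesis by (rule T_local) (use False in auto)
  qed
  ultimately show ?thesis by (auto simp: slice_def)
qed

lemma slice_local: "(\<And>l. l < n \<Longrightarrow> x l = y l) \<Longrightarrow> i < n \<Longrightarrow> slice x i = slice y i"
  unfolding slice_def
  by (auto intro: T_local[of "x(i := _)" "y(i := _)"] T_local[of "y(i := _)" "x(i := _)"])

lemma slice_self: "T x \<Longrightarrow> x i \<in> slice x i" by (simp add: slice_def)

text \<open>The intermediate tuples are kept in the statement because they form the path through the
  block graph from \<open>x\<close> to \<open>y\<close>.\<close>

lemma slice_prefix:
  assumes x: "T x" and y: "\<And>i. i < n \<Longrightarrow> y i \<in> slice x i" and l: "l \<le> n"
  shows "T (\<lambda>i. if i < l then y i else x i)" "\<And>i. i < n \<Longrightarrow> slice (\<lambda>i. if i < l then y i else x i) i = slice x i"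
proof -
  have "T (\<lambda>i. if i < l then y i else x i) \<and> (\<forall>i<n. slice (\<lambda>i. if i < l then y i else x i) i = slice x i)"
    using l
  proof (induction l)
    case 0 show ?case using x by simp
  next
    case (Suc l)
    let ?z = "\<lambda>i. if i < l then y i else x i"
    have IH: "T ?z" "\<And>i. i < n \<Longrightarrow> slice ?z i = slice x i" and l: "l < n" using Suc by auto
    have eq: "(\<lambda>i. if i < Suc l then y i else x i) = ?z(l := y l)" by (auto simp: fun_eq_iff less_Suc_eq)
    have Tz: "T (?z(l := y l))" using y[OF l] IH(2)[OF l] by (auto simp: slice_def)
    show ?case unfolding eq using Tz slice_step[OF IH(1) Tz _ l] IH(2) by simp
  qed
  then show "T (\<lambda>i. if i < l then y i else x i)" "\<And>i. i < n \<Longrightarrow> slice (\<lambda>i. if i < l then y i else x i) i = slice x i"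
    by auto
qed

lemma slice_prod:
  assumes x: "T x" and y: "\<And>i. i < n \<Longrightarrow> y i \<in> slice x i"
  shows "T y" "\<And>i. i < n \<Longrightarrow> slice y i = slice x i"
proof -
  note p = slice_prefix[OF x y order_refl]
  show "T y" by (rule T_local[OF p(1)]) simp_all
  show "slice y i = slice x i" if "i < n" for i
    using p(2)[OF _ that] slice_local[of "\<lambda>i. if i < n then y i else x i" y i] that by simp
qed

lemma slice_prime_group:
  assumes x: "T x"
  obtains H :: "nat monoid" and \<theta> and p k :: nat where "linsys n (slice x) R H \<theta>" "Factorial_Ring.prime p" "order H = p ^ k"
proof (rule block_prime_group[of "slice x" x])
  show "T y" if "\<And>l. l < n \<Longrightarrow> y l \<in> slice x l" for y by (rule slice_prod(1)[OF x that])
  show "x l \<in> slice x l" for l by (rule slice_self[OF x])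
  show "a \<in> slice x i" if "\<And>l. l < n \<Longrightarrow> y l \<in> slice x l" "i < n" "T (y(i := a))" for y i a
    using slice_prod(2)[OF x that(1) that(2)] that(3) by (auto simp: slice_def)
qed (rule that)

end

section \<open>Existence of a rigid core\<close>

text \<open>A preserving map of minimal total image size that keeps \<beta> outside need not fix
  \<beta> or be idempotent. A key map brings \<beta> back and an iterate yields a retraction;
  neither enlarges the images, so minimality persists.\<close>

lemma (in difunctional) linear_target_exists:
  assumes wnu: "wnu_pol n C R m f" and \<beta>: "\<not> R \<beta>" "tilde n R \<beta>"
    and key: "\<And>z. (\<And>i. i < n \<Longrightarrow> z i \<in> C i) \<Longrightarrow> \<not> R z \<Longrightarrow>
      \<exists>\<Psi>. (\<forall>i<n. \<Psi> i ` C i \<subseteq> C i) \<and> (\<forall>x. R x \<longrightarrow> R (\<lambda>i. \<Psi> i (x i))) \<and> (\<forall>i<n. \<Psi> i (z i) = \<beta> i)"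
  obtains R' V and G :: "nat monoid" and \<phi> where "linear_target n R' V G \<phi> \<beta>"
    "\<And>z. (\<And>i. i < n \<Longrightarrow> z i \<in> C i) \<Longrightarrow> \<not> R z \<Longrightarrow>
      \<exists>\<Psi>. (\<forall>x. R x \<longrightarrow> R' (\<lambda>i. \<Psi> i (x i))) \<and> (\<forall>i<n. \<Psi> i (z i) = \<beta> i)"
proof -
  define good where "good e \<longleftrightarrow> (\<forall>i<n. e i ` C i \<subseteq> C i) \<and> (\<forall>x. R x \<longrightarrow> R (\<lambda>i. e i (x i))) \<and> \<not> R (\<lambda>i. e i (\<beta> i))"
    for e :: "nat \<Rightarrow> 'a \<Rightarrow> 'a"
  define size where "size e = (\<Sum>i<n. card (e i ` C i))" for e :: "nat \<Rightarrow> 'a \<Rightarrow> 'a"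
  have "good (\<lambda>i x. x)" unfolding good_def using \<beta> by simp
  then obtain e0 where e0: "good e0" and min: "\<And>e. good e \<Longrightarrow> size e0 \<le> size e"
    using ex_has_least_nat[of good _ size] by blast
  have \<beta>C: "\<beta> i \<in> C i" if "i < n" for i using T_C \<beta> that by blast
  obtain \<Psi>0 where \<Psi>0: "\<And>i. i < n \<Longrightarrow> \<Psi>0 i ` C i \<subseteq> C i" "\<And>x. R x \<Longrightarrow> R (\<lambda>i. \<Psi>0 i (x i))" "\<And>i. i < n \<Longrightarrow> \<Psi>0 i (e0 i (\<beta> i)) = \<beta> i"
    using key[of "\<lambda>i. e0 i (\<beta> i)"] e0 \<beta>C unfolding good_def by blast
  define e1 where "e1 i x = \<Psi>0 i (e0 i x)" for i x
  have e1C: "e1 i ` C i \<subseteq> C i" if "i < n" for i using \<Psi>0(1)[OF that] e0 that unfolding e1_def good_def by blast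
  have e1R: "R (\<lambda>i. e1 i (x i))" if "R x" for x
    unfolding e1_def using \<Psi>0(2)[of "\<lambda>i. e0 i (x i)"] e0 that unfolding good_def by blast
  have e1\<beta>: "e1 i (\<beta> i) = \<beta> i" if "i < n" for i using \<Psi>0(3) that by (simp add: e1_def)
  have e1card: "card (e1 i ` C i) \<le> card (e0 i ` C i)" if "i < n" for i
  proof -
    have "e1 i ` C i = \<Psi>0 i ` (e0 i ` C i)" by (auto simp: e1_def)
    then show ?thesis using card_image_le[of "e0 i ` C i" "\<Psi>0 i"] finC[OF that] by simp
  qed
  obtain N where N: "N > 0" "\<And>i x. i \<in> {..<n} \<Longrightarrow> x \<in> C i \<Longrightarrow> (e1 i ^^ N) ((e1 i ^^ N) x) = (e1 i ^^ N) x"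
    by (rule common_idempotent_power[of "{..<n}" C e1]) (use finC e1C in auto)
  define e where "e i = e1 i ^^ N" for i
  have powR: "R (\<lambda>i. (e1 i ^^ k) (x i))" if "R x" for x k
    using that by (induction k) (auto intro: e1R)
  have eC: "e i x \<in> C i" if "i < n" "x \<in> C i" for i x unfolding e_def by (rule funpow_closed[OF e1C[OF that(1)] that(2)])
  have ee: "e i (e i x) = e i x" if "i < n" "x \<in> C i" for i x using N(2) that by (simp add: e_def)
  have eR: "R (\<lambda>i. e i (x i))" if "R x" for x unfolding e_def by (rule powR[OF that])
  have e\<beta>: "e i (\<beta> i) = \<beta> i" if "i < n" for i
  proof -
    have "(e1 i ^^ k) (\<beta> i) = \<beta> i" for k by (induction k) (use e1\<beta> that in auto)
    then show ?thesis by (simp add: e_def)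
  qed
  define D where "D i = e i ` C i" for i
  have DC: "x \<in> C i" if "i < n" "x \<in> D i" for i x using that eC by (auto simp: D_def)
  have De: "e i x = x" if "i < n" "x \<in> D i" for i x using that ee by (auto simp: D_def)
  have eD: "e i x \<in> D i" if "x \<in> C i" for i x using that by (auto simp: D_def)
  have Dfin: "finite (D i)" if "i < n" for i using finC that by (simp add: D_def)
  have Dcard: "(\<Sum>i<n. card (D i)) \<le> size e0"
    unfolding size_def
  proof (rule sum_mono)
    fix i assume "i \<in> {..<n}" then have i: "i < n" by simp
    obtain N' where N': "N = Suc N'" using N(1) gr0_implies_Suc by blast
    have "D i \<subseteq> e1 i ` C i"
      unfolding D_def e_def N' using funpow_closed[OF e1C[OF i]] by auto
    then have "card (D i) \<le> card (e1 i ` C i)" using finC[OF i] by (intro card_mono) auto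
    then show "card (D i) \<le> card (e0 i ` C i)" using e1card[OF i] by simp
  qed
  define R' where "R' x \<longleftrightarrow> R x \<and> (\<forall>i<n. x i \<in> D i)" for x
  have toR': "R' (\<lambda>i. e i (x i))" if "R x" for x
    unfolding R'_def using eR[OF that] eD R_C[OF that] by simp
  have \<beta>D: "\<beta> i \<in> D i" if "i < n" for i using eD[OF \<beta>C[OF that]] e\<beta>[OF that] by simp
  \<comment> \<open>The retract need not be closed under \<open>f\<close>. Following
    \<open>f\<close> by \<open>e\<close> returns to it and keeps the WNU identities, as
    \<open>e\<close> fixes the retract; specialness may be lost and is restored afterwards.\<close>
  have fe: "wnu_pol n D R' m (\<lambda>i u. e i (f i u))"
    unfolding wnu_pol_def
  proof (intro conjI allI impI ballI)
    show "2 \<le> m" by (rule wnu_pol_arity[OF wnu])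
  next
    fix i u assume "i < n" "\<forall>p<m. u p \<in> D i"
    then show "e i (f i u) \<in> D i" by (intro eD wnu_pol_closed[OF wnu]) (use DC in auto)
  next
    fix i x u assume "i < n" "x \<in> D i" "\<forall>p<m. u p = x"
    then show "e i (f i u) = x" using wnu_pol_const[OF wnu, of i x u] De DC by simp
  next
    fix i x y q u assume a: "i < n" "x \<in> D i" "y \<in> D i" "q < m" "u q = y \<and> (\<forall>p<m. p \<noteq> q \<longrightarrow> u p = x)"
    have "f i u = circ f i x y" by (rule wnu_pol_one[OF wnu a(1) DC[OF a(1,2)] DC[OF a(1,3)] a(4)]) (use a(5) in auto)
    then show "e i (f i u) = circ (\<lambda>i u. e i (f i u)) i x y" by (simp add: circ_def)
  next
    fix r assume "\<forall>p<m. R' (r p)"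
    then show "R' (\<lambda>i. e i (f i (\<lambda>p. r p i)))"
      by (intro toR' wnu_pol_preserves[OF wnu, of r]) (auto simp: R'_def)
  qed
  obtain m' f' where f': "wnu_pol n D R' m' f'" "special n D f'"
    by (rule special_wnu_exists[OF fe Dfin])
  interpret core: rigid_core n D R' m' f' \<beta>
  proof
    show "3 \<le> n" by (rule n3)
    show "finite (D i)" if "i < n" for i by (rule Dfin[OF that])
    show "R' y" if "R' x" "\<And>i. i < n \<Longrightarrow> x i = y i" for x y
      using that local[of x y] unfolding R'_def by auto
    show "x i \<in> D i" if "R' x" "i < n" for x i using that by (simp add: R'_def)
    show "R' x" if ij: "i < n" "j < n" "i \<noteq> j" and r: "R' (x(i := b))" "R' (x(j := d))" "R' (x(i := b, j := d))" for i j x b d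
    proof -
      have "R x" using rect[OF ij] r unfolding R'_def by blast
      moreover have "x l \<in> D l" if "l < n" for l
      proof (cases "l = i")
        case True
        have "(x(j := d)) l \<in> D l" using r(2) that unfolding R'_def by blast
        then show ?thesis using True ij by simp
      next
        case False
        have "(x(i := b)) l \<in> D l" using r(1) that unfolding R'_def by blast
        then show ?thesis using False by simp
      qed
      ultimately show ?thesis by (simp add: R'_def)
    qed
    show "wnu_pol n D R' m' f'" "special n D f'" by (rule f')+
    show "\<not> R' \<beta>" using \<beta> by (simp add: R'_def)
    show "tilde n R' \<beta>"
      unfolding tilde_def
    proof (intro allI impI)
      fix i assume i: "i < n"
      then obtain b where b: "R (\<beta>(i := b))" using T_ex \<beta>(2) by blast
      have "R' (\<lambda>l. e l ((\<beta>(i := b)) l))" by (rule toR'[OF b])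
      moreover have "e l ((\<beta>(i := b)) l) = (\<beta>(i := e i b)) l" if "l < n" for l using e\<beta>[OF that] by simp
      ultimately have "R' (\<beta>(i := e i b))"
        unfolding R'_def using local[of "\<lambda>l. e l ((\<beta>(i := b)) l)" "\<beta>(i := e i b)"] by auto
      then show "\<exists>b. R' (\<beta>(i := b))" by blast
    qed
    show "inj_on (\<Phi> i) (D i)" if \<Phi>: "\<And>j. j < n \<Longrightarrow> \<Phi> j ` D j \<subseteq> D j" "\<And>x. R' x \<Longrightarrow> R' (\<lambda>j. \<Phi> j (x j))"
      and nR: "\<not> R' (\<lambda>j. \<Phi> j (\<beta> j))" and i: "i < n" for \<Phi> i
    proof -
      \<comment> \<open>Precomposing with \<open>e\<close> extends \<open>\<Phi>\<close> from the
        retract to all of \<open>C\<close>, where it competes with \<open>e0\<close>. Equality of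
        the sums of sizes then forces injectivity in every coordinate.\<close>
      define h where "h = (\<lambda>j x. \<Phi> j (e j x))"
      have "good h"
        unfolding good_def
      proof (intro conjI allI impI)
        fix j assume "j < n" then show "h j ` C j \<subseteq> C j" using \<Phi>(1) eD DC unfolding h_def by blast
      next
        fix x assume "R x"
        from \<Phi>(2)[OF toR'[OF this]] show "R (\<lambda>i. h i (x i))" by (simp add: R'_def h_def)
      next
        show "\<not> R (\<lambda>i. h i (\<beta> i))"
        proof
          assume "R (\<lambda>i. h i (\<beta> i))"
          then have "R (\<lambda>j. \<Phi> j (\<beta> j))" by (rule local) (simp add: h_def e\<beta>)
          then show False using nR \<Phi>(1) \<beta>D unfolding R'_def by blast
        qed
      qed
      then have "size e0 \<le> size h" by (rule min)
      moreover have hD: "h j ` C j = \<Phi> j ` D j" for j by (auto simp: h_def D_def)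
      ultimately have le: "(\<Sum>j<n. card (D j)) \<le> (\<Sum>j<n. card (\<Phi> j ` D j))" using Dcard by (simp add: size_def hD)
      have "card (\<Phi> i ` D i) = card (D i)"
      proof (rule ccontr)
        assume "card (\<Phi> i ` D i) \<noteq> card (D i)"
        then have "card (\<Phi> i ` D i) < card (D i)" using card_image_le[OF Dfin[OF i], of "\<Phi> i"] by simp
        then have "(\<Sum>j<n. card (\<Phi> j ` D j)) < (\<Sum>j<n. card (D j))"
          by (intro sum_strict_mono_ex1) (use i card_image_le Dfin in auto)
        then show False using le by simp
      qed
      then show ?thesis using eq_card_imp_inj_on Dfin i by blast
    qed
  qed
  obtain G :: "nat monoid" and \<phi> where L: "linsys n core.V R' G \<phi>" by (rule core.core_linsys)
  have keyC: "\<exists>\<Psi>. (\<forall>x. R x \<longrightarrow> R' (\<lambda>i. \<Psi> i (x i))) \<and> (\<forall>i<n. \<Psi> i (z i) = \<beta> i)"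
    if z: "\<And>i. i < n \<Longrightarrow> z i \<in> C i" and nR: "\<not> R z" for z
  proof -
    obtain \<Psi> where \<Psi>: "\<And>x. R x \<Longrightarrow> R (\<lambda>i. \<Psi> i (x i))" "\<And>i. i < n \<Longrightarrow> \<Psi> i (z i) = \<beta> i" using key[OF z nR] by blast
    show ?thesis
      by (rule exI[of _ "\<lambda>i x. e i (\<Psi> i x)"]) (use toR'[OF \<Psi>(1)] \<Psi>(2) e\<beta> in simp)
  qed
  have "linear_target n R' core.V G \<phi> \<beta>"
  proof
    show "3 \<le> n" by (rule n3)
    show "linsys n core.V R' G \<phi>" by (rule L)
    show "\<not> R' \<beta>" by (rule core.\<beta>_notR)
    show "\<beta> i \<in> core.V i" for i by (rule core.\<beta>_V)
    show "tilde n R' x" if "\<And>i. i < n \<Longrightarrow> x i \<in> core.V i" for x by (rule core.V_T[OF that])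
    show "a \<in> core.V i" if "\<And>l. l < n \<Longrightarrow> x l \<in> core.V l" "i < n" "tilde n R' (x(i := a))" for x i a
      by (rule core.V_step[OF that])
    show "w l \<in> core.V l" if "i < n" "j < n" "k < n" "i \<noteq> j" "i \<noteq> k" "j \<noteq> k"
      "tilde n R' w" "tilde n R' (w(i := \<beta> i))" "tilde n R' (w(j := \<beta> j))"
      "\<And>l. l < n \<Longrightarrow> l \<noteq> i \<Longrightarrow> l \<noteq> j \<Longrightarrow> l \<noteq> k \<Longrightarrow> w l = \<beta> l" "l < n" for i j k w l
      by (rule core.V_corner[OF that])
    show "\<exists>\<Psi>. (\<forall>x. R' x \<longrightarrow> R' (\<lambda>i. \<Psi> i (x i))) \<and> (\<forall>i<n. \<Psi> i (z i) = \<beta> i)"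
      if z: "\<And>i. i < n \<Longrightarrow> z i \<in> core.V i" and nR: "\<not> R' z" for z
    proof -
      have zD: "z i \<in> D i" if "i < n" for i using core.V_C[OF that z[OF that]] .
      then have "\<not> R z" using nR by (simp add: R'_def)
      from keyC[OF DC[OF _ zD] this] show ?thesis unfolding R'_def by blast
    qed
  qed
  from that[OF this keyC] show thesis by blast
qed

section \<open>Relations given by lists\<close>

lemma listset_iff: "xs \<in> listset As \<longleftrightarrow> length xs = length As \<and> (\<forall>i<length As. xs ! i \<in> As ! i)"
proof (induction As arbitrary: xs)
  case (Cons A As)
  show ?case
    by (cases xs) (auto simp: set_Cons_def Cons.IH less_Suc_eq_0_disj)
qed auto

definition fun_rel :: "nat \<Rightarrow> 'a list set \<Rightarrow> (nat \<Rightarrow> 'a) \<Rightarrow> bool" where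
  "fun_rel n \<rho> x \<longleftrightarrow> map x [0..<n] \<in> \<rho>"

lemma map_upd_upt: "i < n \<Longrightarrow> map (x(i := b)) [0..<n] = (map x [0..<n])[i := b]"
  by (rule nth_equalityI) (auto simp: nth_list_update)

lemma fun_rel_nth: "length xs = n \<Longrightarrow> fun_rel n \<rho> ((!) xs) \<longleftrightarrow> xs \<in> \<rho>"
  unfolding fun_rel_def using map_nth[of xs] by simp

lemma fun_rel_nth_upd: "length xs = n \<Longrightarrow> i < n \<Longrightarrow> fun_rel n \<rho> (((!) xs)(i := b)) \<longleftrightarrow> xs[i := b] \<in> \<rho>"
  unfolding fun_rel_def using map_nth[of xs] by (simp add: map_upd_upt)

lemma fun_rel_local: "fun_rel n \<rho> x \<Longrightarrow> (\<And>i. i < n \<Longrightarrow> x i = y i) \<Longrightarrow> fun_rel n \<rho> y"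
proof -
  assume a: "fun_rel n \<rho> x" "\<And>i. i < n \<Longrightarrow> x i = y i"
  have "map x [0..<n] = map y [0..<n]" using a(2) by simp
  then show ?thesis using a(1) unfolding fun_rel_def by (simp only:)
qed

lemma fun_rel_mem: "\<rho> \<subseteq> tuples A n \<Longrightarrow> fun_rel n \<rho> x \<Longrightarrow> i < n \<Longrightarrow> x i \<in> A"
  unfolding fun_rel_def tuples_def by (drule (1) subsetD) auto

lemma fun_rel_difunctional:
  assumes "finite A" "n \<ge> 3" "\<rho> \<subseteq> tuples A n" "full_pattern A n \<rho>"
  shows "difunctional n (\<lambda>_. A) (fun_rel n \<rho>)"
proof
  fix i j and x :: "nat \<Rightarrow> 'a" and b d
  assume ij: "i < n" "j < n" "i \<noteq> j" and r: "fun_rel n \<rho> (x(i := b))" "fun_rel n \<rho> (x(j := d))" "fun_rel n \<rho> (x(i := b, j := d))"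
  have x: "x l \<in> A" if "l < n" for l
    using fun_rel_mem[OF assms(3) r(1) that] fun_rel_mem[OF assms(3) r(2) that] ij by (auto split: if_splits)
  have bd: "b \<in> A" "d \<in> A" using fun_rel_mem[OF assms(3) r(1) ij(1)] fun_rel_mem[OF assms(3) r(2) ij(2)] by auto
  have "map x [0..<n] \<in> tuples A n" using x by (auto simp: tuples_def)
  moreover have "pattern_rel A n \<rho> i j" using assms(4) ij unfolding full_pattern_def by blast
  moreover have "(map x [0..<n])[i := b] \<in> \<rho>" "(map x [0..<n])[j := d] \<in> \<rho>" "(map x [0..<n])[i := b, j := d] \<in> \<rho>"
    using r ij unfolding fun_rel_def by (simp_all add: map_upd_upt)
  ultimately have "map x [0..<n] \<in> \<rho>" using bd unfolding pattern_rel_def by blast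
  then show "fun_rel n \<rho> x" by (simp add: fun_rel_def)
next
  show "fun_rel n \<rho> y" if "fun_rel n \<rho> x" "\<And>i. i < n \<Longrightarrow> x i = y i" for x y by (rule fun_rel_local[OF that])
qed (use assms fun_rel_mem[OF assms(3)] in auto)

lemma fun_rel_wnu:
  assumes f: "is_wnu A m f" "op_preserves n \<rho> m f"
  shows "wnu_pol n (\<lambda>_. A) (fun_rel n \<rho>) m (\<lambda>_ u. f (map u [0..<m]))"
  unfolding wnu_pol_def
proof (intro conjI allI impI ballI)
  show "2 \<le> m" using f by (simp add: is_wnu_def)
next
  fix i and u :: "nat \<Rightarrow> 'a" assume "\<forall>p<m. u p \<in> A"
  then have "map u [0..<m] \<in> tuples A m" by (auto simp: tuples_def)
  then show "f (map u [0..<m]) \<in> A" using f by (simp add: is_wnu_def)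
next
  fix x and u :: "nat \<Rightarrow> 'a" assume x: "x \<in> A" "\<forall>p<m. u p = x"
  then have "map u [0..<m] = replicate m x" by (intro nth_equalityI) auto
  then show "f (map u [0..<m]) = x" using f x by (simp add: is_wnu_def)
next
  fix i x y q and u :: "nat \<Rightarrow> 'a"
  assume a: "x \<in> A" "y \<in> A" "q < m" "u q = y \<and> (\<forall>p<m. p \<noteq> q \<longrightarrow> u p = x)"
  have "map u [0..<m] = (replicate m x)[q := y]" using a(3,4) by (intro nth_equalityI) (auto simp: nth_list_update)
  moreover have "map ((\<lambda>_. x)(0 := y)) [0..<m] = (replicate m x)[0 := y]" by (intro nth_equalityI) (auto simp: nth_list_update)
  moreover have "f ((replicate m x)[q := y]) = f ((replicate m x)[0 := y])"
    using f(1) a(1-3) unfolding is_wnu_def by blast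
  ultimately show "f (map u [0..<m]) = circ (\<lambda>_ u. f (map u [0..<m])) i x y"
    unfolding circ_def by (simp only:)
next
  fix r assume r: "\<forall>p<m. fun_rel n \<rho> (r p)"
  have "map (\<lambda>i. f (map (\<lambda>j. (map (r j) [0..<n]) ! i) [0..<m])) [0..<n] \<in> \<rho>"
    by (rule f(2)[unfolded op_preserves_def, rule_format]) (use r in \<open>simp add: fun_rel_def\<close>)
  moreover have "map (\<lambda>i. f (map (\<lambda>j. (map (r j) [0..<n]) ! i) [0..<m])) [0..<n] = map (\<lambda>i. f (map (\<lambda>p. r p i) [0..<m])) [0..<n]"
    by (intro nth_equalityI) auto
  ultimately show "fun_rel n \<rho> (\<lambda>i. f (map (\<lambda>p. r p i) [0..<m]))" by (simp add: fun_rel_def)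
qed

text \<open>\<open>\<sigma> i\<close> is the cylinder over the projection forgetting
  \<open>i\<close>. Without essential tuples the relation would be the intersection of these
  cylinders, a conjunction of relations in fewer coordinates.\<close>

lemma essential_tuple_exists:
  assumes ess: "essential_rel A n \<rho>" and \<rho>: "\<rho> \<subseteq> tuples A n"
  obtains \<gamma> where "essential_tuple A n \<rho> \<gamma>"
proof (rule ccontr)
  assume no: "\<not> thesis"
  define \<sigma> where "\<sigma> i = {x \<in> tuples A n. \<exists>b\<in>A. x[i := b] \<in> \<rho>}" for i
  have det: "determined_by A n ({0..<n} - {i}) (\<sigma> i)" for i
    unfolding determined_by_def
  proof (intro ballI impI)
    fix x y assume xy: "x \<in> tuples A n" "y \<in> tuples A n" "\<forall>l\<in>{0..<n} - {i}. x ! l = y ! l"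
    have "x[i := b] = y[i := b]" for b
    proof (rule nth_equalityI)
      show "length (x[i := b]) = length (y[i := b])" using xy by (simp add: tuples_def)
      fix l assume "l < length (x[i := b])"
      then show "x[i := b] ! l = y[i := b] ! l" using xy by (cases "l = i") (auto simp: tuples_def)
    qed
    then show "x \<in> \<sigma> i \<longleftrightarrow> y \<in> \<sigma> i" using xy by (simp add: \<sigma>_def)
  qed
  have "\<rho> = tuples A n \<inter> \<Inter> (\<sigma> ` {0..<n})"
  proof
    have "x \<in> \<sigma> i" if "x \<in> \<rho>" "i < n" for x i
    proof -
      have "x \<in> tuples A n" using \<rho> that by blast
      moreover from this have "x ! i \<in> A" using that(2) by (auto simp: tuples_def)
      moreover have "x[i := x ! i] \<in> \<rho>" using that by simp
      ultimately show ?thesis unfolding \<sigma>_def by blast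
    qed
    then show "\<rho> \<subseteq> tuples A n \<inter> \<Inter> (\<sigma> ` {0..<n})" using \<rho> by auto
    show "tuples A n \<inter> \<Inter> (\<sigma> ` {0..<n}) \<subseteq> \<rho>"
    proof
      fix x assume x: "x \<in> tuples A n \<inter> \<Inter> (\<sigma> ` {0..<n})"
      then have "\<forall>i<n. \<exists>b\<in>A. x[i := b] \<in> \<rho>" by (auto simp: \<sigma>_def)
      then show "x \<in> \<rho>" using x no that unfolding essential_tuple_def by blast
    qed
  qed
  moreover have "\<exists>S. S \<subset> {0..<n} \<and> determined_by A n S s" if "s \<in> \<sigma> ` {0..<n}" for s
    using that det by blast
  ultimately show False using ess unfolding essential_rel_def by blast
qed

lemma rho_tilde_iff:
  assumes \<rho>: "\<rho> \<subseteq> tuples A n" and n: "n \<ge> 3"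
  shows "xs \<in> rho_tilde A n \<rho> \<longleftrightarrow> length xs = n \<and> tilde n (fun_rel n \<rho>) ((!) xs)"
proof
  assume "xs \<in> rho_tilde A n \<rho>"
  then consider "xs \<in> \<rho>" | "essential_tuple A n \<rho> xs" unfolding rho_tilde_def by blast
  then show "length xs = n \<and> tilde n (fun_rel n \<rho>) ((!) xs)"
  proof cases
    case 1
    then have len: "length xs = n" using \<rho> by (auto simp: tuples_def)
    have "fun_rel n \<rho> (((!) xs)(i := xs ! i))" if "i < n" for i using 1 fun_rel_nth[OF len] by simp
    then show ?thesis using len unfolding tilde_def by blast
  next
    case 2
    then have len: "length xs = n" by (auto simp: tuples_def essential_tuple_def)
    then show ?thesis using 2 unfolding tilde_def essential_tuple_def by (auto simp: fun_rel_nth_upd)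
  qed
next
  assume a: "length xs = n \<and> tilde n (fun_rel n \<rho>) ((!) xs)"
  have ex: "\<exists>b. xs[i := b] \<in> \<rho>" if i: "i < n" for i
  proof -
    obtain b where "fun_rel n \<rho> (((!) xs)(i := b))" using a i unfolding tilde_def by blast
    then show ?thesis using fun_rel_nth_upd[OF conjunct1[OF a] i] by blast
  qed
  have upd: "set (xs[i := b]) \<subseteq> A" if "xs[i := b] \<in> \<rho>" for i b using that \<rho> by (auto simp: tuples_def)
  have exA: "\<exists>b\<in>A. xs[i := b] \<in> \<rho>" if i: "i < n" for i
  proof -
    obtain b where b: "xs[i := b] \<in> \<rho>" using ex[OF i] by blast
    have "(xs[i := b]) ! i \<in> A" using upd[OF b] a i by (metis length_list_update nth_mem subsetD)
    then show ?thesis using b a i by auto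
  qed
  have mem: "xs ! l \<in> A" if l: "l < n" for l
  proof -
    obtain i where i: "i < n" "i \<noteq> l" using n that[of 0] that[of 1] by (cases "l = 0") auto
    obtain b where b: "xs[i := b] \<in> \<rho>" using ex i by blast
    have "(xs[i := b]) ! l \<in> A" using upd[OF b] a l by (metis length_list_update nth_mem subsetD)
    then show ?thesis using i by simp
  qed
  have "xs \<in> tuples A n" using a mem by (auto simp: tuples_def in_set_conv_nth)
  then show "xs \<in> rho_tilde A n \<rho>" using exA unfolding rho_tilde_def essential_tuple_def by blast
qed

theorem mainTheorem11:
  fixes A :: "'a set" and n :: nat and \<rho> :: "'a list set"
  assumes "finite A" and "n \<ge> 3" and "\<rho> \<subseteq> tuples A n"
    and "essential_rel A n \<rho>" and "key_relation A n \<rho>"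
    and "\<exists>m f. is_wnu A m f \<and> op_preserves n \<rho> m f"
    and "full_pattern A n \<rho>"
  shows "(\<forall>B. is_block A n \<rho> B \<longrightarrow>
            (\<exists>Bs. length Bs = n \<and> (\<forall>i<n. Bs ! i \<subseteq> A) \<and> B = listset Bs))
       \<and> (\<forall>B. nontrivial_block A n \<rho> B \<longrightarrow>
            (\<exists>Bs. length Bs = n \<and> (\<forall>i<n. Bs ! i \<subseteq> A) \<and> B = listset Bs \<and>
              (\<exists>(G :: nat monoid) (p :: nat) (k :: nat) (\<phi> :: nat \<Rightarrow> 'a \<Rightarrow> nat).
                 comm_group G \<and> finite (carrier G) \<and> Factorial_Ring.prime p \<and> order G = p ^ k \<and>
                 (\<forall>i<n. \<phi> i ` (Bs ! i) = carrier G) \<and>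
                 \<rho> \<inter> B = {x \<in> B. finprod G (\<lambda>i. \<phi> i (x ! i)) {..<n} = \<one>\<^bsub>G\<^esub>})))"
proof -
  let ?R = "fun_rel n \<rho>"
  interpret D: difunctional n "\<lambda>_. A" ?R by (rule fun_rel_difunctional[OF assms(1,2,3,7)])
  obtain m0 f0 where "is_wnu A m0 f0" "op_preserves n \<rho> m0 f0" using assms(6) by blast
  from fun_rel_wnu[OF this] have w0: "wnu_pol n (\<lambda>_. A) ?R m0 (\<lambda>_ u. f0 (map u [0..<m0]))" .
  obtain m f where f: "wnu_pol n (\<lambda>_. A) ?R m f" "special n (\<lambda>_. A) f"
    by (rule special_wnu_exists[OF w0]) (use assms(1) in auto)
  obtain \<beta> where \<beta>: "\<beta> \<in> tuples A n - \<rho>" and keyl: "\<And>\<alpha>. \<alpha> \<in> tuples A n - \<rho> \<Longrightarrow>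
        \<exists>\<Psi>. vf_preserves A n \<rho> \<Psi> \<and> apply_vf n \<Psi> \<alpha> = \<beta>"
    using assms(5) unfolding key_relation_def by blast
  have key: "\<exists>\<Psi>. (\<forall>i<n. \<Psi> i ` A \<subseteq> A) \<and> (\<forall>x. ?R x \<longrightarrow> ?R (\<lambda>i. \<Psi> i (x i))) \<and> (\<forall>i<n. \<Psi> i (z i) = \<beta> ! i)"
    if z: "\<And>i. i < n \<Longrightarrow> z i \<in> A" "\<not> ?R z" for z
  proof -
    have "map z [0..<n] \<in> tuples A n - \<rho>" using z by (auto simp: tuples_def fun_rel_def)
    then obtain \<Psi> where \<Psi>: "vf_preserves A n \<rho> \<Psi>" "apply_vf n \<Psi> (map z [0..<n]) = \<beta>" using keyl by blast
    have "?R (\<lambda>i. \<Psi> i (x i))" if "?R x" for x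
    proof -
      have "apply_vf n \<Psi> (map x [0..<n]) \<in> \<rho>" using \<Psi>(1) that unfolding vf_preserves_def fun_rel_def by blast
      moreover have "apply_vf n \<Psi> (map x [0..<n]) = map (\<lambda>i. \<Psi> i (x i)) [0..<n]" unfolding apply_vf_def by (intro nth_equalityI) auto
      ultimately show ?thesis by (simp add: fun_rel_def)
    qed
    moreover have "\<Psi> i (z i) = \<beta> ! i" if "i < n" for i unfolding \<Psi>(2)[symmetric] using that by (simp add: apply_vf_def)
    ultimately show ?thesis using \<Psi>(1) unfolding vf_preserves_def by blast
  qed
  have \<beta>len: "length \<beta> = n" using \<beta> by (simp add: tuples_def)
  have \<beta>R: "\<not> ?R ((!) \<beta>)" using \<beta> \<beta>len fun_rel_nth by blast
  obtain \<gamma> where \<gamma>: "essential_tuple A n \<rho> \<gamma>" by (rule essential_tuple_exists[OF assms(4,3)])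
  have \<gamma>len: "length \<gamma> = n" and \<gamma>mem: "\<And>i. i < n \<Longrightarrow> \<gamma> ! i \<in> A" and \<gamma>R: "\<not> ?R ((!) \<gamma>)"
    using \<gamma> fun_rel_nth unfolding essential_tuple_def tuples_def by auto
  \<comment> \<open>The key tuple inherits repairs from the essential tuple \<open>\<gamma>\<close>
    through the key map that sends \<open>\<gamma>\<close> to it.\<close>
  have \<beta>T: "tilde n ?R ((!) \<beta>)"
  proof -
    obtain \<Psi> where \<Psi>: "\<And>x. ?R x \<Longrightarrow> ?R (\<lambda>i. \<Psi> i (x i))" "\<And>i. i < n \<Longrightarrow> \<Psi> i (\<gamma> ! i) = \<beta> ! i"
      using key[OF \<gamma>mem \<gamma>R] by blast
    show ?thesis
      unfolding tilde_def
    proof (intro allI impI)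
      fix i assume i: "i < n"
      then obtain b where "\<gamma>[i := b] \<in> \<rho>" using \<gamma> unfolding essential_tuple_def by blast
      then have "?R (((!) \<gamma>)(i := b))" using fun_rel_nth_upd[OF \<gamma>len i] by blast
      from \<Psi>(1)[OF this] have "?R (((!) \<beta>)(i := \<Psi> i b))" by (rule fun_rel_local) (use \<Psi>(2) in auto)
      then show "\<exists>b. ?R (((!) \<beta>)(i := b))" by blast
    qed
  qed
  obtain R' V and G :: "nat monoid" and \<phi> where tg: "linear_target n R' V G \<phi> ((!) \<beta>)"
    and tk: "\<And>z. (\<And>i. i < n \<Longrightarrow> z i \<in> A) \<Longrightarrow> \<not> ?R z \<Longrightarrow>
      \<exists>\<Psi>. (\<forall>x. ?R x \<longrightarrow> R' (\<lambda>i. \<Psi> i (x i))) \<and> (\<forall>i<n. \<Psi> i (z i) = \<beta> ! i)"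
    using D.linear_target_exists[OF f(1) \<beta>R \<beta>T key] by blast
  interpret tg: linear_target n R' V G \<phi> "(!) \<beta>" by (rule tg)
  interpret K: key_setting n "\<lambda>_. A" ?R m f R' V G \<phi> "(!) \<beta>"
    by unfold_locales (use f tk in auto)
  note tilde_iff = rho_tilde_iff[OF assms(3,2)]
  have block: "\<exists>xs. length xs = n \<and> D.T ((!) xs) \<and> (\<forall>i<n. K.slice ((!) xs) i \<subseteq> A) \<and> B = listset (map (K.slice ((!) xs)) [0..<n])"
    if B: "is_block A n \<rho> B" for B
  proof -
    obtain xs where xs: "xs \<in> rho_tilde A n \<rho>" "B = {ys. (xs, ys) \<in> (block_graph A n \<rho>)\<^sup>*}" using B unfolding is_block_def by blast
    let ?S = "K.slice ((!) xs)"
    have len: "length xs = n" and Tx: "D.T ((!) xs)" using xs(1) tilde_iff by auto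
    have SA: "?S i \<subseteq> A" if "i < n" for i
      using D.T_C[OF _ that] unfolding K.slice_def by fastforce
    \<comment> \<open>Slices are invariant along edges, so every tuple of the component has its
      entries in the slices of \<open>xs\<close>.\<close>
    have fwd: "length ys = n \<and> D.T ((!) ys) \<and> (\<forall>i<n. K.slice ((!) ys) i = ?S i)" if "(xs, ys) \<in> (block_graph A n \<rho>)\<^sup>*" for ys
      using that
    proof (induction rule: rtrancl_induct)
      case base show ?case using len Tx by simp
    next
      case (step ys zs)
      have Tz: "length zs = n" "D.T ((!) zs)" and df: "card {i. i < n \<and> ys ! i \<noteq> zs ! i} = 1"
        using step(2) tilde_iff unfolding block_graph_def differ_in_one_def by auto
      obtain j where j: "{i. i < n \<and> ys ! i \<noteq> zs ! i} = {j}" using df card_1_singletonE by blast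
      then have jn: "j < n" by auto
      have eq: "zs ! i = (((!) ys)(j := zs ! j)) i" if "i < n" for i
      proof (cases "i = j")
        case False
        then have "i \<notin> {i. i < n \<and> ys ! i \<noteq> zs ! i}" unfolding j by simp
        then show ?thesis using that False by simp
      qed simp
      have T2: "D.T (((!) ys)(j := zs ! j))" by (rule D.T_local[OF Tz(2)]) (rule eq)
      have "K.slice ((!) zs) i = ?S i" if i: "i < n" for i
      proof -
        have "K.slice ((!) zs) i = K.slice (((!) ys)(j := zs ! j)) i" by (rule K.slice_local[OF eq i])
        also have "\<dots> = K.slice ((!) ys) i" by (rule K.slice_step[OF _ T2 i jn]) (use step.IH in blast)
        finally show ?thesis using step.IH i by simp
      qed
      then show ?case using Tz by simp
    qed
    have "B = listset (map ?S [0..<n])"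
    proof
      show "B \<subseteq> listset (map ?S [0..<n])"
      proof
        fix ys assume "ys \<in> B"
        then have "(xs, ys) \<in> (block_graph A n \<rho>)\<^sup>*" using xs(2) by simp
        from fwd[OF this] have ys: "length ys = n" "D.T ((!) ys)" "\<And>i. i < n \<Longrightarrow> K.slice ((!) ys) i = ?S i" by blast+
        have "ys ! i \<in> ?S i" if "i < n" for i using K.slice_self[OF ys(2), of i] ys(3)[OF that] by simp
        then show "ys \<in> listset (map ?S [0..<n])" using ys(1) by (simp add: listset_iff)
      qed
      show "listset (map ?S [0..<n]) \<subseteq> B"
      proof
        fix ys assume "ys \<in> listset (map ?S [0..<n])"
        then have ylen: "length ys = n" and yS: "\<And>i. i < n \<Longrightarrow> ys ! i \<in> ?S i" by (auto simp: listset_iff)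
        define z where "z l = map (\<lambda>i. if i < l then ys ! i else xs ! i) [0..<n]" for l
        have zn: "z l ! i = (if i < l then ys ! i else xs ! i)" if "i < n" for l i using that by (simp add: z_def)
        have zT: "z l \<in> rho_tilde A n \<rho>" if "l \<le> n" for l
        proof -
          have "D.T ((!) (z l))"
            by (rule D.T_local[OF K.slice_prefix(1)[OF Tx yS that]]) (auto simp: z_def)
          then show ?thesis using tilde_iff by (simp add: z_def)
        qed
        have "(xs, z l) \<in> (block_graph A n \<rho>)\<^sup>*" if "l \<le> n" for l
          using that
        proof (induction l)
          case 0
          have "z 0 = xs" unfolding z_def using len map_nth[of xs] by simp
          then show ?case by simp
        next
          case (Suc l)
          \<comment> \<open>An edge needs exactly one difference, so where \<open>ys\<close> and
            \<open>xs\<close> agree the path stands still instead of taking an edge.\<close>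
          have "{i. i < n \<and> z l ! i \<noteq> z (Suc l) ! i} = (if ys ! l = xs ! l then {} else {l})"
            using Suc.prems by (auto simp: zn less_Suc_eq split: if_splits)
          then have "z l = z (Suc l) \<or> differ_in_one n (z l) (z (Suc l))"
            unfolding differ_in_one_def by (cases "ys ! l = xs ! l") (auto simp: z_def intro!: nth_equalityI)
          then have "z l = z (Suc l) \<or> (z l, z (Suc l)) \<in> block_graph A n \<rho>"
            using zT[of l] zT[of "Suc l"] Suc.prems unfolding block_graph_def by auto
          then show ?case using Suc by (auto intro: rtrancl_into_rtrancl)
        qed
        moreover have "z n = ys" unfolding z_def using ylen by (intro nth_equalityI) auto
        ultimately show "ys \<in> B" using xs(2) by auto
      qed
    qed
    then show ?thesis using len Tx SA by blast
  qed
  show ?thesis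
  proof (intro conjI allI impI)
    fix B assume "is_block A n \<rho> B"
    then obtain xs where xs: "\<forall>i<n. K.slice ((!) xs) i \<subseteq> A" "B = listset (map (K.slice ((!) xs)) [0..<n])" using block by blast
    show "\<exists>Bs. length Bs = n \<and> (\<forall>i<n. Bs ! i \<subseteq> A) \<and> B = listset Bs"
      by (rule exI[of _ "map (K.slice ((!) xs)) [0..<n]"]) (use xs in simp)
  next
    fix B assume "nontrivial_block A n \<rho> B"
    then obtain xs where len: "length xs = n" and Tx: "D.T ((!) xs)"
      and SA: "\<forall>i<n. K.slice ((!) xs) i \<subseteq> A" and Beq: "B = listset (map (K.slice ((!) xs)) [0..<n])"
      using block unfolding nontrivial_block_def by blast
    let ?S = "K.slice ((!) xs)"
    obtain H :: "nat monoid" and \<theta> and p k :: nat where L: "linsys n ?S ?R H \<theta>" and p: "Factorial_Ring.prime p" "order H = p ^ k"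
      by (rule K.slice_prime_group[OF Tx])
    have eq: "\<rho> \<inter> B = {x \<in> B. finprod H (\<lambda>i. \<theta> i (x ! i)) {..<n} = \<one>\<^bsub>H\<^esub>}"
    proof -
      have "ys \<in> \<rho> \<longleftrightarrow> finprod H (\<lambda>i. \<theta> i (ys ! i)) {..<n} = \<one>\<^bsub>H\<^esub>" if "ys \<in> B" for ys
      proof -
        have ys: "length ys = n" "\<forall>i<n. ys ! i \<in> ?S i" using that by (auto simp: Beq listset_iff)
        have "?R ((!) ys) \<longleftrightarrow> finprod H (\<lambda>i. \<theta> i (ys ! i)) {..<n} = \<one>\<^bsub>H\<^esub>" using L ys(2) unfolding linsys_def by blast
        then show ?thesis using fun_rel_nth[OF ys(1)] by blast
      qed
      then show ?thesis by auto
    qed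
    have H: "comm_group H" "finite (carrier H)" "\<forall>i<n. \<theta> i ` ?S i = carrier H" using L by (simp_all add: linsys_def)
    show "\<exists>Bs. length Bs = n \<and> (\<forall>i<n. Bs ! i \<subseteq> A) \<and> B = listset Bs \<and>
              (\<exists>(G :: nat monoid) (p :: nat) (k :: nat) (\<phi> :: nat \<Rightarrow> 'a \<Rightarrow> nat).
                 comm_group G \<and> finite (carrier G) \<and> Factorial_Ring.prime p \<and> order G = p ^ k \<and>
                 (\<forall>i<n. \<phi> i ` (Bs ! i) = carrier G) \<and>
                 \<rho> \<inter> B = {x \<in> B. finprod G (\<lambda>i. \<phi> i (x ! i)) {..<n} = \<one>\<^bsub>G\<^esub>})"
    proof (rule exI[of _ "map ?S [0..<n]"], intro conjI)
      show "length (map ?S [0..<n]) = n" by simp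
      show "\<forall>i<n. map ?S [0..<n] ! i \<subseteq> A" using SA by simp
      show "B = listset (map ?S [0..<n])" by (rule Beq)
      have "\<forall>i<n. \<theta> i ` (map ?S [0..<n] ! i) = carrier H" using H(3) by simp
      then show "\<exists>(G :: nat monoid) (p :: nat) (k :: nat) (\<phi> :: nat \<Rightarrow> 'a \<Rightarrow> nat).
                 comm_group G \<and> finite (carrier G) \<and> Factorial_Ring.prime p \<and> order G = p ^ k \<and>
                 (\<forall>i<n. \<phi> i ` (map ?S [0..<n] ! i) = carrier G) \<and>
                 \<rho> \<inter> B = {x \<in> B. finprod G (\<lambda>i. \<phi> i (x ! i)) {..<n} = \<one>\<^bsub>G\<^esub>}"
        using H(1,2) p eq by blast
    qed
  qed
qed

end
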